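(* Let $(M,g)$ be an oriented Riemannian spin $8$-manifold, let $\eta\in\Gamma(\Sigma(M)^+)$ be a unit spinor field, and let $\Omega$ be the $\mathrm{Spin}(7)$ structure defined by $\eta$. Let $D$ be the Dirac operator of the spinorial bundle $\Sigma(M)$ and let $V$ be the vector field on $M$ such that $D\eta=V\eta$. Then the $\mathrm{Spin}(7)$ structure $\Omega$ is: 1. parallel if $\nabla\eta=0$; 2. locally conformally parallel if $i(V)\Omega=28\,\mathrm{alt}(c^{-1}\nabla\eta)$; 3. balanced if $D\eta=0$.
   Context: Spinors. $(M,g)$ is an oriented Riemannian $8$-manifold with a fixed spin structure. $\Sigma(M)$ is the real spinorial bundle of rank $16$, associated to the real representation $\mathrm{Cl}_8\cong \mathrm{End}(\mathbb{R}^{16})$, with a metric $(\cdot,\cdot)$ for which Clifford multiplication by vectors is skew-symmetric; juxtaposition denotes Clifford product and $XY+YX=-2g(X,Y)$. The volume form acts with square $1$ and $\Sigma(M)=\Sigma(M)^+\oplus\Sigma(M)^-$ are its $\pm1$ eigenbundles. $X^*=g(X,\cdot)$; forms act on spinors by $X^*\phi=X\phi$ and $(X^*\wedge\beta)\phi=X(\beta\phi)+(i(X)\beta)\phi$, where $i(X)$ is contraction. $\nabla$ is the Levi-Civita connection and its lift to $\Sigma(M)$. $\mathrm{Spin}(7)$ structure of $\eta$. The triple product $X\times Y\times Z\in TM$ is defined by $(X\times Y\times Z)\eta=(X^*\wedge Y^*\wedge Z^* )\eta$, and $\Omega(W,X,Y,Z)=((X\times Y\times Z)\eta,W\eta)=\tfrac12((-WXYZ+WZYX)\eta,\eta)$.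 Pointwise the stabilizer of $\Omega$ (equivalently of $\eta$) is $\mathrm{Spin}(7)$. Form decompositions. $\Lambda^2T^*M=\Lambda^2_7\oplus\Lambda^2_{21}$, where $\Lambda^2_7$ and $\Lambda^2_{21}$ are the eigenspaces of $\beta\mapsto *(\beta\wedge\Omega)$ with eigenvalues $3$ and $-1$. $\Lambda^3T^*M=\Lambda^3_8\oplus\Lambda^3_{48}$, with $\Lambda^3_8=\{i(X)\Omega\}$ and $\Lambda^3_{48}=\ker(\cdot\wedge\Omega)$. The map $c:\Lambda^2_7T^*M\to H$, where $H=\langle\eta\rangle^\perp\subset\Sigma(M)^+$, is the isomorphism $c(\alpha)=\alpha\eta$. ($\Lambda^2_7T^*M$ is the bundle $R\times_{\mathrm{Spin}(7)}\mathfrak{spin}(7)^\perp$, with $R$ the $\mathrm{Spin}(7)$ reduction of the frame bundle.) $c^{-1}\nabla\eta$ is the tensor $(X,Y,Z)\mapsto (c^{-1}(\nabla_X\eta))(Y,Z)$, and for a covariant $n$-tensor $T$, $\mathrm{alt}(T)(X_1,\dots,X_n)=\frac1{n!}\sum_{\sigma\in S_n}\mathrm{sign}(\sigma)\,T(X_{\sigma(1)},\dots,X_{\sigma(n)})$. Types. $\Omega$ is parallel if $*d\Omega=0$; locally conformally parallel if $*d\Omega\in\Lambda^3_8T^*M$; balanced if $*d\Omega\in\Lambda^3_{48}T^*M$. *)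

theory Defs
  imports "HOL-Analysis.Analysis" "HOL-Combinatorics.Permutations"
begin

text \<open>
  An oriented Riemannian spin 8-manifold is modelled on a Hausdorff second countable type
  with an oriented smooth atlas.  Fibres of vector bundles are realised in a preferred local
  trivialisation: the tangent space at \<open>p\<close> is \<open>real^8\<close>, a vector being recorded by its
  components in the preferred chart \<open>chart_at M p\<close>, and the spinor space at \<open>p\<close> is \<open>real^16\<close>,
  a spinor being recorded in the preferred trivialisation \<open>triv_at M p\<close> of the spinor bundle.
  Since the preferred chart or trivialisation may jump with \<open>p\<close>, smoothness of a section is
  always tested after transporting it to a fixed chart or trivialisation.
\<close>


subsection \<open>Smooth functions on open sets of Euclidean spaces\<close>

fun Ck_on :: "nat \<Rightarrow> 'a::real_normed_vector set \<Rightarrow> ('a \<Rightarrow> 'b::real_normed_vector) \<Rightarrow> bool" where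
  "Ck_on 0 S f \<longleftrightarrow> continuous_on S f"
| "Ck_on (Suc n) S f \<longleftrightarrow>
     (\<forall>x\<in>S. f differentiable (at x)) \<and> (\<forall>v. Ck_on n S (\<lambda>x. frechet_derivative f (at x) v))"

definition smooth_on :: "'a::real_normed_vector set \<Rightarrow> ('a \<Rightarrow> 'b::real_normed_vector) \<Rightarrow> bool" where
  "smooth_on S f \<longleftrightarrow> (\<forall>n. Ck_on n S f)"


subsection \<open>Oriented smooth manifolds of dimension 8\<close>

type_synonym 'm chart = "'m set \<times> ('m \<Rightarrow> real^8)"

abbreviation chart_inv :: "'m chart \<Rightarrow> real^8 \<Rightarrow> 'm" where
  "chart_inv c \<equiv> inv_into (fst c) (snd c)"

definition oriented_atlas :: "'m::{t2_space, second_countable_topology} chart set \<Rightarrow> bool" where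
  "oriented_atlas A \<longleftrightarrow>
     (\<Union>c\<in>A. fst c) = UNIV \<and>
     (\<forall>c\<in>A. open (fst c) \<and> open (snd c ` fst c) \<and>
        homeomorphism (fst c) (snd c ` fst c) (snd c) (chart_inv c)) \<and>
     (\<forall>c\<in>A. \<forall>c'\<in>A.
        smooth_on (snd c ` (fst c \<inter> fst c')) (snd c' \<circ> chart_inv c) \<and>
        (\<forall>x\<in>snd c ` (fst c \<inter> fst c').
           det (matrix (frechet_derivative (snd c' \<circ> chart_inv c) (at x))) > 0))"

record 'm riemannian =
  atlas :: "'m chart set"
  metric :: "'m \<Rightarrow> real^8 \<Rightarrow> real^8 \<Rightarrow> real"

definition chart_at :: "('m, 'z) riemannian_scheme \<Rightarrow> 'm \<Rightarrow> 'm chart" where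
  "chart_at M p = (SOME c. c \<in> atlas M \<and> p \<in> fst c)"

definition smooth_map_on ::
  "('m, 'z) riemannian_scheme \<Rightarrow> 'm set \<Rightarrow> ('m \<Rightarrow> 'b::real_normed_vector) \<Rightarrow> bool" where
  "smooth_map_on M U F \<longleftrightarrow> (\<forall>c\<in>atlas M. smooth_on (snd c ` (fst c \<inter> U)) (F \<circ> chart_inv c))"

text \<open>The differential \<open>dF\<^sub>p\<close> on the tangent space at \<open>p\<close>. In particular
  \<open>differential M (snd c) p v\<close> gives the components of the tangent vector \<open>v\<close> in the chart \<open>c\<close>.\<close>

definition differential ::
  "('m, 'z) riemannian_scheme \<Rightarrow> ('m \<Rightarrow> 'b::real_normed_vector) \<Rightarrow> 'm \<Rightarrow> real^8 \<Rightarrow> 'b" where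
  "differential M F p v =
     frechet_derivative (F \<circ> chart_inv (chart_at M p)) (at (snd (chart_at M p) p)) v"

definition smooth_vector_field_on ::
  "('m, 'z) riemannian_scheme \<Rightarrow> 'm set \<Rightarrow> ('m \<Rightarrow> real^8) \<Rightarrow> bool" where
  "smooth_vector_field_on M U X \<longleftrightarrow>
     (\<forall>c\<in>atlas M. smooth_map_on M (U \<inter> fst c) (\<lambda>q. differential M (snd c) q (X q)))"

text \<open>The vector field, defined on the domain of \<open>chart_at M p\<close>, which has constant
  components \<open>v\<close> in that chart.\<close>

definition coord_field ::
  "('m, 'z) riemannian_scheme \<Rightarrow> 'm \<Rightarrow> real^8 \<Rightarrow> 'm \<Rightarrow> real^8" where
  "coord_field M p v q =
     frechet_derivative (snd (chart_at M q) \<circ> chart_inv (chart_at M p)) (at (snd (chart_at M p) q)) v"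

text \<open>\<open>[X,Y] = DY(X) - DX(Y)\<close>, computed in the coordinates \<open>chart_at M p\<close>.\<close>

definition lie_bracket ::
  "('m, 'z) riemannian_scheme \<Rightarrow> ('m \<Rightarrow> real^8) \<Rightarrow> ('m \<Rightarrow> real^8) \<Rightarrow> 'm \<Rightarrow> real^8" where
  "lie_bracket M X Y p =
     differential M (\<lambda>q. differential M (snd (chart_at M p)) q (Y q)) p (X p) -
     differential M (\<lambda>q. differential M (snd (chart_at M p)) q (X q)) p (Y p)"


subsection \<open>Riemannian metrics and the Levi-Civita connection\<close>

definition riemannian_manifold ::
  "('m::{t2_space, second_countable_topology}, 'z) riemannian_scheme \<Rightarrow> bool" where
  "riemannian_manifold M \<longleftrightarrow>
     oriented_atlas (atlas M) \<and>
     (\<forall>p. bilinear (metric M p)) \<and>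
     (\<forall>p v w. metric M p v w = metric M p w v) \<and>
     (\<forall>p v. v \<noteq> 0 \<longrightarrow> metric M p v v > 0) \<and>
     (\<forall>U X Y. open U \<and> smooth_vector_field_on M U X \<and> smooth_vector_field_on M U Y \<longrightarrow>
        smooth_map_on M U (\<lambda>q. metric M q (X q) (Y q)))"

definition oriented_orthonormal_basis ::
  "(real^8 \<Rightarrow> real^8 \<Rightarrow> real) \<Rightarrow> (8 \<Rightarrow> real^8) \<Rightarrow> bool" where
  "oriented_orthonormal_basis g b \<longleftrightarrow>
     (\<forall>i j. g (b i) (b j) = (if i = j then 1 else 0)) \<and> det (\<chi> i. b i) > 0"

text \<open>\<open>nab p v X\<close> stands for the covariant derivative at \<open>p\<close> of \<open>X\<close> in the direction \<open>v\<close>.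
  It acts on vector fields which need only be smooth on some open neighbourhood of \<open>p\<close>,
  so that it applies to local frames.\<close>

type_synonym 'm connection = "'m \<Rightarrow> real^8 \<Rightarrow> ('m \<Rightarrow> real^8) \<Rightarrow> real^8"

definition levi_civita ::
  "('m::topological_space, 'z) riemannian_scheme \<Rightarrow> 'm connection \<Rightarrow> bool" where
  "levi_civita M nab \<longleftrightarrow>
     (\<forall>U X Y f. open U \<and> smooth_vector_field_on M U X \<and> smooth_vector_field_on M U Y \<and>
                smooth_map_on M U (f :: 'm \<Rightarrow> real) \<longrightarrow>
        smooth_vector_field_on M U (\<lambda>q. nab q (X q) Y) \<and>
        (\<forall>p\<in>U.
           linear (\<lambda>v. nab p v X) \<and>
           (\<forall>v. nab p v (\<lambda>q. X q + Y q) = nab p v X + nab p v Y) \<and>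
           (\<forall>v. nab p v (\<lambda>q. f q *\<^sub>R X q) = differential M f p v *\<^sub>R X p + f p *\<^sub>R nab p v X) \<and>
           (\<forall>v. differential M (\<lambda>q. metric M q (X q) (Y q)) p v =
                  metric M p (nab p v X) (Y p) + metric M p (X p) (nab p v Y)) \<and>
           nab p (X p) Y - nab p (Y p) X = lie_bracket M X Y p))"


subsection \<open>Exterior algebra of a tangent space\<close>

text \<open>A covariant \<open>k\<close>-tensor takes a sequence of vectors as its argument and depends on the
  entries \<open>0, \<dots>, k-1\<close> only; hence equality of tensors is equality of functions.\<close>

type_synonym tensor = "(nat \<Rightarrow> real^8) \<Rightarrow> real"

definition covariant_tensor :: "nat \<Rightarrow> tensor \<Rightarrow> bool" where
  "covariant_tensor k T \<longleftrightarrow>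
     (\<forall>X Y. (\<forall>i<k. X i = Y i) \<longrightarrow> T X = T Y) \<and>
     (\<forall>X. \<forall>i<k. linear (\<lambda>v. T (X(i := v))))"

definition exterior_form :: "nat \<Rightarrow> tensor \<Rightarrow> bool" where
  "exterior_form k \<alpha> \<longleftrightarrow>
     covariant_tensor k \<alpha> \<and> (\<forall>X i j. i < j \<and> j < k \<and> X i = X j \<longrightarrow> \<alpha> X = 0)"

definition alt :: "nat \<Rightarrow> tensor \<Rightarrow> tensor" where
  "alt n T X = (\<Sum>\<sigma> | \<sigma> permutes {..<n}. of_int (sign \<sigma>) * T (\<lambda>i. X (\<sigma> i))) / fact n"

definition wedge :: "nat \<Rightarrow> nat \<Rightarrow> tensor \<Rightarrow> tensor \<Rightarrow> tensor" where
  "wedge k l \<alpha> \<beta> X =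
     fact (k + l) / (fact k * fact l) * alt (k + l) (\<lambda>Y. \<alpha> Y * \<beta> (\<lambda>i. Y (k + i))) X"

definition contract :: "real^8 \<Rightarrow> tensor \<Rightarrow> tensor" where
  "contract v \<alpha> X = \<alpha> (case_nat v X)"

definition flat :: "(real^8 \<Rightarrow> real^8 \<Rightarrow> real) \<Rightarrow> real^8 \<Rightarrow> tensor" where
  "flat g v X = g v (X 0)"

definition volume_form :: "(real^8 \<Rightarrow> real^8 \<Rightarrow> real) \<Rightarrow> (8 \<Rightarrow> real^8) \<Rightarrow> tensor" where
  "volume_form g b X =
     (\<Sum>\<sigma> | \<sigma> permutes {..<8}. of_int (sign \<sigma>) * (\<Prod>i<8. g (b (of_nat (\<sigma> i))) (X i)))"

text \<open>The Hodge star of a \<open>k\<close>-form, \<open>\<beta> \<and> *\<alpha> = \<langle>\<beta>,\<alpha>\<rangle> vol\<close>, in terms of an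
  oriented orthonormal basis \<open>b\<close>; the result does not depend on that basis.\<close>

definition hodge ::
  "(real^8 \<Rightarrow> real^8 \<Rightarrow> real) \<Rightarrow> (8 \<Rightarrow> real^8) \<Rightarrow> nat \<Rightarrow> tensor \<Rightarrow> tensor" where
  "hodge g b k \<alpha> X =
     (\<Sum>I \<in> PiE {..<k} (\<lambda>_. UNIV). \<alpha> (\<lambda>i. b (I i)) *
        volume_form g b (\<lambda>i. if i < k then b (I i) else X (i - k))) / fact k"

text \<open>\<open>(d\<omega>)(\<partial>\<^sub>0, \<dots>, \<partial>\<^sub>k) = \<Sum>\<^sub>i (-1)\<^sup>i \<partial>\<^sub>i (\<omega>(\<partial>\<^sub>0, \<dots>, \<partial>\<^sub>i omitted, \<dots>, \<partial>\<^sub>k))\<close>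
  for coordinate vector fields.\<close>

definition ext_deriv ::
  "('m, 'z) riemannian_scheme \<Rightarrow> nat \<Rightarrow> ('m \<Rightarrow> tensor) \<Rightarrow> 'm \<Rightarrow> tensor" where
  "ext_deriv M k \<omega> p X =
     (\<Sum>i\<le>k. (-1) ^ i *
        differential M (\<lambda>q. \<omega> q (\<lambda>j. coord_field M p (X (if j < i then j else Suc j)) q)) p (X i))"


subsection \<open>The Clifford algebra and the spin group\<close>

text \<open>A representation of \<open>Cl\<^sub>8\<close> on \<open>real^16\<close> by skew-symmetric matrices. As \<open>Cl\<^sub>8\<close> is
  simple of dimension \<open>16\<^sup>2\<close>, every such \<open>\<gamma>\<close> extends to an isomorphism of \<open>Cl\<^sub>8\<close> with the algebra
  of all real 16 by 16 matrices, and any two are equivalent.\<close>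

definition clifford_rep :: "(real^8 \<Rightarrow> real^16^16) \<Rightarrow> bool" where
  "clifford_rep \<gamma> \<longleftrightarrow>
     linear \<gamma> \<and>
     (\<forall>v w. \<gamma> v ** \<gamma> w + \<gamma> w ** \<gamma> v = (- 2 * (v \<bullet> w)) *\<^sub>R mat 1) \<and>
     (\<forall>v. transpose (\<gamma> v) = - \<gamma> v)"

definition volume_element :: "(real^8 \<Rightarrow> real^16^16) \<Rightarrow> real^16^16" where
  "volume_element \<gamma> = foldr (\<lambda>k A. \<gamma> (axis (of_nat k) 1) ** A) [0..<8] (mat 1)"

text \<open>\<open>Spin(8)\<close>, inside \<open>Cl\<^sub>8 = End(\<real>\<^sup>1\<^sup>6)\<close>: products of an even number of unit vectors.\<close>

inductive_set spin_group :: "(real^8 \<Rightarrow> real^16^16) \<Rightarrow> (real^16^16) set"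
  for \<gamma> :: "real^8 \<Rightarrow> real^16^16" where
  one: "mat 1 \<in> spin_group \<gamma>"
| mult: "\<lbrakk>h \<in> spin_group \<gamma>; norm u = 1; norm v = 1\<rbrakk> \<Longrightarrow> \<gamma> u ** \<gamma> v ** h \<in> spin_group \<gamma>"


subsection \<open>Spin structures and the spinor bundle\<close>

text \<open>A spin structure is given by local sections of the principal \<open>Spin(8)\<close>-bundle over an open
  cover: these project to oriented orthonormal frames \<open>frame M a\<close>, and differ on overlaps by
  \<open>Spin(8)\<close>-valued functions \<open>trans M a b\<close>, which satisfy the cocycle condition and lie over the
  transition functions of the frames.  The spinor bundle is the associated bundle with
  transition functions \<open>\<psi>\<^sub>a = trans M a b \<psi>\<^sub>b\<close>.\<close>

record ('m, 'i) spin_mfd = "'m riemannian" +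
  cliff_rep :: "real^8 \<Rightarrow> real^16^16"
  triv_dom :: "'i \<Rightarrow> 'm set"
  frame :: "'i \<Rightarrow> 'm \<Rightarrow> 8 \<Rightarrow> real^8"
  trans :: "'i \<Rightarrow> 'i \<Rightarrow> 'm \<Rightarrow> real^16^16"

definition frame_coords :: "('m, 'i) spin_mfd \<Rightarrow> 'i \<Rightarrow> 'm \<Rightarrow> real^8 \<Rightarrow> real^8" where
  "frame_coords M a p v = (\<chi> k. metric M p (frame M a p k) v)"

definition spin_manifold ::
  "('m::{t2_space, second_countable_topology}, 'i) spin_mfd \<Rightarrow> bool" where
  "spin_manifold M \<longleftrightarrow>
     riemannian_manifold M \<and>
     clifford_rep (cliff_rep M) \<and>
     (\<Union>a. triv_dom M a) = UNIV \<and>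
     (\<forall>a. open (triv_dom M a)) \<and>
     (\<forall>a k. smooth_vector_field_on M (triv_dom M a) (\<lambda>p. frame M a p k)) \<and>
     (\<forall>a. \<forall>p\<in>triv_dom M a. oriented_orthonormal_basis (metric M p) (frame M a p)) \<and>
     (\<forall>a b. smooth_map_on M (triv_dom M a \<inter> triv_dom M b) (trans M a b)) \<and>
     (\<forall>a b. \<forall>p \<in> triv_dom M a \<inter> triv_dom M b.
        trans M a b p \<in> spin_group (cliff_rep M) \<and>
        (\<forall>v. trans M a b p ** cliff_rep M (frame_coords M b p v) =
             cliff_rep M (frame_coords M a p v) ** trans M a b p)) \<and>
     (\<forall>a b c. \<forall>p \<in> triv_dom M a \<inter> triv_dom M b \<inter> triv_dom M c.
        trans M a b p ** trans M b c p = trans M a c p)"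

definition triv_at :: "('m, 'i) spin_mfd \<Rightarrow> 'm \<Rightarrow> 'i" where
  "triv_at M p = (SOME a. p \<in> triv_dom M a)"

definition frame_at :: "('m, 'i) spin_mfd \<Rightarrow> 'm \<Rightarrow> 8 \<Rightarrow> real^8" where
  "frame_at M p = frame M (triv_at M p) p"

type_synonym 'm spinor_field = "'m \<Rightarrow> real^16"

definition local_rep ::
  "('m, 'i) spin_mfd \<Rightarrow> 'm spinor_field \<Rightarrow> 'i \<Rightarrow> 'm \<Rightarrow> real^16" where
  "local_rep M \<psi> a q = trans M a (triv_at M q) q *v \<psi> q"

definition smooth_spinor_field :: "('m, 'i) spin_mfd \<Rightarrow> 'm spinor_field \<Rightarrow> bool" where
  "smooth_spinor_field M \<psi> \<longleftrightarrow> (\<forall>a. smooth_map_on M (triv_dom M a) (local_rep M \<psi> a))"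

definition cliff :: "('m, 'i) spin_mfd \<Rightarrow> 'm \<Rightarrow> real^8 \<Rightarrow> real^16 \<Rightarrow> real^16" where
  "cliff M p v \<phi> = cliff_rep M (frame_coords M (triv_at M p) p v) *v \<phi>"

text \<open>The fibre of \<open>\<Sigma>(M)\<^sup>+\<close>; since \<open>Spin(8)\<close> commutes with the volume element, the condition
  does not depend on the trivialisation.\<close>

definition positive_spinors :: "('m, 'i) spin_mfd \<Rightarrow> (real^16) set" where
  "positive_spinors M = {\<phi>. volume_element (cliff_rep M) *v \<phi> = \<phi>}"

text \<open>The lift of the connection: in the local frame \<open>e\<close> it is
  \<open>\<nabla>\<^sub>v \<psi> = d\<psi>(v) + 1/4 \<Sum>\<^sub>j\<^sub>k g(\<nabla>\<^sub>v e\<^sub>j, e\<^sub>k) e\<^sub>j e\<^sub>k \<psi>\<close>, where the commutator of the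
  zeroth order term with \<open>e\<^sub>l\<close> is \<open>\<nabla>\<^sub>v e\<^sub>l\<close> because \<open>e\<^sub>j e\<^sub>k + e\<^sub>k e\<^sub>j = -2 \<delta>\<^sub>j\<^sub>k\<close>.\<close>

definition spin_nabla ::
  "('m, 'i) spin_mfd \<Rightarrow> 'm connection \<Rightarrow> 'm \<Rightarrow> real^8 \<Rightarrow> 'm spinor_field \<Rightarrow> real^16" where
  "spin_nabla M nab p v \<psi> =
     differential M (local_rep M \<psi> (triv_at M p)) p v +
     (1/4) *\<^sub>R (\<Sum>j\<in>UNIV. \<Sum>k\<in>UNIV.
        metric M p (nab p v (\<lambda>q. frame M (triv_at M p) q j)) (frame_at M p k) *\<^sub>R
        cliff M p (frame_at M p j) (cliff M p (frame_at M p k) (\<psi> p)))"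

definition dirac ::
  "('m, 'i) spin_mfd \<Rightarrow> 'm connection \<Rightarrow> 'm spinor_field \<Rightarrow> 'm spinor_field" where
  "dirac M nab \<psi> p =
     (\<Sum>k\<in>UNIV. cliff M p (frame_at M p k) (spin_nabla M nab p (frame_at M p k) \<psi>))"

text \<open>The action of a \<open>k\<close>-form on spinors. The rule \<open>(X\<^sup>* \<and> \<beta>)\<phi> = X(\<beta>\<phi>) + (i(X)\<beta>)\<phi>\<close>, applied to
  \<open>\<beta> = 1/(k+1) \<Sum>\<^sub>j e\<^sub>j\<^sup>* \<and> i(e\<^sub>j)\<beta>\<close> for a \<open>(k+1)\<close>-form \<open>\<beta>\<close>, gives this recursion, as
  \<open>i(e\<^sub>j)i(e\<^sub>j)\<beta> = 0\<close>.\<close>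

fun form_act :: "('m, 'i) spin_mfd \<Rightarrow> 'm \<Rightarrow> nat \<Rightarrow> tensor \<Rightarrow> real^16 \<Rightarrow> real^16" where
  "form_act M p 0 \<beta> \<phi> = \<beta> (\<lambda>_. 0) *\<^sub>R \<phi>"
| "form_act M p (Suc k) \<beta> \<phi> =
     (1 / real (Suc k)) *\<^sub>R
       (\<Sum>j\<in>UNIV. cliff M p (frame_at M p j) (form_act M p k (contract (frame_at M p j) \<beta>) \<phi>))"

abbreviation star :: "('m, 'i) spin_mfd \<Rightarrow> 'm \<Rightarrow> nat \<Rightarrow> tensor \<Rightarrow> tensor" where
  "star M p \<equiv> hodge (metric M p) (frame_at M p)"


subsection \<open>The \<open>Spin(7)\<close> structure of a positive unit spinor\<close>

definition triple_product ::
  "('m, 'i) spin_mfd \<Rightarrow> 'm spinor_field \<Rightarrow> 'm \<Rightarrow> real^8 \<Rightarrow> real^8 \<Rightarrow> real^8 \<Rightarrow> real^8" where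
  "triple_product M \<eta> p X Y Z =
     (THE T. cliff M p T (\<eta> p) =
        form_act M p 3 (wedge 1 2 (flat (metric M p) X)
          (wedge 1 1 (flat (metric M p) Y) (flat (metric M p) Z))) (\<eta> p))"

definition spin7_form :: "('m, 'i) spin_mfd \<Rightarrow> 'm spinor_field \<Rightarrow> 'm \<Rightarrow> tensor" where
  "spin7_form M \<eta> p X =
     cliff M p (triple_product M \<eta> p (X 1) (X 2) (X 3)) (\<eta> p) \<bullet> cliff M p (X 0) (\<eta> p)"

definition Lambda2_7 :: "('m, 'i) spin_mfd \<Rightarrow> 'm spinor_field \<Rightarrow> 'm \<Rightarrow> tensor set" where
  "Lambda2_7 M \<eta> p =
     {\<beta>. exterior_form 2 \<beta> \<and> star M p 6 (wedge 2 4 \<beta> (spin7_form M \<eta> p)) = (\<lambda>X. 3 * \<beta> X)}"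

definition Lambda3_8 :: "('m, 'i) spin_mfd \<Rightarrow> 'm spinor_field \<Rightarrow> 'm \<Rightarrow> tensor set" where
  "Lambda3_8 M \<eta> p = {contract v (spin7_form M \<eta> p) | v. True}"

definition Lambda3_48 :: "('m, 'i) spin_mfd \<Rightarrow> 'm spinor_field \<Rightarrow> 'm \<Rightarrow> tensor set" where
  "Lambda3_48 M \<eta> p =
     {\<alpha>. exterior_form 3 \<alpha> \<and> wedge 3 4 \<alpha> (spin7_form M \<eta> p) = (\<lambda>X. 0)}"

definition c_map :: "('m, 'i) spin_mfd \<Rightarrow> 'm spinor_field \<Rightarrow> 'm \<Rightarrow> tensor \<Rightarrow> real^16" where
  "c_map M \<eta> p \<alpha> = form_act M p 2 \<alpha> (\<eta> p)"

definition c_inv :: "('m, 'i) spin_mfd \<Rightarrow> 'm spinor_field \<Rightarrow> 'm \<Rightarrow> real^16 \<Rightarrow> tensor" where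
  "c_inv M \<eta> p = inv_into (Lambda2_7 M \<eta> p) (c_map M \<eta> p)"

definition c_inv_nabla ::
  "('m, 'i) spin_mfd \<Rightarrow> 'm connection \<Rightarrow> 'm spinor_field \<Rightarrow> 'm \<Rightarrow> tensor" where
  "c_inv_nabla M nab \<eta> p X = c_inv M \<eta> p (spin_nabla M nab p (X 0) \<eta>) (\<lambda>i. X (Suc i))"

definition star_d_form :: "('m, 'i) spin_mfd \<Rightarrow> 'm spinor_field \<Rightarrow> 'm \<Rightarrow> tensor" where
  "star_d_form M \<eta> p = star M p 5 (ext_deriv M 4 (spin7_form M \<eta>) p)"

definition spin7_parallel :: "('m, 'i) spin_mfd \<Rightarrow> 'm spinor_field \<Rightarrow> bool" where
  "spin7_parallel M \<eta> \<longleftrightarrow> (\<forall>p. star_d_form M \<eta> p = (\<lambda>X. 0))"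

definition spin7_locally_conformally_parallel ::
  "('m, 'i) spin_mfd \<Rightarrow> 'm spinor_field \<Rightarrow> bool" where
  "spin7_locally_conformally_parallel M \<eta> \<longleftrightarrow> (\<forall>p. star_d_form M \<eta> p \<in> Lambda3_8 M \<eta> p)"

definition spin7_balanced :: "('m, 'i) spin_mfd \<Rightarrow> 'm spinor_field \<Rightarrow> bool" where
  "spin7_balanced M \<eta> \<longleftrightarrow> (\<forall>p. star_d_form M \<eta> p \<in> Lambda3_48 M \<eta> p)"

end

theory Submission
  imports Defs
begin

text \<open>Let \<open>A\<^sub>n\<close> be the antisymmetrised Clifford product of \<open>n\<close> vectors, so that
  \<open>\<Omega>(w,x,y,z) = \<langle>A\<^sub>3(x,y,z)\<eta>, w\<eta>\<rangle> = -\<langle>A\<^sub>4(w,x,y,z)\<eta>, \<eta>\<rangle>\<close>. The spin connection is metric and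
  satisfies the Leibniz rule for Clifford multiplication, hence
  \<open>(\<nabla>\<^sub>v\<Omega>)(w,x,y,z) = -2 \<langle>A\<^sub>4(w,x,y,z)\<eta>, \<nabla>\<^sub>v\<eta>\<rangle>\<close>, and \<open>d\<Omega>\<close> is the alternation of \<open>\<nabla>\<Omega>\<close> since
  \<open>\<nabla>\<close> is torsion free. As the volume element fixes \<open>\<eta>\<close>, every 4-form \<open>\<langle>A\<^sub>4\<eta>, \<psi>\<rangle>\<close> is self-dual,
  which turns \<open>*d\<Omega>\<close> into the contraction \<open>-2 \<Sum>\<^sub>i \<langle>A\<^sub>4(e\<^sub>i,x,y,z)\<eta>, \<nabla>\<^sub>e\<^sub>i\<eta>\<rangle>\<close>. Splitting
  \<open>A\<^sub>4(e\<^sub>i,\<dots>)\<close> into \<open>e\<^sub>i A\<^sub>3\<close> and contractions, and using that the inverse of \<open>c\<close> is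
  \<open>\<phi> \<mapsto> 1/4 \<langle>A\<^sub>2\<eta>, \<phi>\<rangle>\<close>, one obtains \<open>*d\<Omega> = 2 i(V)\<Omega> - 24 alt(c\<^sup>-\<^sup>1\<nabla>\<eta>)\<close>. The first two claims follow;
  for the third, \<open>*(*d\<Omega> \<and> \<Omega>)\<close> is a multiple of \<open>w \<mapsto> \<langle>w\<eta>, D\<eta>\<rangle>\<close>, because \<open>\<Omega>\<close> acts on 2-forms
  followed by \<open>c\<close> as multiplication by 3.\<close>

subsection \<open>Alternating tensors\<close>

text \<open>Two layers are kept apart. The algebra takes place at one point, for an abstract metric,
  frame and Clifford multiplication, with \<open>\<nabla>\<eta>\<close> present only as a linear map
  \<open>N\<close> into the positive spinors orthogonal to \<open>\<eta>\<close>. The analysis has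
  to cope with sections recorded in a preferred chart and trivialisation that may jump from point to
  point: \<open>\<Omega>\<close> is shown to have the same expression in every trivialisation, and
  near a point p it is differentiated in the chart and trivialisation preferred at p. Frame
  coordinates then carry everything to \<open>real^8\<close> with the constant Clifford
  multiplication of the representation, where only the arguments vary.

  The constant 24 is 2 * 3 * 4. The 2 comes from polarising the quadratic dependence of
  \<open>\<Omega>\<close> on \<open>\<eta>\<close>, the 3 from the average in \<open>alt\<close>,
  and 4 is 1 + 3: pairing c(\<beta>) with \<open>A2\<close> on \<open>\<eta>\<close> yields \<beta>
  plus the star of \<beta> \<and> \<Omega>, and 3 is the eigenvalue that defines
  \<open>Lambda2_7\<close>.\<close>

lemma covariant_tensor_cong:
  assumes "covariant_tensor k T" "\<And>i. i < k \<Longrightarrow> X i = Y i"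
  shows "T X = T Y"
  using assms by (auto simp: covariant_tensor_def)

lemma covariant_tensor_linear:
  "covariant_tensor k T \<Longrightarrow> i < k \<Longrightarrow> linear (\<lambda>v. T (X(i := v)))"
  by (auto simp: covariant_tensor_def)

text \<open>Polarisation in the slots \<open>i\<close> and \<open>j\<close>. Vanishing is assumed
  for this one pair of slots only, so that the lemma is available in
  \<open>exterior_form_adjacentI\<close>, before the tensor is known to be alternating.\<close>

lemma covariant_tensor_transpose:
  assumes ct: "covariant_tensor k \<alpha>" and ij: "i < k" "j < k" "i \<noteq> j"
    and z: "\<And>Y. Y i = Y j \<Longrightarrow> \<alpha> Y = 0"
  shows "\<alpha> (X \<circ> Transposition.transpose i j) = - \<alpha> X"
proof -
  define h where "h u v = \<alpha> (X(i := u, j := v))" for u v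
  have l1: "linear (h u)" for u
    unfolding h_def using covariant_tensor_linear[OF ct ij(2)] by blast
  have l2: "linear (\<lambda>u. h u v)" for v
    using covariant_tensor_linear[OF ct ij(1), of "X(j := v)"] ij(3)
    by (simp add: h_def fun_upd_twist)
  have h0: "h u u = 0" for u
    by (rule z[of "X(i := u, j := u)", folded h_def]) simp
  have "h (X i + X j) (X i + X j) = h (X i) (X i) + h (X i) (X j) + (h (X j) (X i) + h (X j) (X j))"
    by (simp add: linear_add[OF l1] linear_add[OF l2])
  then have "h (X j) (X i) = - h (X i) (X j)" by (simp add: h0)
  moreover have "X(i := X j, j := X i) = X \<circ> Transposition.transpose i j"
    by (auto simp: fun_eq_iff Transposition.transpose_def)
  moreover have "X(i := X i, j := X j) = X" by auto
  ultimately show ?thesis by (simp add: h_def)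
qed

lemma exterior_formI:
  assumes "\<And>X Y. (\<And>i. i < k \<Longrightarrow> X i = Y i) \<Longrightarrow> \<alpha> X = \<alpha> Y"
    and "\<And>X i. i < k \<Longrightarrow> linear (\<lambda>v. \<alpha> (X(i := v)))"
    and "\<And>X i j. i < j \<Longrightarrow> j < k \<Longrightarrow> X i = X j \<Longrightarrow> \<alpha> X = 0"
  shows "exterior_form k \<alpha>"
  unfolding exterior_form_def covariant_tensor_def
proof (intro conjI allI impI)
  show "\<alpha> X = \<alpha> Y" if "\<forall>i<k. X i = Y i" for X Y
    by (rule assms(1)) (simp add: that)
  show "linear (\<lambda>v. \<alpha> (X(i := v)))" if "i < k" for X i
    by (rule assms(2)) (rule that)
  show "\<alpha> X = 0" if "i < j \<and> j < k \<and> X i = X j" for X i j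
    by (rule assms(3)[of i j]) (simp_all add: that)
qed

lemma exterior_form_vanish:
  "exterior_form k \<alpha> \<Longrightarrow> i < j \<Longrightarrow> j < k \<Longrightarrow> X i = X j \<Longrightarrow> \<alpha> X = 0"
  by (auto simp: exterior_form_def)

lemma exterior_form_transpose:
  assumes \<alpha>: "exterior_form k \<alpha>" and ij: "i < k" "j < k" "i \<noteq> j"
  shows "\<alpha> (X \<circ> Transposition.transpose i j) = - \<alpha> X"
proof (rule covariant_tensor_transpose[OF _ ij])
  show "covariant_tensor k \<alpha>" using \<alpha> by (simp add: exterior_form_def)
  show "\<alpha> Y = 0" if "Y i = Y j" for Y
    using exterior_form_vanish[OF \<alpha>, of i j Y] exterior_form_vanish[OF \<alpha>, of j i Y] ij that
    by (cases i j rule: linorder_cases) simp_all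
qed

lemma exterior_form_permute:
  assumes \<alpha>: "exterior_form k \<alpha>" and "\<sigma> permutes {..<k}"
  shows "\<alpha> (X \<circ> \<sigma>) = of_int (sign \<sigma>) * \<alpha> X"
  using assms(2) finite_lessThan[of k]
proof (induction arbitrary: X rule: permutes_induct)
  case id
  then show ?case by simp
next
  case (swap a b p)
  have "\<alpha> (X \<circ> (Transposition.transpose a b \<circ> p)) = of_int (sign p) * \<alpha> (X \<circ> Transposition.transpose a b)"
    using swap.IH[of "X \<circ> Transposition.transpose a b"] by (simp only: comp_assoc)
  also have "\<dots> = - of_int (sign p) * \<alpha> X"
    using exterior_form_transpose[OF \<alpha>, of a b X] swap by simp
  also have "- of_int (sign p) = (of_int (sign (Transposition.transpose a b \<circ> p)) :: real)"
    using swap by (subst sign_compose)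
      (auto simp: sign_swap_id permutation_swap_id intro: permutes_imp_permutation[of "{..<k}"])
  finally show ?case .
qed

text \<open>The recursion of \<open>aprod\<close> exposes only neighbouring entries, so its
  alternation is checked there. A swap of neighbours moves the second of two equal entries one place
  to the left until the two meet.\<close>

lemma exterior_form_adjacentI:
  assumes ct: "covariant_tensor k \<alpha>"
    and adj: "\<And>X i. Suc i < k \<Longrightarrow> X i = X (Suc i) \<Longrightarrow> \<alpha> X = 0"
  shows "exterior_form k \<alpha>"
proof -
  have sw: "\<alpha> (X \<circ> Transposition.transpose i (Suc i)) = - \<alpha> X" if "Suc i < k" for X i
    by (rule covariant_tensor_transpose[OF ct]) (use that adj in auto)
  have "\<alpha> X = 0" if "j < k" "i < j" "X i = X j" for X i j
    using that
  proof (induction j arbitrary: X)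
    case (Suc j)
    show ?case
    proof (cases "i = j")
      case True
      then show ?thesis using adj[of i X] Suc by simp
    next
      case False
      then have "\<alpha> (X \<circ> Transposition.transpose j (Suc j)) = 0"
        using Suc by (intro Suc.IH) (auto simp: Transposition.transpose_def)
      then show ?thesis using sw[of j X] Suc by simp
    qed
  qed simp
  with ct show ?thesis by (auto simp: exterior_form_def)
qed

text \<open>Multi-indices are lists, so that splitting off a first entry or a first block is
  concatenation, and \<open>nth\<close> turns a list of vectors into an argument of a tensor, which
  does not read entries past its degree.\<close>

definition basis_lists :: "nat \<Rightarrow> 'a::finite list set" where
  "basis_lists k = {xs. length xs = k}"

lemma finite_basis_lists [simp]: "finite (basis_lists k :: 'a::finite list set)"
  using finite_lists_length_eq[of "UNIV :: 'a set" k] by (simp add: basis_lists_def)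

lemma basis_lists_0 [simp]: "basis_lists 0 = {[]}"
  by (auto simp: basis_lists_def)

lemma sum_basis_lists_Suc:
  "(\<Sum>xs\<in>basis_lists (Suc k). f xs) = (\<Sum>j\<in>UNIV. \<Sum>xs\<in>basis_lists k. f (j # xs))"
  unfolding sum.cartesian_product
  by (rule sum.reindex_bij_witness[of _ "\<lambda>(j, xs). j # xs" "\<lambda>xs. (hd xs, tl xs)"])
     (auto simp: basis_lists_def length_Suc_conv)

lemma sum_basis_lists_add:
  "(\<Sum>xs\<in>basis_lists (k + l). f xs) = (\<Sum>xs\<in>basis_lists k. \<Sum>ys\<in>basis_lists l. f (xs @ ys))"
  unfolding sum.cartesian_product
  by (rule sum.reindex_bij_witness[of _ "\<lambda>(xs, ys). xs @ ys" "\<lambda>xs. (take k xs, drop k xs)"])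
     (auto simp: basis_lists_def)

lemma sum_PiE_basis_lists:
  fixes f :: "'a::finite list \<Rightarrow> 'b::comm_monoid_add"
  shows "(\<Sum>I\<in>PiE {..<k} (\<lambda>_. UNIV). f (map I [0..<k])) = (\<Sum>xs\<in>basis_lists k. f xs)"
proof (rule sum.reindex_bij_witness[of _ "\<lambda>xs. restrict (nth xs) {..<k}" "\<lambda>I. map I [0..<k]"])
  fix I :: "nat \<Rightarrow> 'a" assume I: "I \<in> PiE {..<k} (\<lambda>_. UNIV)"
  show "restrict (nth (map I [0..<k])) {..<k} = I"
  proof
    fix i show "restrict (nth (map I [0..<k])) {..<k} i = I i"
      using PiE_arb[OF I, of i] by (cases "i < k") simp_all
  qed
  show "map I [0..<k] \<in> basis_lists k" by (simp add: basis_lists_def)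
next
  fix xs :: "'a list" assume "xs \<in> basis_lists k"
  then show "map (restrict (nth xs) {..<k}) [0..<k] = xs"
    by (intro nth_equalityI) (simp_all add: basis_lists_def)
  show "restrict (nth xs) {..<k} \<in> PiE {..<k} (\<lambda>_. UNIV)" by simp
qed simp

text \<open>The vector \<open>a\<close> jumps over one entry of \<open>bs\<close> at a time; the
  bound on \<open>length xs + length bs\<close> keeps every swapped position below \<open>k\<close>,
  where alternation holds.\<close>

lemma exterior_form_move:
  assumes \<alpha>: "exterior_form k \<alpha>"
  shows "k \<le> length (xs @ a # bs @ ys) \<Longrightarrow> length xs + length bs < k \<Longrightarrow>
    \<alpha> (nth (xs @ a # bs @ ys)) = (-1) ^ length bs * \<alpha> (nth (xs @ bs @ a # ys))"
proof (induction bs arbitrary: xs)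
  case Nil
  then show ?case by simp
next
  case (Cons b bs)
  let ?n = "length xs"
  have "\<alpha> (nth (xs @ a # b # bs @ ys)) = \<alpha> (nth (xs @ b # a # bs @ ys) \<circ> Transposition.transpose ?n (Suc ?n))"
    using \<alpha> Cons.prems
    by (intro arg_cong[of _ _ \<alpha>])
       (auto simp: fun_eq_iff nth_append Transposition.transpose_def nth_Cons split: nat.splits)
  also have "\<dots> = - \<alpha> (nth (xs @ b # a # bs @ ys))"
    using Cons.prems by (intro exterior_form_transpose[OF \<alpha>]) auto
  also have "\<alpha> (nth (xs @ b # a # bs @ ys)) = (-1) ^ length bs * \<alpha> (nth (xs @ b # bs @ a # ys))"
    using Cons.IH[of "xs @ [b]"] Cons.prems by simp
  finally show ?case by simp
qed

lemma exterior_form_move_block: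
  assumes \<alpha>: "exterior_form k \<alpha>"
  shows "k \<le> length (xs @ as @ bs @ ys) \<Longrightarrow> length (xs @ as @ bs) \<le> k \<Longrightarrow>
    \<alpha> (nth (xs @ as @ bs @ ys)) = (-1) ^ (length as * length bs) * \<alpha> (nth (xs @ bs @ as @ ys))"
proof (induction as arbitrary: xs)
  case Nil
  then show ?case by simp
next
  case (Cons a as)
  have "\<alpha> (nth (xs @ (a # as) @ bs @ ys)) = (-1) ^ (length as * length bs) * \<alpha> (nth (xs @ a # bs @ as @ ys))"
    using Cons.IH[of "xs @ [a]"] Cons.prems by simp
  also have "\<alpha> (nth (xs @ a # bs @ as @ ys)) = (-1) ^ length bs * \<alpha> (nth (xs @ bs @ a # as @ ys))"
    using Cons.prems by (intro exterior_form_move[OF \<alpha>]) auto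
  finally show ?case by (simp add: power_add)
qed

lemma multilinear_expand:
  fixes \<alpha> :: tensor and e :: "'a::finite \<Rightarrow> real^8" and c :: "nat \<Rightarrow> 'a \<Rightarrow> real"
  assumes ct: "covariant_tensor k \<alpha>" and X: "\<And>i. i < k \<Longrightarrow> X i = (\<Sum>j\<in>UNIV. c i j *\<^sub>R e j)"
  shows "\<alpha> X = (\<Sum>I\<in>PiE {..<k} (\<lambda>_. UNIV). (\<Prod>i<k. c i (I i)) * \<alpha> (\<lambda>i. e (I i)))"
proof -
  \<comment> \<open>Induction on the number \<open>m\<close> of slots already expanded in
    \<open>e\<close>; the later slots still hold \<open>X\<close>.\<close>
  have "\<alpha> X = (\<Sum>I\<in>PiE {..<m} (\<lambda>_. UNIV). (\<Prod>i<m. c i (I i)) * \<alpha> (\<lambda>i. if i < m then e (I i) else X i))"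
    if "m \<le> k" for m
    using that
  proof (induction m)
    case 0
    then show ?case by simp
  next
    case (Suc m)
    have st: "\<alpha> (\<lambda>i. if i < m then e (I i) else X i) =
        (\<Sum>j\<in>UNIV. c m j * \<alpha> ((\<lambda>i. if i < m then e (I i) else X i)(m := e j)))" for I
    proof -
      let ?Y = "\<lambda>i. if i < m then e (I i) else X i"
      have l: "linear (\<lambda>v. \<alpha> (?Y(m := v)))" using covariant_tensor_linear[OF ct] Suc.prems by simp
      have "\<alpha> ?Y = \<alpha> (?Y(m := (\<Sum>j\<in>UNIV. c m j *\<^sub>R e j)))"
        using X[of m] Suc.prems by (intro arg_cong[of _ _ \<alpha>]) auto
      also have "\<dots> = (\<Sum>j\<in>UNIV. c m j * \<alpha> (?Y(m := e j)))"
        by (subst linear_sum[OF l]) (simp add: linear_cmul[OF l])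
      finally show ?thesis .
    qed
    have "\<alpha> X = (\<Sum>I\<in>PiE {..<m} (\<lambda>_. UNIV). \<Sum>j\<in>UNIV. (\<Prod>i<m. c i (I i)) *
        (c m j * \<alpha> ((\<lambda>i. if i < m then e (I i) else X i)(m := e j))))"
      using Suc by (subst Suc.IH) (simp_all add: st sum_distrib_left)
    also have "\<dots> = (\<Sum>I\<in>PiE {..<Suc m} (\<lambda>_. UNIV). (\<Prod>i<Suc m. c i (I i)) *
        \<alpha> (\<lambda>i. if i < Suc m then e (I i) else X i))"
      unfolding sum.cartesian_product
    \<comment> \<open>\<open>restrict\<close> resets slot \<open>m\<close> to
      \<open>undefined\<close>, the value that \<open>PiE {..<m}\<close> demands outside its
      domain.\<close>
    proof (rule sum.reindex_bij_witness[of _ "\<lambda>I. (restrict I {..<m}, I m)" "\<lambda>(I, j). I(m := j)"], goal_cases)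
      case (1 a)
      then show ?case by (auto simp: fun_eq_iff PiE_def extensional_def restrict_def)
    next
      case (2 a)
      then show ?case by (auto simp: PiE_def extensional_def)
    next
      case (3 b)
      then show ?case by (auto simp: fun_eq_iff PiE_def extensional_def restrict_def)
    next
      case (4 b)
      then show ?case by auto
    next
      case (5 a)
      then obtain I j where a: "a = (I, j)" by force
      have "(\<lambda>i. if i < m then e (I i) else X i)(m := e j) = (\<lambda>i. if i < Suc m then e ((I(m := j)) i) else X i)"
        by (auto simp: fun_eq_iff less_Suc_eq)
      then show ?case unfolding a prod.case by (simp add: mult.assoc)
    qed
    finally show ?case .
  qed
  from this[of k] have "\<alpha> X = (\<Sum>I\<in>PiE {..<k} (\<lambda>_. UNIV). (\<Prod>i<k. c i (I i)) *
      \<alpha> (\<lambda>i. if i < k then e (I i) else X i))" by simp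
  also have "\<dots> = (\<Sum>I\<in>PiE {..<k} (\<lambda>_. UNIV). (\<Prod>i<k. c i (I i)) * \<alpha> (\<lambda>i. e (I i)))"
    by (intro sum.cong refl arg_cong2[of _ _ _ _ "(*)"] covariant_tensor_cong[OF ct]) auto
  finally show ?thesis .
qed

section \<open>Alternation and the wedge product\<close>

lemma alt_cong:
  assumes "\<And>X Y. (\<And>i. i < n \<Longrightarrow> X i = Y i) \<Longrightarrow> T X = T Y" "\<And>i. i < n \<Longrightarrow> X i = Y i"
  shows "alt n T X = alt n T Y"
proof -
  have "T (\<lambda>i. X (\<sigma> i)) = T (\<lambda>i. Y (\<sigma> i))" if "\<sigma> permutes {..<n}" for \<sigma>
    using permutes_in_image[OF that] assms(2) by (intro assms(1)) auto
  then show ?thesis unfolding alt_def by (intro arg_cong2[of _ _ _ _ "(/)"] sum.cong) auto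
qed

lemma alt_permute:
  assumes \<tau>: "\<tau> permutes {..<n}"
  shows "alt n T (X \<circ> \<tau>) = of_int (sign \<tau>) * alt n T X"
proof -
  have "(\<Sum>\<sigma> | \<sigma> permutes {..<n}. of_int (sign \<sigma>) * T (\<lambda>i. (X \<circ> \<tau>) (\<sigma> i)))
      = (\<Sum>\<sigma> | \<sigma> permutes {..<n}. of_int (sign \<tau>) * (of_int (sign (\<tau> \<circ> \<sigma>)) * T (\<lambda>i. X ((\<tau> \<circ> \<sigma>) i))))"
  proof (intro sum.cong refl)
    fix \<sigma> assume "\<sigma> \<in> {\<sigma>. \<sigma> permutes {..<n}}"
    then have "sign (\<tau> \<circ> \<sigma>) = sign \<tau> * sign \<sigma>"
      using \<tau> by (intro sign_compose) (auto intro: permutes_imp_permutation[of "{..<n}"])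
    then have "sign \<sigma> = sign \<tau> * sign (\<tau> \<circ> \<sigma>)" by simp
    then have r: "real_of_int (sign \<sigma>) = of_int (sign \<tau>) * of_int (sign (\<tau> \<circ> \<sigma>))"
      using of_int_mult by metis
    then show "of_int (sign \<sigma>) * T (\<lambda>i. (X \<circ> \<tau>) (\<sigma> i)) =
        of_int (sign \<tau>) * (of_int (sign (\<tau> \<circ> \<sigma>)) * T (\<lambda>i. X ((\<tau> \<circ> \<sigma>) i)))"
      by (simp only: r mult.assoc comp_apply)
  qed
  also have "\<dots> = (\<Sum>\<sigma> | \<sigma> permutes {..<n}. of_int (sign \<tau>) * (of_int (sign \<sigma>) * T (\<lambda>i. X (\<sigma> i))))"
    by (subst setum_permutations_compose_left[OF \<tau>, of "\<lambda>\<sigma>. of_int (sign \<tau>) * (of_int (sign \<sigma>) * T (\<lambda>i. X (\<sigma> i)))"]) simp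
  finally show ?thesis by (simp add: alt_def sum_distrib_left)
qed

lemma covariant_tensor_alt:
  assumes T: "covariant_tensor n T"
  shows "covariant_tensor n (alt n T)"
  unfolding covariant_tensor_def
proof (intro conjI allI impI)
  fix X Y :: "nat \<Rightarrow> real^8" assume "\<forall>i<n. X i = Y i"
  then show "alt n T X = alt n T Y"
    by (intro alt_cong covariant_tensor_cong[OF T]) auto
next
  fix X :: "nat \<Rightarrow> real^8" and i assume i: "i < n"
  have l: "linear (\<lambda>v. T (\<lambda>j. (X(i := v)) (\<sigma> j)))" if \<sigma>: "\<sigma> permutes {..<n}" for \<sigma>
  proof -
    have "(\<lambda>j. (X(i := v)) (\<sigma> j)) = (\<lambda>j. X (\<sigma> j))(inv \<sigma> i := v)" for v
      using permutes_inverses[OF \<sigma>] by (auto simp: fun_eq_iff)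
    moreover have "inv \<sigma> i < n"
      using permutes_in_image[OF permutes_inv[OF \<sigma>], of i] i by simp
    ultimately show ?thesis using covariant_tensor_linear[OF T] by simp
  qed
  have "linear (\<lambda>v. \<Sum>\<sigma> | \<sigma> permutes {..<n}. (of_int (sign \<sigma>) / fact n) *\<^sub>R T (\<lambda>j. (X(i := v)) (\<sigma> j)))"
    by (intro linear_compose_sum ballI linear_compose_scale_right l) simp
  then show "linear (\<lambda>v. alt n T (X(i := v)))"
    unfolding alt_def by (simp add: sum_divide_distrib)
qed

lemma exterior_form_alt:
  assumes T: "covariant_tensor n T"
  shows "exterior_form n (alt n T)"
  unfolding exterior_form_def
proof (intro conjI allI impI covariant_tensor_alt[OF T])
  fix X :: "nat \<Rightarrow> real^8" and i j assume ij: "i < j \<and> j < n \<and> X i = X j"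
  have "Transposition.transpose i j permutes {..<n}" using ij by (intro permutes_swap_id) auto
  from alt_permute[OF this, of T X] have "alt n T (X \<circ> Transposition.transpose i j) = - alt n T X"
    using ij by (simp add: sign_swap_id)
  moreover have "X \<circ> Transposition.transpose i j = X"
    using ij by (auto simp: fun_eq_iff Transposition.transpose_def)
  ultimately show "alt n T X = 0" by simp
qed

lemma covariant_tensor_product:
  assumes \<alpha>: "covariant_tensor k \<alpha>" and \<beta>: "covariant_tensor l \<beta>"
  shows "covariant_tensor (k + l) (\<lambda>Y. \<alpha> Y * \<beta> (\<lambda>i. Y (k + i)))"
  unfolding covariant_tensor_def
proof (intro conjI allI impI)
  fix X Y :: "nat \<Rightarrow> real^8" assume "\<forall>i<k + l. X i = Y i"
  then show "\<alpha> X * \<beta> (\<lambda>i. X (k + i)) = \<alpha> Y * \<beta> (\<lambda>i. Y (k + i))"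
    by (intro arg_cong2[of _ _ _ _ "(*)"] covariant_tensor_cong[OF \<alpha>] covariant_tensor_cong[OF \<beta>]) auto
next
  fix X :: "nat \<Rightarrow> real^8" and i assume i: "i < k + l"
  show "linear (\<lambda>v. \<alpha> (X(i := v)) * \<beta> (\<lambda>j. (X(i := v)) (k + j)))"
  proof (cases "i < k")
    case True
    have 1: "\<beta> (\<lambda>j. (X(i := v)) (k + j)) = \<beta> (\<lambda>j. X (k + j))" for v using True by simp
    show ?thesis using covariant_tensor_linear[OF \<alpha> True, of X]
      unfolding 1 by (auto simp: linear_iff algebra_simps)
  next
    case False
    have 1: "\<alpha> (X(i := v)) = \<alpha> X" for v
      using False by (intro covariant_tensor_cong[OF \<alpha>]) auto
    have 2: "(\<lambda>j. (X(i := v)) (k + j)) = (\<lambda>j. X (k + j))(i - k := v)" for v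
      using False by (auto simp: fun_eq_iff)
    show ?thesis using covariant_tensor_linear[OF \<beta>, of "i - k" "\<lambda>j. X (k + j)"] False i
      unfolding 1 2 by (auto simp: linear_iff algebra_simps)
  qed
qed

lemma exterior_form_scale:
  assumes \<alpha>: "exterior_form k \<alpha>"
  shows "exterior_form k (\<lambda>X. c * \<alpha> X)"
proof -
  have "linear (\<lambda>v. c * \<alpha> (X(i := v)))" if "i < k" for X i
    using linear_compose_scale_right[of "\<lambda>v. \<alpha> (X(i := v))" c] \<alpha> that
    by (auto simp: exterior_form_def covariant_tensor_def)
  then show ?thesis
    using \<alpha> unfolding exterior_form_def covariant_tensor_def by (metis mult_zero_right)
qed

lemma exterior_form_wedge:
  assumes "covariant_tensor k \<alpha>" "covariant_tensor l \<beta>"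
  shows "exterior_form (k + l) (wedge k l \<alpha> \<beta>)"
  unfolding wedge_def
  by (intro exterior_form_scale exterior_form_alt covariant_tensor_product assms)

lemma alt_3:
  "alt 3 (\<lambda>X. f (X 0) (X 1) (X 2)) X =
    (f (X 0) (X 1) (X 2) - f (X 0) (X 2) (X 1) - f (X 1) (X 0) (X 2) - f (X 2) (X 1) (X 0)
     + f (X 1) (X 2) (X 0) + f (X 2) (X 0) (X 1)) / 6"
proof -
  have 1: "{..<3} = {0, 1, 2 :: nat}" by auto
  have f12: "finite {1, 2::nat}" "0 \<notin> {1, 2::nat}" by auto
  have f2: "finite {2::nat}" "1 \<notin> {2::nat}" by auto
  show ?thesis
    unfolding alt_def 1
    unfolding sum_over_permutations_insert[OF f12]
    unfolding sum_over_permutations_insert[OF f2]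
    unfolding permutes_sing
    by (simp add: sign_swap_id permutation_swap_id sign_compose Transposition.transpose_def fact_numeral)
qed

lemma alt_2:
  "alt 2 (\<lambda>X. f (X 0) (X 1)) X = (f (X 0) (X 1) - f (X 1) (X 0)) / 2"
proof -
  have 1: "{..<2} = {0, 1 :: nat}" by auto
  have f2: "finite {1::nat}" "0 \<notin> {1::nat}" by auto
  show ?thesis
    unfolding alt_def 1
    unfolding sum_over_permutations_insert[OF f2]
    unfolding permutes_sing
    by (simp add: sign_swap_id permutation_swap_id sign_compose Transposition.transpose_def fact_numeral)
qed

section \<open>The Hodge star of permuted and alternated tensors\<close>

lemma hodge_permute:
  assumes vol: "exterior_form 8 (volume_form g b)" and \<sigma>: "\<sigma> permutes {..<k}" and k: "k \<le> 8"
  shows "hodge g b k (\<lambda>Y. T (Y \<circ> \<sigma>)) X = of_int (sign \<sigma>) * hodge g b k T X"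
proof -
  let ?P = "PiE {..<k} (\<lambda>_. UNIV) :: (nat \<Rightarrow> 8) set"
  let ?W = "\<lambda>I i. if i < k then b (I i) else X (i - k)"
  note inv = permutes_inverses[OF \<sigma>] and inv\<sigma> = permutes_inv[OF \<sigma>]
  have img: "\<sigma> i < k \<longleftrightarrow> i < k" "inv \<sigma> i < k \<longleftrightarrow> i < k" for i
    using permutes_in_image[OF \<sigma>, of i] permutes_in_image[OF inv\<sigma>, of i] by auto
  have out: "\<sigma> i = i" "inv \<sigma> i = i" if "\<not> i < k" for i
    using permutes_not_in[OF \<sigma>, of i] permutes_not_in[OF inv\<sigma>, of i] that by auto
  \<comment> \<open>Relabelling the multi-index by the inverse permutation permutes the first
    \<open>k\<close> slots of the volume form, which costs the sign of \<sigma>.\<close>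
  have W: "volume_form g b (?W (I \<circ> inv \<sigma>)) = of_int (sign \<sigma>) * volume_form g b (?W I)" for I
  proof -
    have eq: "?W (I \<circ> inv \<sigma>) = ?W I \<circ> inv \<sigma>" using img out by (auto simp: fun_eq_iff)
    have p: "inv \<sigma> permutes {..<8}" using permutes_subset[OF inv\<sigma>] k by auto
    have "sign (inv \<sigma>) = sign \<sigma>"
      using \<sigma> by (intro sign_inverse permutes_imp_permutation[of "{..<k}"]) auto
    then show ?thesis unfolding eq exterior_form_permute[OF vol p] by (rule arg_cong)
  qed
  have "(\<Sum>I\<in>?P. T ((\<lambda>i. b (I i)) \<circ> \<sigma>) * volume_form g b (?W I)) =
        (\<Sum>I\<in>?P. T (\<lambda>i. b (I i)) * volume_form g b (?W (I \<circ> inv \<sigma>)))"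
  proof (rule sum.reindex_bij_witness[of _ "\<lambda>I. I \<circ> inv \<sigma>" "\<lambda>I. I \<circ> \<sigma>"])
    fix I assume I: "I \<in> ?P"
    show *: "I \<circ> \<sigma> \<circ> inv \<sigma> = I" "I \<circ> inv \<sigma> \<circ> \<sigma> = I" using inv by (auto simp: fun_eq_iff)
    show "I \<circ> \<sigma> \<in> ?P" "I \<circ> inv \<sigma> \<in> ?P"
      using PiE_arb[OF I] img out by (auto simp: PiE_def extensional_def)
    show "T (\<lambda>i. b ((I \<circ> \<sigma>) i)) * volume_form g b (?W (I \<circ> \<sigma> \<circ> inv \<sigma>)) =
      T ((\<lambda>i. b (I i)) \<circ> \<sigma>) * volume_form g b (?W I)"
      unfolding * by (simp add: comp_def)
  qed
  also have "\<dots> = (\<Sum>I\<in>?P. T (\<lambda>i. b (I i)) * (of_int (sign \<sigma>) * volume_form g b (?W I)))"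
    by (simp only: W)
  finally show ?thesis
    by (simp add: hodge_def sum_distrib_left mult.assoc mult.left_commute)
qed

lemma hodge_cmult: "hodge g b k (\<lambda>Y. c * T Y) X = c * hodge g b k T X"
  by (simp add: hodge_def sum_distrib_left mult.assoc)

lemma hodge_sum: "hodge g b k (\<lambda>Y. \<Sum>a\<in>A. T a Y) X = (\<Sum>a\<in>A. hodge g b k (T a) X)"
  unfolding hodge_def sum_distrib_right sum_divide_distrib by (rule sum.swap)

text \<open>The star sums over all multi-indices against the alternating volume form and thereby
  antisymmetrises on its own: by \<open>hodge_permute\<close> the signs cancel and the
  \<open>fact k\<close> terms agree. The star of a wedge product can thus be computed from a single
  unalternated product.\<close>

lemma hodge_alt:
  assumes vol: "exterior_form 8 (volume_form g b)" and k: "k \<le> 8"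
  shows "hodge g b k (alt k T) X = hodge g b k T X"
proof -
  have "hodge g b k (alt k T) X = (1 / fact k) * (\<Sum>\<sigma> | \<sigma> permutes {..<k}.
      of_int (sign \<sigma>) * hodge g b k (\<lambda>Y. T (Y \<circ> \<sigma>)) X)"
  proof -
    have "alt k T = (\<lambda>Y. (1 / fact k) * (\<Sum>\<sigma> | \<sigma> permutes {..<k}. of_int (sign \<sigma>) * T (Y \<circ> \<sigma>)))"
      by (simp add: fun_eq_iff alt_def comp_def)
    then show ?thesis by (simp only: hodge_cmult hodge_sum)
  qed
  also have "(\<Sum>\<sigma> | \<sigma> permutes {..<k}. of_int (sign \<sigma>) * hodge g b k (\<lambda>Y. T (Y \<circ> \<sigma>)) X) =
      (\<Sum>\<sigma> | \<sigma> permutes {..<k}. hodge g b k T X)"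
  proof (intro sum.cong refl)
    fix \<sigma> assume "\<sigma> \<in> {\<sigma>. \<sigma> permutes {..<k}}"
    then have "hodge g b k (\<lambda>Y. T (Y \<circ> \<sigma>)) X = of_int (sign \<sigma>) * hodge g b k T X"
      using hodge_permute[OF vol _ k] by simp
    then show "of_int (sign \<sigma>) * hodge g b k (\<lambda>Y. T (Y \<circ> \<sigma>)) X = hodge g b k T X"
      by (simp flip: mult.assoc of_int_mult)
  qed
  also have "\<dots> = fact k * hodge g b k T X"
    by (simp add: card_permutations)
  finally show ?thesis by simp
qed

lemma volume_form_cong: "(\<And>i. i < 8 \<Longrightarrow> X i = Y i) \<Longrightarrow> volume_form g b X = volume_form g b Y"
  unfolding volume_form_def by (intro sum.cong refl arg_cong2[of _ _ _ _ "(*)"] prod.cong) auto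

lemma hodge_basis_lists:
  assumes T: "\<And>X Y. (\<And>i. i < k \<Longrightarrow> X i = Y i) \<Longrightarrow> T X = T Y" and k: "k \<le> 8"
  shows "hodge g b k T X = (\<Sum>xs\<in>basis_lists k. T (nth (map b xs)) *
     volume_form g b (nth (map b xs @ map X [0..<8 - k]))) / fact k"
  unfolding hodge_def sum_PiE_basis_lists[symmetric]
  by (intro arg_cong2[of _ _ _ _ "(/)"] arg_cong2[of _ _ _ _ "(*)"] sum.cong refl T volume_form_cong)
     (use k in \<open>auto simp: nth_append\<close>)

text \<open>The equation star \<beta> = \<beta>, written as the sum that occurs inside the star of a
  tensor of higher degree. The sum runs over all ordered quadruples of frame indices, whence 24 =
  4!.\<close>

definition self_dual :: "(real^8 \<Rightarrow> real^8 \<Rightarrow> real) \<Rightarrow> (8 \<Rightarrow> real^8) \<Rightarrow> tensor \<Rightarrow> bool" where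
  "self_dual g b \<beta> \<longleftrightarrow> (\<forall>Z. length Z = 4 \<longrightarrow>
     (\<Sum>ys\<in>basis_lists 4. \<beta> (nth (map b ys)) * volume_form g b (nth (map b ys @ Z))) = 24 * \<beta> (nth Z))"

text \<open>With frame vectors in the first \<open>k\<close> slots, \<open>T\<close> is a self-dual
  4-form in the last four. The sum over the last four indices therefore collapses, and the star
  becomes a contraction over the first \<open>k\<close>.\<close>

lemma hodge_self_dual:
  assumes vol: "exterior_form 8 (volume_form g b)" and k: "k \<le> 4"
    and T: "\<And>X Y. (\<And>i. i < k + 4 \<Longrightarrow> X i = Y i) \<Longrightarrow> T X = T Y"
    and \<beta>: "\<And>xs ys. length xs = k \<Longrightarrow> length ys = 4 \<Longrightarrow>
       T (nth (map b xs @ map b ys)) = \<beta> xs (nth (map b ys))"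
    and sd: "\<And>xs. length xs = k \<Longrightarrow> self_dual g b (\<beta> xs)"
  shows "hodge g b (k + 4) T X =
    24 * (\<Sum>xs\<in>basis_lists k. \<beta> xs (nth (map b xs @ map X [0..<4 - k]))) / fact (k + 4)"
proof -
  let ?Z = "map X [0..<4 - k]"
  have "hodge g b (k + 4) T X = (\<Sum>xs\<in>basis_lists k. \<Sum>ys\<in>basis_lists 4.
      T (nth (map b xs @ map b ys)) * volume_form g b (nth (map b xs @ map b ys @ ?Z))) / fact (k + 4)"
    using k by (subst hodge_basis_lists[OF T]) (simp_all add: sum_basis_lists_add)
  also have "(\<Sum>xs\<in>basis_lists k. \<Sum>ys\<in>basis_lists 4.
      T (nth (map b xs @ map b ys)) * volume_form g b (nth (map b xs @ map b ys @ ?Z)))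
    = (\<Sum>xs\<in>basis_lists k. \<Sum>ys\<in>basis_lists 4.
      \<beta> xs (nth (map b ys)) * volume_form g b (nth (map b ys @ map b xs @ ?Z)))"
  proof (intro sum.cong refl arg_cong2[of _ _ _ _ "(*)"])
    fix xs ys :: "8 list" assume l: "xs \<in> basis_lists k" "ys \<in> basis_lists 4"
    then show "T (nth (map b xs @ map b ys)) = \<beta> xs (nth (map b ys))"
      by (intro \<beta>) (auto simp: basis_lists_def)
    \<comment> \<open>A block of \<open>k\<close> entries passes a block of four, so the number of
      swaps is even.\<close>
    show "volume_form g b (nth (map b xs @ map b ys @ ?Z)) = volume_form g b (nth (map b ys @ map b xs @ ?Z))"
      using exterior_form_move_block[OF vol, of "[]" "map b xs" "map b ys" ?Z] l k
      by (simp add: basis_lists_def uminus_power_if)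
  qed
  also have "\<dots> = (\<Sum>xs\<in>basis_lists k. 24 * \<beta> xs (nth (map b xs @ ?Z)))"
    using sd k by (intro sum.cong refl) (auto simp: self_dual_def basis_lists_def)
  finally show ?thesis by (simp add: sum_distrib_left)
qed

lemma bij_betw_of_nat_8: "bij_betw (of_nat :: nat \<Rightarrow> 8) {..<8} UNIV"
proof -
  have "x \<in> of_nat ` {..<8}" for x :: 8
  proof (cases x rule: bit0_cases)
    case (of_int z)
    then have "x = of_nat (nat z)" "nat z < 8" by auto
    then show ?thesis by blast
  qed
  then have s: "(of_nat :: nat \<Rightarrow> 8) ` {..<8} = UNIV" by auto
  then have "inj_on (of_nat :: nat \<Rightarrow> 8) {..<8}" by (intro eq_card_imp_inj_on) auto
  with s show ?thesis by (simp add: bij_betw_def)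
qed

section \<open>Orthonormal frames and forms of top degree\<close>

locale orthonormal_frame =
  fixes g :: "real^8 \<Rightarrow> real^8 \<Rightarrow> real" and e :: "8 \<Rightarrow> real^8"
  assumes bilin: "bilinear g" and sym: "g v w = g w v"
    and orth: "g (e i) (e j) = (if i = j then 1 else 0)"
begin

lemma linear_g: "linear (g v)" "linear (\<lambda>v. g v w)"
  using bilin by (auto simp: bilinear_def)

lemma g_add: "g v (w + w') = g v w + g v w'" "g (v + v') w = g v w + g v' w"
  by (simp_all add: linear_add[OF linear_g(1)] linear_add[OF linear_g(2)])

lemma g_scaleR: "g v (c *\<^sub>R w) = c * g v w" "g (c *\<^sub>R v) w = c * g v w"
  by (simp_all add: linear_cmul[OF linear_g(1)] linear_cmul[OF linear_g(2)])

lemma g_sum: "g v (\<Sum>a\<in>A. f a) = (\<Sum>a\<in>A. g v (f a))"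
  by (rule linear_sum[OF linear_g(1)])

text \<open>Pairing with \<open>e i\<close> reads off the coordinates of \<open>L c\<close>, so
  \<open>L\<close> is injective; as its source and target both have dimension 8, it is onto.\<close>

lemma expand: "v = (\<Sum>j\<in>UNIV. g (e j) v *\<^sub>R e j)"
proof -
  define L :: "real^8 \<Rightarrow> real^8" where "L c = (\<Sum>j\<in>UNIV. c $ j *\<^sub>R e j)" for c
  have g_L: "g (e i) (L c) = c $ i" for i c
    by (simp add: L_def g_sum g_scaleR orth if_distrib cong: if_cong)
  have lin: "linear L"
    by (intro linearI) (simp_all add: L_def sum.distrib scaleR_left_distrib scaleR_sum_right)
  have "inj L" by (rule injI) (metis g_L vec_eq_iff)
  then have "surj L" using lin linear_injective_imp_surjective by blast
  then obtain c where "v = L c" by blast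
  then show ?thesis by (metis (no_types, lifting) L_def g_L sum.cong)
qed

lemma covariant_tensor_eqI:
  assumes \<alpha>: "covariant_tensor k \<alpha>" and \<beta>: "covariant_tensor k \<beta>"
    and eq: "\<And>I. \<alpha> (\<lambda>i. e (I i)) = \<beta> (\<lambda>i. e (I i))"
  shows "\<alpha> = \<beta>"
proof
  fix X
  show "\<alpha> X = \<beta> X"
    using multilinear_expand[OF \<alpha>, of X "\<lambda>i j. g (e j) (X i)" e]
      multilinear_expand[OF \<beta>, of X "\<lambda>i j. g (e j) (X i)" e] expand by (simp add: eq)
qed

lemma exterior_form_eqI:
  assumes \<alpha>: "exterior_form k \<alpha>" and \<beta>: "exterior_form k \<beta>"
    and eq: "\<And>I. inj_on I {..<k} \<Longrightarrow> \<alpha> (\<lambda>i. e (I i)) = \<beta> (\<lambda>i. e (I i))"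
  shows "\<alpha> = \<beta>"
proof (rule covariant_tensor_eqI)
  show "covariant_tensor k \<alpha>" "covariant_tensor k \<beta>" using \<alpha> \<beta> by (auto simp: exterior_form_def)
  fix I :: "nat \<Rightarrow> 8"
  show "\<alpha> (\<lambda>i. e (I i)) = \<beta> (\<lambda>i. e (I i))"
  proof (cases "inj_on I {..<k}")
    case False
    then obtain i j where "i < j" "j < k" "I i = I j"
      by (auto simp: inj_on_def) (metis linorder_neqE_nat)
    then have "\<alpha> (\<lambda>i. e (I i)) = 0" "\<beta> (\<lambda>i. e (I i)) = 0"
      using \<alpha> \<beta> unfolding exterior_form_def by metis+
    then show ?thesis by simp
  qed (rule eq)
qed

text \<open>The 8-forms are a line. In the multilinear expansion only the multi-indices that list
  every frame vector once survive; along \<open>of_nat\<close> these are the permutations of the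
  slots, and each contributes its sign.\<close>

lemma top_form:
  assumes B: "exterior_form 8 B"
  shows "B Z = volume_form g e Z * B (\<lambda>i. e (of_nat i))"
proof -
  let ?h = "\<lambda>I :: nat \<Rightarrow> 8. (\<Prod>i<8. g (e (I i)) (Z i)) * B (\<lambda>i. e (I i))"
  let ?r = "\<lambda>\<sigma> :: nat \<Rightarrow> nat. restrict (\<lambda>i. of_nat (\<sigma> i) :: 8) {..<8}"
  let ?S = "{\<sigma>. \<sigma> permutes {..<8::nat}}"
  have ct: "covariant_tensor 8 B" using B by (simp add: exterior_form_def)
  have inj: "inj_on (of_nat :: nat \<Rightarrow> 8) {..<8}" and surj: "(of_nat :: nat \<Rightarrow> 8) ` {..<8} = UNIV"
    using bij_betw_of_nat_8 by (auto simp: bij_betw_def)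
  have "B Z = sum ?h (PiE {..<8} (\<lambda>_. UNIV))"
    by (rule multilinear_expand[OF ct]) (rule expand)
  also have "\<dots> = sum ?h (?r ` ?S)"
  proof (rule sum.mono_neutral_right)
    show "finite (PiE {..<8::nat} (\<lambda>_. UNIV :: 8 set))" by (intro finite_PiE) auto
    show "?r ` ?S \<subseteq> PiE {..<8} (\<lambda>_. UNIV)" by (auto simp: PiE_def extensional_def)
    show "\<forall>I\<in>PiE {..<8} (\<lambda>_. UNIV) - ?r ` ?S. ?h I = 0"
    proof
      fix I assume I: "I \<in> PiE {..<8} (\<lambda>_. UNIV) - ?r ` ?S"
      have "\<not> inj_on I {..<8}"
      proof
        assume ij: "inj_on I {..<8}"
        \<comment> \<open>The multi-index is pulled back along \<open>of_nat\<close>, and continued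
          by the identity as \<open>permutes\<close> requires.\<close>
        define \<sigma> where "\<sigma> i = (if i < 8 then the_inv_into {..<8} of_nat (I i) else i)" for i
        have \<sigma>: "of_nat (\<sigma> i) = I i" "\<sigma> i < 8" if "i < 8" for i
          using that f_the_inv_into_f[OF inj, of "I i"] the_inv_into_into[OF inj, of "I i" "{..<8}"] surj
          by (auto simp: \<sigma>_def)
        have "inj_on \<sigma> {..<8}"
        proof (rule inj_onI)
          fix x y assume "x \<in> {..<8}" "y \<in> {..<8}" "\<sigma> x = \<sigma> y"
          then have "I x = I y" using \<sigma>(1)[of x] \<sigma>(1)[of y] by simp
          then show "x = y" using inj_onD[OF ij] \<open>x \<in> _\<close> \<open>y \<in> _\<close> by blast
        qed
        then have "\<sigma> ` {..<8} = {..<8}"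
          using \<sigma>(2) by (intro endo_inj_surj) auto
        with \<open>inj_on \<sigma> {..<8}\<close> have "\<sigma> permutes {..<8}"
          by (intro bij_imp_permutes) (auto simp: bij_betw_def \<sigma>_def)
        moreover have "?r \<sigma> = I" using I \<sigma> by (auto simp: fun_eq_iff PiE_def extensional_def)
        ultimately show False using I by auto
      qed
      then obtain i j where "i < j" "j < 8" "I i = I j"
        by (auto simp: inj_on_def) (metis linorder_neqE_nat)
      then have "B (\<lambda>i. e (I i)) = 0" using B unfolding exterior_form_def by metis
      then show "?h I = 0" by simp
    qed
  qed
  also have "\<dots> = sum (?h \<circ> ?r) ?S"
  proof (rule sum.reindex)
    show "inj_on ?r ?S"
    proof (rule inj_onI)
      fix \<sigma> \<tau> assume s: "\<sigma> \<in> ?S" "\<tau> \<in> ?S" and eq: "?r \<sigma> = ?r \<tau>"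
      show "\<sigma> = \<tau>"
      proof
        fix i
        show "\<sigma> i = \<tau> i"
        proof (cases "i < 8")
          case True
          then have "(of_nat (\<sigma> i) :: 8) = of_nat (\<tau> i)" using fun_cong[OF eq, of i] by simp
          moreover have "\<sigma> i < 8" "\<tau> i < 8"
            using s True permutes_in_image[of \<sigma> "{..<8}" i] permutes_in_image[of \<tau> "{..<8}" i] by auto
          ultimately show ?thesis using inj by (auto simp: inj_on_def)
        qed (use s permutes_not_in[of \<sigma> "{..<8}" i] permutes_not_in[of \<tau> "{..<8}" i] in auto)
      qed
    qed
  qed
  also have "\<dots> = (\<Sum>\<sigma>\<in>?S. of_int (sign \<sigma>) * (\<Prod>i<8. g (e (of_nat (\<sigma> i))) (Z i)) * B (\<lambda>i. e (of_nat i)))"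
  proof (rule sum.cong[OF refl])
    fix \<sigma> assume \<sigma>: "\<sigma> \<in> ?S"
    have "B (\<lambda>i. e (?r \<sigma> i)) = B ((\<lambda>i. e (of_nat i)) \<circ> \<sigma>)"
      by (rule covariant_tensor_cong[OF ct]) simp
    also have "\<dots> = of_int (sign \<sigma>) * B (\<lambda>i. e (of_nat i))"
      using \<sigma> by (intro exterior_form_permute[OF B]) simp
    finally show "(?h \<circ> ?r) \<sigma> = of_int (sign \<sigma>) * (\<Prod>i<8. g (e (of_nat (\<sigma> i))) (Z i)) * B (\<lambda>i. e (of_nat i))"
      by simp
  qed
  finally show ?thesis by (simp add: volume_form_def sum_distrib_right)
qed

end

subsection \<open>Antisymmetrised Clifford products\<close>

text \<open>This is the Clifford action of the wedge product of the dual 1-forms: for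
  \<open>a\<close> of degree \<open>n\<close>, the exterior product of x with a is half of x a +
  (-1)^n a x. The recursion replaces a signed sum over permutations.\<close>

primrec aprod :: "(real^8 \<Rightarrow> real^16 \<Rightarrow> real^16) \<Rightarrow> nat \<Rightarrow> (nat \<Rightarrow> real^8) \<Rightarrow> real^16 \<Rightarrow> real^16" where
  "aprod C 0 X \<phi> = \<phi>"
| "aprod C (Suc n) X \<phi> =
    (1 / 2) *\<^sub>R (C (X 0) (aprod C n (\<lambda>i. X (Suc i)) \<phi>) + (-1) ^ n *\<^sub>R aprod C n (\<lambda>i. X (Suc i)) (C (X 0) \<phi>))"

locale spin_space = orthonormal_frame +
  fixes cl :: "real^8 \<Rightarrow> real^16 \<Rightarrow> real^16"
  assumes bilinear_cl: "bilinear cl"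
    and clifford: "cl v (cl w \<phi>) + cl w (cl v \<phi>) = (- 2 * g v w) *\<^sub>R \<phi>"
    and skew: "cl v \<phi> \<bullet> \<psi> = - (\<phi> \<bullet> cl v \<psi>)"
begin

lemma linear_cl: "linear (cl v)" "linear (\<lambda>v. cl v \<phi>)"
  using bilinear_cl by (auto simp: bilinear_def)

lemma cl_0 [simp]: "cl v 0 = 0" "cl 0 \<phi> = 0"
  by (simp_all add: linear_0[OF linear_cl(1)] linear_0[OF linear_cl(2)])

lemma cl_add: "cl v (\<phi> + \<psi>) = cl v \<phi> + cl v \<psi>" "cl (v + w) \<phi> = cl v \<phi> + cl w \<phi>"
  by (simp_all add: linear_add[OF linear_cl(1)] linear_add[OF linear_cl(2)])

lemma cl_diff: "cl v (\<phi> - \<psi>) = cl v \<phi> - cl v \<psi>" "cl (v - w) \<phi> = cl v \<phi> - cl w \<phi>"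
  by (simp_all add: linear_diff[OF linear_cl(1)] linear_diff[OF linear_cl(2)])

lemma cl_minus: "cl v (- \<phi>) = - cl v \<phi>" "cl (- v) \<phi> = - cl v \<phi>"
  by (simp_all add: linear_neg[OF linear_cl(1)] linear_neg[OF linear_cl(2)])

lemma cl_scaleR: "cl v (c *\<^sub>R \<phi>) = c *\<^sub>R cl v \<phi>" "cl (c *\<^sub>R v) \<phi> = c *\<^sub>R cl v \<phi>"
  by (simp_all add: linear_cmul[OF linear_cl(1)] linear_cmul[OF linear_cl(2)])

lemma cl_sum: "cl v (\<Sum>a\<in>S. f a) = (\<Sum>a\<in>S. cl v (f a))"
  "cl (\<Sum>a\<in>S. h a) \<phi> = (\<Sum>a\<in>S. cl (h a) \<phi>)"
  by (simp_all add: linear_sum[OF linear_cl(1)] linear_sum[OF linear_cl(2)])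

lemmas cl_simps = cl_add cl_diff cl_minus cl_scaleR

lemma cl_swap: "cl v (cl w \<phi>) = - cl w (cl v \<phi>) - (2 * g v w) *\<^sub>R \<phi>"
proof -
  have "cl v (cl w \<phi>) = (- 2 * g v w) *\<^sub>R \<phi> - cl w (cl v \<phi>)"
    by (simp only: eq_diff_eq clifford)
  then show ?thesis by simp
qed

lemma cl_square: "cl v (cl v \<phi>) = - g v v *\<^sub>R \<phi>"
proof -
  have "2 *\<^sub>R cl v (cl v \<phi>) = 2 *\<^sub>R (- g v v *\<^sub>R \<phi>)"
    using clifford[of v v \<phi>] by (simp add: scaleR_2)
  then show ?thesis by (simp only: scaleR_cancel_left) simp
qed

lemma cl_e_swap: "i \<noteq> j \<Longrightarrow> cl (e i) (cl (e j) \<phi>) = - cl (e j) (cl (e i) \<phi>)"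
  using cl_swap[of "e i" "e j"] by (simp add: orth)

lemma cl_e_square: "cl (e i) (cl (e i) \<phi>) = - \<phi>"
  using cl_square[of "e i"] by (simp add: orth)

lemma cl_inner: "cl v \<phi> \<bullet> cl w \<phi> = g v w * (\<phi> \<bullet> \<phi>)"
proof -
  have "2 * (cl v \<phi> \<bullet> cl w \<phi>) = - ((cl v (cl w \<phi>) + cl w (cl v \<phi>)) \<bullet> \<phi>)"
    using skew[of v \<phi> "cl w \<phi>"] skew[of w \<phi> "cl v \<phi>"]
    by (simp add: inner_add_left inner_add_right inner_commute)
  then show ?thesis by (simp add: clifford)
qed

lemma linear_aprod: "linear (aprod cl n X)"
proof (induction n arbitrary: X)
  case 0
  have "aprod cl 0 X = (\<lambda>x. x)" by auto
  then show ?case by (simp add: linear_ident)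
next
  case (Suc n)
  show ?case
    by (intro linearI) (simp_all add: cl_simps linear_add[OF Suc] linear_cmul[OF Suc] algebra_simps)
qed

lemma aprod_cong: "(\<And>i. i < n \<Longrightarrow> X i = Y i) \<Longrightarrow> aprod cl n X \<phi> = aprod cl n Y \<phi>"
proof (induction n arbitrary: X Y \<phi>)
  case (Suc n)
  have "aprod cl n (\<lambda>i. X (Suc i)) \<psi> = aprod cl n (\<lambda>i. Y (Suc i)) \<psi>" for \<psi>
    by (rule Suc.IH) (use Suc.prems in auto)
  then show ?case using Suc.prems[of 0] by simp
qed simp

lemma linear_aprod_slot: "i < n \<Longrightarrow> linear (\<lambda>v. aprod cl n (X(i := v)) \<phi>)"
proof (induction n arbitrary: X \<phi> i)
  case (Suc n)
  show ?case
  proof (cases i)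
    case 0
    then show ?thesis
      by (intro linearI)
        (simp_all add: cl_simps linear_add[OF linear_aprod] linear_cmul[OF linear_aprod] algebra_simps)
  next
    case (Suc i')
    have 1: "(\<lambda>j. (X(i := v)) (Suc j)) = (\<lambda>j. X (Suc j))(i' := v)" for v
      by (auto simp: Suc fun_eq_iff)
    have l: "linear (\<lambda>v. aprod cl n ((\<lambda>j. X (Suc j))(i' := v)) \<psi>)" for \<psi>
      by (rule Suc.IH) (use Suc.prems Suc in simp)
    show ?thesis
      unfolding aprod.simps 1 using Suc
      by (intro linearI) (simp_all add: cl_simps linear_add[OF l] linear_cmul[OF l] algebra_simps)
  qed
qed simp

text \<open>If the first two vectors both equal x, the mixed terms x B x cancel, and x x B - B x x
  vanishes because x x is a scalar. Later repetitions are passed on to the recursion.\<close>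

lemma aprod_adjacent: "Suc i < n \<Longrightarrow> X i = X (Suc i) \<Longrightarrow> aprod cl n X \<phi> = 0"
proof (induction n arbitrary: X \<phi> i)
  case (Suc n)
  show ?case
  proof (cases i)
    case 0
    with Suc obtain m where m: "n = Suc m" by (cases n) auto
    define x B where "x = X 0" and "B = aprod cl m (\<lambda>i. X (Suc (Suc i)))"
    have x: "X 0 = x" "X (Suc 0) = x" using Suc.prems 0 by (simp_all add: x_def)
    have B: "linear B" unfolding B_def by (rule linear_aprod)
    have "aprod cl (Suc n) X \<phi> = (1 / 2) *\<^sub>R (cl x ((1 / 2) *\<^sub>R (cl x (B \<phi>) + (-1) ^ m *\<^sub>R B (cl x \<phi>)))
        - (-1) ^ m *\<^sub>R (1 / 2) *\<^sub>R (cl x (B (cl x \<phi>)) + (-1) ^ m *\<^sub>R B (cl x (cl x \<phi>))))"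
      unfolding m aprod.simps x B_def by simp
    then show ?thesis
      by (simp add: cl_simps cl_square linear_neg[OF B] linear_cmul[OF B] scaleR_right_distrib
          scaleR_right_diff_distrib flip: power_mult_distrib)
  next
    case (Suc i')
    then have "aprod cl n (\<lambda>i. X (Suc i)) \<psi> = 0" for \<psi>
      using Suc.IH[of i' "\<lambda>i. X (Suc i)"] Suc.prems by simp
    then show ?thesis by simp
  qed
qed simp

lemma exterior_form_aprod: "exterior_form n (\<lambda>X. aprod cl n X \<phi> \<bullet> \<psi>)"
proof (rule exterior_form_adjacentI)
  have "linear (\<lambda>v. aprod cl n (X(i := v)) \<phi> \<bullet> \<psi>)" if "i < n" for X i
    using linear_aprod_slot[OF that, of X \<phi>] by (simp add: linear_iff inner_add_left)
  moreover have "aprod cl n X \<phi> \<bullet> \<psi> = aprod cl n Y \<phi> \<bullet> \<psi>" if "\<forall>i<n. X i = Y i" for X Y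
    using aprod_cong[of n X Y \<phi>] that by simp
  ultimately show "covariant_tensor n (\<lambda>X. aprod cl n X \<phi> \<bullet> \<psi>)"
    unfolding covariant_tensor_def by blast
qed (simp add: aprod_adjacent)

lemma aprod_anticommute:
  "(\<And>i. i < n \<Longrightarrow> g x (X i) = 0) \<Longrightarrow> aprod cl n X (cl x \<phi>) = (-1) ^ n *\<^sub>R cl x (aprod cl n X \<phi>)"
proof (induction n arbitrary: X \<phi>)
  case (Suc n)
  have IH: "aprod cl n (\<lambda>i. X (Suc i)) (cl x \<psi>) = (-1) ^ n *\<^sub>R cl x (aprod cl n (\<lambda>i. X (Suc i)) \<psi>)" for \<psi>
    by (rule Suc.IH) (use Suc.prems in auto)
  have sw: "cl (X 0) (cl x \<psi>) = - cl x (cl (X 0) \<psi>)" for \<psi>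
    using cl_swap[of "X 0" x \<psi>] Suc.prems[of 0] by (simp add: sym)
  show ?case
    by (simp add: IH sw cl_simps linear_neg[OF linear_aprod] algebra_simps)
qed simp

text \<open>By \<open>aprod_anticommute\<close> the two halves of the recursion agree on orthogonal
  vectors, so antisymmetrising changes nothing.\<close>

lemma aprod_orthogonal:
  "(\<And>i j. i < j \<Longrightarrow> j < n \<Longrightarrow> g (X i) (X j) = 0) \<Longrightarrow> aprod cl n X \<phi> = foldr cl (map X [0..<n]) \<phi>"
proof (induction n arbitrary: X)
  case (Suc n)
  have "aprod cl n (\<lambda>i. X (Suc i)) (cl (X 0) \<phi>) = (-1) ^ n *\<^sub>R cl (X 0) (aprod cl n (\<lambda>i. X (Suc i)) \<phi>)"
    by (rule aprod_anticommute) (use Suc.prems in auto)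
  moreover have "aprod cl n (\<lambda>i. X (Suc i)) \<phi> = foldr cl (map (\<lambda>i. X (Suc i)) [0..<n]) \<phi>"
    by (rule Suc.IH) (use Suc.prems in auto)
  moreover have "map X [0..<Suc n] = X 0 # map (\<lambda>i. X (Suc i)) [0..<n]"
    by (simp add: map_upt_Suc del: upt_Suc)
  ultimately show ?case
    by (simp del: upt_Suc flip: scaleR_2 power_mult_distrib)
qed simp

section \<open>Antisymmetrised products of degree two, three and four\<close>

definition A2 :: "real^8 \<Rightarrow> real^8 \<Rightarrow> real^16 \<Rightarrow> real^16" where
  "A2 y z \<phi> = (1 / 2) *\<^sub>R (cl y (cl z \<phi>) - cl z (cl y \<phi>))"

definition A3 :: "real^8 \<Rightarrow> real^8 \<Rightarrow> real^8 \<Rightarrow> real^16 \<Rightarrow> real^16" where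
  "A3 x y z \<phi> = (1 / 2) *\<^sub>R (cl x (A2 y z \<phi>) + A2 y z (cl x \<phi>))"

definition A4 :: "real^8 \<Rightarrow> real^8 \<Rightarrow> real^8 \<Rightarrow> real^8 \<Rightarrow> real^16 \<Rightarrow> real^16" where
  "A4 w x y z \<phi> = (1 / 2) *\<^sub>R (cl w (A3 x y z \<phi>) - A3 x y z (cl w \<phi>))"

lemma aprod_2: "aprod cl 2 X \<phi> = A2 (X 0) (X 1) \<phi>"
  by (simp add: numeral_2_eq_2 A2_def cl_simps algebra_simps flip: scaleR_add_left)

lemma aprod_3: "aprod cl 3 X \<phi> = A3 (X 0) (X 1) (X 2) \<phi>"
  using aprod_2[of "\<lambda>i. X (Suc i)"] by (simp add: numeral_3_eq_3 numeral_2_eq_2 A3_def del: aprod.simps(2))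
    (simp add: numeral_2_eq_2)

lemma aprod_4: "aprod cl 4 X \<phi> = A4 (X 0) (X 1) (X 2) (X 3) \<phi>"
proof -
  have 4: "(4::nat) = Suc 3" by simp
  show ?thesis unfolding 4 aprod.simps(2) aprod_3 A4_def by (simp add: numeral_eq_Suc)
qed

lemma A2_eq: "A2 y z \<phi> = cl y (cl z \<phi>) + g y z *\<^sub>R \<phi>"
  unfolding A2_def cl_swap[of z y] by (simp add: sym[of z y] vec_eq_iff field_simps)

lemma A2_cl: "A2 y z (cl x \<phi>) = cl x (A2 y z \<phi>) + (2 * g x y) *\<^sub>R cl z \<phi> - (2 * g x z) *\<^sub>R cl y \<phi>"
  unfolding A2_eq cl_swap[of z x] cl_diff cl_minus cl_scaleR cl_swap[of y x]
  by (simp add: cl_simps sym[of z x] sym[of y x] vec_eq_iff algebra_simps)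

lemma cl_A2: "cl x (A2 y z \<phi>) = A3 x y z \<phi> - g x y *\<^sub>R cl z \<phi> + g x z *\<^sub>R cl y \<phi>"
  by (simp add: A3_def A2_cl vec_eq_iff field_simps)

lemma A3_cl: "A3 y z w (cl x \<phi>) = - cl x (A3 y z w \<phi>) - (2 * g x y) *\<^sub>R A2 z w \<phi>
    + (2 * g x z) *\<^sub>R A2 y w \<phi> - (2 * g x w) *\<^sub>R A2 y z \<phi>"
proof -
  have A3: "A3 y z w \<psi> = cl y (A2 z w \<psi>) + g y z *\<^sub>R cl w \<psi> - g y w *\<^sub>R cl z \<psi>" for \<psi>
    using cl_A2[of y z w \<psi>] by simp
  show ?thesis
    unfolding A3 A2_cl cl_diff cl_add cl_scaleR cl_swap[of y x] cl_swap[of w x \<phi>] cl_swap[of z x \<phi>]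
    by (simp add: cl_simps sym[of y x] sym[of w x] sym[of z x] A2_eq[of y] vec_eq_iff algebra_simps)
qed

text \<open>The Clifford rule for a vector times a 3-form: exterior product minus contraction. In
  \<open>star_d_eq\<close> it separates the Dirac term from the other terms.\<close>

lemma cl_A3: "cl x (A3 y z w \<phi>) = A4 x y z w \<phi> - g x y *\<^sub>R A2 z w \<phi> + g x z *\<^sub>R A2 y w \<phi> - g x w *\<^sub>R A2 y z \<phi>"
  by (simp add: A4_def A3_cl vec_eq_iff field_simps)

lemma A2_skew: "A2 y z \<phi> \<bullet> \<psi> = - (\<phi> \<bullet> A2 y z \<psi>)"
  by (simp add: A2_def inner_diff_left inner_diff_right skew field_simps)

lemma A3_symmetric: "A3 x y z \<phi> \<bullet> \<psi> = \<phi> \<bullet> A3 x y z \<psi>"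
  by (simp add: A3_def inner_add_left inner_add_right skew A2_skew)

section \<open>The volume element and the splitting into half-spinors\<close>

definition vol_op :: "real^16 \<Rightarrow> real^16" where
  "vol_op \<phi> = foldr cl (map (\<lambda>k. e (of_nat k)) [0..<8]) \<phi>"

text \<open>Each factor contributes a sign on passing \<open>cl (e j)\<close>, except a factor that
  is itself \<open>e j\<close>; the extra 1 in the exponent undoes that sign.\<close>

lemma foldr_cl_anticommute:
  "distinct ks \<Longrightarrow> foldr cl (map e ks) (cl (e j) \<phi>) =
     (-1) ^ (length ks + (if j \<in> set ks then 1 else 0)) *\<^sub>R cl (e j) (foldr cl (map e ks) \<phi>)"
proof (induction ks)
  case (Cons k ks)
  show ?case
  proof (cases "k = j")
    case False
    then show ?thesis using Cons cl_e_swap[of k j] by (simp add: cl_simps)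
  qed (use Cons in \<open>simp add: cl_simps\<close>)
qed simp

text \<open>A new vector in front of n others adds n + 1 signs: n to reach its copy and one from its
  square. For four and for eight vectors the exponent is 10 and 36, so both products square to
  1.\<close>

lemma foldr_cl_square:
  "distinct ks \<Longrightarrow> foldr cl (map e ks) (foldr cl (map e ks) \<phi>) = (-1) ^ (length ks * (length ks + 1) div 2) *\<^sub>R \<phi>"
proof (induction ks arbitrary: \<phi>)
  case (Cons k ks)
  have "Suc n * (Suc n + 1) div 2 = n * (n + 1) div 2 + Suc n" for n :: nat
  proof -
    have "Suc n * (Suc n + 1) = n * (n + 1) + Suc n * 2" by simp
    then show ?thesis by (simp only: div_mult_self1)
  qed
  then show ?case using Cons
    by (simp add: foldr_cl_anticommute cl_simps cl_e_square power_add del: mult_Suc mult_Suc_right)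
qed simp

lemma linear_foldr_cl: "linear (foldr cl vs)"
proof (induction vs)
  case Nil
  then show ?case using linear_id by (simp add: id_def)
next
  case (Cons v vs)
  then show ?case using linear_compose[OF Cons linear_cl(1)] by (simp add: comp_def)
qed

lemma vol_op_list: "vol_op = foldr cl (map e (map of_nat [0..<8]))"
  by (simp add: vol_op_def fun_eq_iff comp_def)

lemma linear_vol_op: "linear vol_op"
  unfolding vol_op_list by (rule linear_foldr_cl)

lemma distinct_of_nat_8: "distinct (map of_nat [0..<8] :: 8 list)"
  using bij_betw_of_nat_8 by (auto simp: distinct_map bij_betw_def atLeast0LessThan)

lemma set_of_nat_8: "set (map of_nat [0..<8]) = (UNIV :: 8 set)"
  using bij_betw_of_nat_8 by (simp add: bij_betw_def atLeast0LessThan)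

lemma vol_op_e: "vol_op (cl (e j) \<phi>) = - cl (e j) (vol_op \<phi>)"
  unfolding vol_op_list foldr_cl_anticommute[OF distinct_of_nat_8] set_of_nat_8 by simp

lemma vol_op_cl: "vol_op (cl v \<phi>) = - cl v (vol_op \<phi>)"
  by (subst (1 2) expand[of v])
     (simp add: cl_sum cl_scaleR linear_sum[OF linear_vol_op] linear_cmul[OF linear_vol_op] vol_op_e sum_negf)

lemma vol_op_square: "vol_op (vol_op \<phi>) = \<phi>"
  unfolding vol_op_list foldr_cl_square[OF distinct_of_nat_8] by simp

end

lemma exterior_form_sum:
  assumes "\<And>a. a \<in> S \<Longrightarrow> exterior_form k (\<alpha> a)"
  shows "exterior_form k (\<lambda>X. \<Sum>a\<in>S. \<alpha> a X)"
proof -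
  have ct: "covariant_tensor k (\<alpha> a)" if "a \<in> S" for a
    using assms[OF that] by (simp add: exterior_form_def)
  show ?thesis
  proof (rule exterior_formI)
    show "linear (\<lambda>v. \<Sum>a\<in>S. \<alpha> a (X(i := v)))" if "i < k" for X i
      using covariant_tensor_linear[OF ct that] by (intro linear_compose_sum) auto
    show "(\<Sum>a\<in>S. \<alpha> a X) = (\<Sum>a\<in>S. \<alpha> a Y)" if "\<And>i. i < k \<Longrightarrow> X i = Y i" for X Y
      by (intro sum.cong refl covariant_tensor_cong[OF ct] that)
    show "(\<Sum>a\<in>S. \<alpha> a X) = 0" if "i < j" "j < k" "X i = X j" for X i j
      by (intro sum.neutral ballI exterior_form_vanish[OF assms that])
  qed
qed

lemma exterior_form_fix_initial:
  assumes \<alpha>: "exterior_form (m + n) \<alpha>"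
  shows "exterior_form n (\<lambda>X. \<alpha> (\<lambda>i. if i < m then Y i else X (i - m)))"
proof -
  have ct: "covariant_tensor (m + n) \<alpha>" using \<alpha> by (simp add: exterior_form_def)
  let ?E = "\<lambda>X i. if i < m then Y i else X (i - m)"
  show ?thesis
  proof (rule exterior_formI)
    show "linear (\<lambda>v. \<alpha> (?E (X(i := v))))" if "i < n" for X i
    proof -
      have "?E (X(i := v)) = (?E X)(m + i := v)" for v by (auto simp: fun_eq_iff)
      then show ?thesis using covariant_tensor_linear[OF ct, of "m + i" "?E X"] that by simp
    qed
    show "\<alpha> (?E X) = \<alpha> (?E X')" if "\<And>i. i < n \<Longrightarrow> X i = X' i" for X X'
      by (rule covariant_tensor_cong[OF ct]) (use that in auto)
    show "\<alpha> (?E X) = 0" if "i < j" "j < n" "X i = X j" for X i j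
      by (rule exterior_form_vanish[OF \<alpha>, of "m + i" "m + j"]) (use that in auto)
  qed
qed

context spin_space
begin

text \<open>Multiplication by \<open>e 0\<close> is injective, since its square is -1, and exchanges
  the two eigenspaces of \<open>vol_op\<close>. They have the same dimension, meet in 0 and together
  span dimension 16.\<close>

lemma dim_negative_spinors: "dim {\<phi>. vol_op \<phi> = - \<phi>} = 8"
proof -
  define P N where "P = {\<phi>. vol_op \<phi> = \<phi>}" and "N = {\<phi>. vol_op \<phi> = - \<phi>}"
  have P: "subspace P" and N: "subspace N"
    by (auto simp: P_def N_def subspace_def linear_add[OF linear_vol_op] linear_cmul[OF linear_vol_op]
        linear_0[OF linear_vol_op])
  have cP: "cl (e 0) ` P \<subseteq> N" and cN: "cl (e 0) ` N \<subseteq> P"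
    by (auto simp: P_def N_def vol_op_cl cl_minus)
  have inj: "inj (cl (e 0))"
    by (rule injI) (metis cl_e_square neg_equal_iff_equal)
  have "dim P \<le> dim N" "dim N \<le> dim P"
    using dim_image_eq[OF linear_cl(1) inj_on_subset[OF inj], of P]
      dim_image_eq[OF linear_cl(1) inj_on_subset[OF inj], of N] dim_subset[OF cP] dim_subset[OF cN] by auto
  moreover have "P \<inter> N = {0}"
  proof -
    have "\<phi> = 0" if "\<phi> = - \<phi>" for \<phi> :: "real^16" using that by (simp add: eq_neg_iff_add_eq_0 flip: scaleR_2)
    then show ?thesis using subspace_0[OF P] subspace_0[OF N] by (auto simp: P_def N_def)
  qed
  moreover have "{x + y |x y. x \<in> P \<and> y \<in> N} = UNIV"
  proof -
    have "\<exists>x y. \<phi> = x + y \<and> x \<in> P \<and> y \<in> N" for \<phi>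
      by (intro exI[of _ "(1 / 2) *\<^sub>R (\<phi> + vol_op \<phi>)"] exI[of _ "(1 / 2) *\<^sub>R (\<phi> - vol_op \<phi>)"])
         (simp add: P_def N_def linear_add[OF linear_vol_op] linear_diff[OF linear_vol_op]
           linear_cmul[OF linear_vol_op] vol_op_square vec_eq_iff field_simps)
    then show ?thesis by blast
  qed
  ultimately show ?thesis
    using dim_sums_Int[OF P N] by (simp add: dim_UNIV N_def[symmetric])
qed

end

section \<open>A positive unit spinor and the self-dual 4-forms it defines\<close>

locale positive_spinor = spin_space +
  fixes \<eta> :: "real^16"
  assumes positive: "vol_op \<eta> = \<eta>" and unit: "norm \<eta> = 1"
begin

lemma unit_inner: "\<eta> \<bullet> \<eta> = 1"
  using unit by (simp add: norm_eq_1)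

lemma cl_eta_inner: "cl v \<eta> \<bullet> cl w \<eta> = g v w"
  by (simp add: cl_inner unit_inner)

lemma cl_eta_inj: "cl v \<eta> = cl w \<eta> \<Longrightarrow> v = w"
  by (subst (1 2) expand) (simp flip: cl_eta_inner)

text \<open>Clifford multiplication on \<eta> is an isometry of the tangent space into the negative
  spinors, and both have dimension 8. The vectors \<open>cl (e j) \<eta>\<close> thus form an
  orthonormal basis there, and the sum is the expansion of \<theta> in it.\<close>

lemma completeness:
  assumes "vol_op \<theta> = - \<theta>"
  shows "(\<Sum>j\<in>UNIV. (cl (e j) \<eta> \<bullet> \<theta>) *\<^sub>R cl (e j) \<eta>) = \<theta>"
proof -
  let ?N = "{\<phi>. vol_op \<phi> = - \<phi>}"
  have N: "subspace ?N"
    by (auto simp: subspace_def linear_add[OF linear_vol_op] linear_cmul[OF linear_vol_op] linear_0[OF linear_vol_op])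
  have lin: "linear (\<lambda>v. cl v \<eta>)" by (rule linear_cl)
  have inj: "inj (\<lambda>v. cl v \<eta>)" using cl_eta_inj by (auto intro: injI)
  have "dim (range (\<lambda>v. cl v \<eta>)) = 8"
    using dim_image_eq[OF lin inj_on_subset[OF inj], of UNIV] by (simp add: dim_UNIV)
  moreover have "range (\<lambda>v. cl v \<eta>) \<subseteq> ?N" by (auto simp: vol_op_cl positive)
  moreover have "subspace (range (\<lambda>v. cl v \<eta>))" using linear_subspace_image[OF lin] subspace_UNIV by blast
  ultimately have "range (\<lambda>v. cl v \<eta>) = ?N"
    using subspace_dim_equal[OF _ N] dim_negative_spinors by simp
  then obtain v where v: "\<theta> = cl v \<eta>" using assms by blast
  have "(\<Sum>j\<in>UNIV. (cl (e j) \<eta> \<bullet> \<theta>) *\<^sub>R cl (e j) \<eta>) = cl (\<Sum>j\<in>UNIV. g (e j) v *\<^sub>R e j) \<eta>"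
    by (simp add: v cl_eta_inner cl_sum cl_scaleR)
  then show ?thesis by (simp add: v flip: expand)
qed

lemma aprod_8: "aprod cl 8 Z \<eta> = volume_form g e Z *\<^sub>R \<eta>"
proof -
  have "aprod cl 8 (\<lambda>i. e (of_nat i)) \<eta> = \<eta>"
  proof -
    have "g (e (of_nat i)) (e (of_nat j)) = 0" if "i < j" "j < 8" for i j
      using bij_betw_of_nat_8 that by (auto simp: orth bij_betw_def inj_on_def)
    then have "aprod cl 8 (\<lambda>i. e (of_nat i)) \<eta> = vol_op \<eta>"
      unfolding vol_op_def by (rule aprod_orthogonal)
    then show ?thesis by (simp add: positive)
  qed
  then have "aprod cl 8 Z \<eta> \<bullet> \<psi> = (volume_form g e Z *\<^sub>R \<eta>) \<bullet> \<psi>" for \<psi>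
    using top_form[OF exterior_form_aprod[of 8 \<eta> \<psi>], of Z] by simp
  then have "\<forall>\<psi>. aprod cl 8 Z \<eta> \<bullet> \<psi> = (volume_form g e Z *\<^sub>R \<eta>) \<bullet> \<psi>" by blast
  then show ?thesis by (simp only: vector_eq_rdot)
qed

lemma exterior_volume: "exterior_form 8 (volume_form g e)"
proof -
  have "volume_form g e = (\<lambda>Z. aprod cl 8 Z \<eta> \<bullet> \<eta>)"
    by (simp add: aprod_8 unit_inner fun_eq_iff)
  then show ?thesis using exterior_form_aprod[of 8 \<eta> \<eta>] by simp
qed

lemma aprod_basis:
  assumes "distinct xs"
  shows "aprod cl (length xs) (nth (map e xs)) \<phi> = foldr cl (map e xs) \<phi>"
proof -
  have "aprod cl (length xs) (nth (map e xs)) \<phi> = foldr cl (map (nth (map e xs)) [0..<length xs]) \<phi>"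
    using assms by (intro aprod_orthogonal) (auto simp: orth nth_eq_iff_index_eq)
  also have "map (nth (map e xs)) [0..<length xs] = map e xs"
    by (rule nth_equalityI) auto
  finally show ?thesis .
qed

text \<open>The product of all eight frame vectors maps \<eta> to plus or minus \<eta>, with the
  sign given by the volume form. The first four of them square to 1 and can be moved to the other
  side.\<close>

lemma self_dual_term:
  assumes l: "length xs = 4" "length ys = 4" and d: "distinct (xs @ ys)"
  shows "(aprod cl 4 (nth (map e xs)) \<eta> \<bullet> \<psi>) * volume_form g e (nth (map e xs @ map e ys)) =
    aprod cl 4 (nth (map e ys)) \<eta> \<bullet> \<psi>"
proof -
  let ?s = "volume_form g e (nth (map e xs @ map e ys))"
  have ds: "distinct xs" "distinct ys" using d by auto
  have "foldr cl (map e xs) (foldr cl (map e ys) \<eta>) = ?s *\<^sub>R \<eta>"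
    using aprod_basis[OF d, of \<eta>] l by (simp add: aprod_8)
  then have "foldr cl (map e xs) (foldr cl (map e xs) (foldr cl (map e ys) \<eta>)) = ?s *\<^sub>R foldr cl (map e xs) \<eta>"
    by (simp add: linear_cmul[OF linear_foldr_cl])
  then have "foldr cl (map e ys) \<eta> = ?s *\<^sub>R foldr cl (map e xs) \<eta>"
    using foldr_cl_square[OF ds(1)] l by simp
  moreover have "aprod cl 4 (nth (map e xs)) \<eta> = foldr cl (map e xs) \<eta>"
    "aprod cl 4 (nth (map e ys)) \<eta> = foldr cl (map e ys) \<eta>"
    using aprod_basis[OF ds(1)] aprod_basis[OF ds(2)] l by simp_all
  ultimately show ?thesis by simp
qed

text \<open>Both sides are exterior 4-forms in the free slots, so distinct frame vectors
  \<open>ks\<close> suffice. There only the orderings \<open>ys\<close> of the complementary indices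
  contribute, and by \<open>self_dual_term\<close> all of them equally.\<close>

lemma self_dual_aprod: "self_dual g e (\<lambda>X. aprod cl 4 X \<eta> \<bullet> \<psi>)"
proof -
  let ?A = "\<lambda>X. aprod cl 4 X \<eta> \<bullet> \<psi>"
  let ?V = "volume_form g e"
  let ?E = "\<lambda>ys X i. if i < 4 then e (ys ! i) else X (i - 4)"
  let ?F = "\<lambda>X. \<Sum>ys\<in>basis_lists 4. ?A (nth (map e ys)) * ?V (?E ys X)"
  have F: "?F = (\<lambda>X. 24 * ?A X)"
  proof (rule exterior_form_eqI)
    show "exterior_form 4 ?F"
      using exterior_volume by (intro exterior_form_sum exterior_form_scale exterior_form_fix_initial) simp
    show "exterior_form 4 (\<lambda>X. 24 * ?A X)" by (intro exterior_form_scale exterior_form_aprod)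
    fix I :: "nat \<Rightarrow> 8" assume I: "inj_on I {..<4}"
    define ks where "ks = map I [0..<4]"
    have ks: "length ks = 4" "distinct ks"
      using I by (auto simp: ks_def distinct_map atLeast0LessThan)
    have E: "?V (?E ys (\<lambda>i. e (I i))) = ?V (nth (map e (ys @ ks)))" if "length ys = 4" for ys
      using that by (intro volume_form_cong) (auto simp: nth_append ks_def)
    have AI: "?A (\<lambda>i. e (I i)) = ?A (nth (map e ks))"
      by (intro arg_cong2[of _ _ _ _ "(\<bullet>)"] aprod_cong) (auto simp: ks_def)
    let ?D = "{ys \<in> basis_lists 4. distinct (ys @ ks)}"
    have "?F (\<lambda>i. e (I i)) = (\<Sum>ys\<in>basis_lists 4. if distinct (ys @ ks) then ?A (nth (map e ks)) else 0)"
    proof (intro sum.cong refl)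
      fix ys :: "8 list" assume ys: "ys \<in> basis_lists 4"
      then have l: "length ys = 4" by (simp add: basis_lists_def)
      show "?A (nth (map e ys)) * ?V (?E ys (\<lambda>i. e (I i))) = (if distinct (ys @ ks) then ?A (nth (map e ks)) else 0)"
      proof (cases "distinct (ys @ ks)")
        case True
        then show ?thesis using self_dual_term[OF l ks(1) True] E[OF l] by simp
      next
        case False
        then obtain i j where ij: "i < j" "j < length (ys @ ks)" "(ys @ ks) ! i = (ys @ ks) ! j"
          unfolding distinct_conv_nth by (metis linorder_neqE_nat)
        have "?V (nth (map e (ys @ ks))) = 0"
          by (rule exterior_form_vanish[OF exterior_volume ij(1)]) (use ij l ks in \<open>simp_all del: map_append\<close>)
        then show ?thesis using False E[OF l] by (simp del: distinct_append map_append)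
      qed
    qed
    also have "\<dots> = real (card ?D) * ?A (nth (map e ks))"
      by (simp add: sum.If_cases Int_def del: distinct_append)
    \<comment> \<open>The four indices outside \<open>ks\<close> can be ordered in 4! ways.\<close>
    also have "card ?D = 24"
    proof -
      have "?D = {ys. length ys = 4 \<and> distinct ys \<and> set ys \<subseteq> - set ks}"
        using ks by (auto simp: basis_lists_def)
      moreover have "card (- set ks) = 4"
        using ks by (simp add: Compl_eq_Diff_UNIV card_Diff_subset distinct_card)
      ultimately show ?thesis
        by (simp add: card_lists_distinct_length_eq) (simp add: eval_nat_numeral)
    qed
    finally show "?F (\<lambda>i. e (I i)) = 24 * ?A (\<lambda>i. e (I i))" by (simp add: AI)
  qed
  have FZ: "?F (nth Z) = (\<Sum>ys\<in>basis_lists 4. ?A (nth (map e ys)) * ?V (nth (map e ys @ Z)))"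
    if "length Z = 4" for Z
    by (intro sum.cong refl arg_cong2[of _ _ _ _ "(*)"] volume_form_cong)
       (auto simp: nth_append basis_lists_def)
  show ?thesis unfolding self_dual_def
  proof (intro allI impI)
    fix Z :: "(real^8) list" assume l: "length Z = 4"
    show "(\<Sum>ys\<in>basis_lists 4. ?A (nth (map e ys)) * ?V (nth (map e ys @ Z))) = 24 * ?A (nth Z)"
      by (rule trans[OF FZ[OF l, symmetric] fun_cong[OF F]])
  qed
qed

definition Om :: "real^8 \<Rightarrow> real^8 \<Rightarrow> real^8 \<Rightarrow> real^8 \<Rightarrow> real" where
  "Om w x y z = A3 x y z \<eta> \<bullet> cl w \<eta>"

text \<open>Skewness of \<open>cl w\<close> and symmetry of \<open>A3\<close> turn the pairing into
  the commutator that defines \<open>A4\<close>. In this form \<open>Om\<close> inherits alternation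
  and self-duality from \<open>aprod\<close>.\<close>

lemma Om_A4: "Om w x y z = - (A4 w x y z \<eta> \<bullet> \<eta>)"
  using skew[of w "A3 x y z \<eta>" \<eta>] A3_symmetric[of x y z "cl w \<eta>" \<eta>]
  by (simp add: Om_def A4_def inner_diff_left inner_diff_right inner_commute)

lemma exterior_form_Om: "exterior_form 4 (\<lambda>X. Om (X 0) (X 1) (X 2) (X 3))"
proof -
  have "(\<lambda>X. Om (X 0) (X 1) (X 2) (X 3)) = (\<lambda>X. (-1) * (aprod cl 4 X \<eta> \<bullet> \<eta>))"
    by (simp add: aprod_4 Om_A4 fun_eq_iff)
  then show ?thesis using exterior_form_scale[OF exterior_form_aprod[of 4 \<eta> \<eta>], of "-1"] by simp
qed

lemma self_dual_Om: "self_dual g e (\<lambda>X. Om (X 0) (X 1) (X 2) (X 3))"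
  using self_dual_aprod[of \<eta>] unfolding self_dual_def
  by (simp add: aprod_4 Om_A4 sum_negf)

end

section \<open>Injectivity of the Hodge star in degree seven\<close>

context positive_spinor
begin

lemma volume_nonzero:
  assumes "distinct xs" "length xs = 8"
  shows "volume_form g e (nth (map e xs)) \<noteq> 0"
proof
  assume z: "volume_form g e (nth (map e xs)) = 0"
  have "foldr cl (map e xs) \<eta> = 0"
    using aprod_basis[OF assms(1), of \<eta>] assms(2) z by (simp add: aprod_8)
  then have "\<eta> = 0"
    using foldr_cl_square[OF assms(1), of \<eta>] assms(2) by (simp add: linear_0[OF linear_foldr_cl])
  then show False using unit by simp
qed

text \<open>\<open>Lambda3_48\<close> is defined by the vanishing of a 7-form, while only stars of
  wedge products are computed; this lemma closes the gap. Evaluating the star on the one frame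
  vector missing from \<open>ks\<close> leaves only reorderings of \<open>ks\<close>, which all
  contribute the same amount.\<close>

lemma hodge_eq_0_7:
  assumes T: "exterior_form 7 T" and h: "\<And>X. hodge g e 7 T X = 0"
  shows "T = (\<lambda>X. 0)"
proof (rule exterior_form_eqI[OF T])
  show "exterior_form 7 (\<lambda>X. 0)" by (rule exterior_formI) (simp_all add: linear_zero)
  fix I :: "nat \<Rightarrow> 8" assume I: "inj_on I {..<7}"
  define ks where "ks = map I [0..<7]"
  have ks: "length ks = 7" "distinct ks"
    using I by (auto simp: ks_def distinct_map atLeast0LessThan)
  have "set ks \<noteq> UNIV" using distinct_card[OF ks(2)] ks(1) by auto
  then obtain w where w: "w \<notin> set ks" by blast
  let ?V = "volume_form g e"
  let ?t = "\<lambda>ys. T (nth (map e ys)) * ?V (nth (map e (ys @ [w])))"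
  have ctT: "covariant_tensor 7 T" using T by (simp add: exterior_form_def)
  let ?D = "{ys \<in> basis_lists 7. distinct (ys @ [w])}"
  have "hodge g e 7 T (\<lambda>_. e w) = (\<Sum>ys\<in>basis_lists 7. ?t ys) / fact 7"
    using hodge_basis_lists[of 7 T g e "\<lambda>_. e w", OF covariant_tensor_cong[OF ctT]] by simp
  then have "0 = (\<Sum>ys\<in>basis_lists 7. ?t ys)" using h by simp
  also have "\<dots> = (\<Sum>ys\<in>basis_lists 7. if distinct (ys @ [w]) then ?t ks else 0)"
  proof (intro sum.cong refl)
    fix ys :: "8 list" assume "ys \<in> basis_lists 7"
    then have l: "length ys = 7" by (simp add: basis_lists_def)
    show "?t ys = (if distinct (ys @ [w]) then ?t ks else 0)"
    proof (cases "distinct (ys @ [w])")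
      case False
      then obtain i j where ij: "i < j" "j < length (ys @ [w])" "(ys @ [w]) ! i = (ys @ [w]) ! j"
        unfolding distinct_conv_nth by (metis linorder_neqE_nat)
      have "?V (nth (map e (ys @ [w]))) = 0"
        by (rule exterior_form_vanish[OF exterior_volume ij(1)]) (use ij l in \<open>simp_all del: map_append\<close>)
      then show ?thesis using False by (simp del: distinct_append map_append)
    next
      case True
      have c: "card (- {w}) = 7" by (simp add: Compl_eq_Diff_UNIV card_Diff_subset)
      have "set ys = - {w}"
        by (rule card_subset_eq) (use True l in \<open>auto simp: c distinct_card\<close>)
      moreover have "set ks = - {w}"
        by (rule card_subset_eq) (use w ks in \<open>auto simp: c distinct_card\<close>)
      ultimately have "mset ys = mset ks"
        using True ks by (metis distinct_append set_eq_iff_mset_eq_distinct)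
      then obtain \<sigma> where \<sigma>: "\<sigma> permutes {..<7}" and ys: "permute_list \<sigma> ks = ys"
        using mset_eq_permutation[of ys ks] ks(1) by auto
      have lt: "\<sigma> i < 7 \<longleftrightarrow> i < 7" for i using permutes_in_image[OF \<sigma>, of i] by simp
      have nth: "ys ! i = ks ! \<sigma> i" if "i < 7" for i
        using that ks(1) by (simp add: ys[symmetric] permute_list_def)
      have "T (nth (map e ys)) = T (nth (map e ks) \<circ> \<sigma>)"
        by (rule covariant_tensor_cong[OF ctT]) (use l ks(1) lt nth in simp)
      then have 1: "T (nth (map e ys)) = of_int (sign \<sigma>) * T (nth (map e ks))"
        using exterior_form_permute[OF T \<sigma>] by simp
      have "?V (nth (map e (ys @ [w]))) = ?V (nth (map e (ks @ [w])) \<circ> \<sigma>)"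
      proof (rule volume_form_cong)
        fix i :: nat assume "i < 8"
        then consider "i < 7" | "i = 7" by linarith
        then show "map e (ys @ [w]) ! i = (nth (map e (ks @ [w])) \<circ> \<sigma>) i"
        proof cases
          case 2
          \<comment> \<open>The last slot holds \<open>e w\<close> and is fixed by \<sigma>, so the
            volume form and \<open>T\<close> acquire the same sign and the signs cancel.\<close>
          have "\<sigma> 7 = 7" using permutes_not_in[OF \<sigma>, of 7] by simp
          then show ?thesis using 2 l ks(1) by (simp add: nth_append)
        qed (use l ks(1) lt nth in \<open>simp add: nth_append\<close>)
      qed
      then have 2: "?V (nth (map e (ys @ [w]))) = of_int (sign \<sigma>) * ?V (nth (map e (ks @ [w])))"
        using exterior_form_permute[OF exterior_volume permutes_subset[OF \<sigma>, of "{..<8}"]] by auto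
      show ?thesis using True unfolding 1 2 by (simp add: mult.assoc mult.left_commute flip: of_int_mult)
    qed
  qed
  also have "\<dots> = real (card ?D) * ?t ks"
    by (simp add: sum.If_cases Int_def del: distinct_append)
  finally have "real (card ?D) * ?t ks = 0" by simp
  moreover have "card ?D \<noteq> 0"
  proof -
    have "ks \<in> ?D" using ks w by (simp add: basis_lists_def)
    moreover have "finite ?D" by simp
    ultimately show ?thesis unfolding card_eq_0_iff by blast
  qed
  moreover have "?V (nth (map e (ks @ [w]))) \<noteq> 0"
    by (rule volume_nonzero) (use ks w in simp_all)
  ultimately have "T (nth (map e ks)) = 0" by (simp only: mult_eq_0_iff of_nat_eq_0_iff simp_thms)
  moreover have "T (\<lambda>i. e (I i)) = T (nth (map e ks))"
    by (rule covariant_tensor_cong[OF ctT]) (simp add: ks_def)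
  ultimately show "T (\<lambda>i. e (I i)) = 0" by simp
qed

section \<open>The 4-form, the map c and the eigenvalue 3\<close>

lemma Om_swap:
  "Om x w y z = - Om w x y z" "Om w y x z = - Om w x y z" "Om w x z y = - Om w x y z"
  using exterior_form_transpose[OF exterior_form_Om, of 0 1 "nth [w, x, y, z]"]
    exterior_form_transpose[OF exterior_form_Om, of 1 2 "nth [w, x, y, z]"]
    exterior_form_transpose[OF exterior_form_Om, of 2 3 "nth [w, x, y, z]"]
  by (simp_all add: Transposition.transpose_def numeral_eq_Suc)

lemma Om_same: "Om w w y z = 0"
  using Om_swap(1)[of w w y z] by simp

lemma linear_Om: "linear (\<lambda>v. Om v x y z)"
  unfolding Om_def using linear_cl(2)[of \<eta>] by (simp add: linear_iff inner_add_right)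

lemma bilinear_expand:
  assumes b: "bilinear b"
  shows "b y z = (\<Sum>i\<in>UNIV. \<Sum>j\<in>UNIV. g (e i) y * g (e j) z * b (e i) (e j))"
proof -
  have l: "linear (b v)" "linear (\<lambda>v. b v w)" for v w using b by (auto simp: bilinear_def)
  have "b y z = (\<Sum>i\<in>UNIV. g (e i) y * b (e i) z)"
    by (subst expand[of y]) (simp add: linear_sum[OF l(2)] linear_cmul[OF l(2)])
  moreover have "b (e i) z = (\<Sum>j\<in>UNIV. g (e j) z * b (e i) (e j))" for i
    by (subst expand[of z]) (simp add: linear_sum[OF l(1)] linear_cmul[OF l(1)])
  ultimately show ?thesis by (simp add: sum_distrib_left mult.assoc)
qed

text \<open>The spinor on the left is c(b), and by \<open>hodge_wedge_2\<close> the last sum is the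
  star of b \<and> \<Omega>. On \<open>Lambda2_7\<close>, where that star is 3 b, the right side
  becomes 4 b; this is the origin of the factor 1/4 in the inverse of c.\<close>

lemma A2_inner_form:
  fixes b :: "real^8 \<Rightarrow> real^8 \<Rightarrow> real"
  assumes b: "bilinear b" and anti: "\<And>v w. b v w = - b w v"
  shows "A2 y z \<eta> \<bullet> ((1 / 2) *\<^sub>R (\<Sum>i\<in>UNIV. \<Sum>j\<in>UNIV. b (e i) (e j) *\<^sub>R cl (e i) (cl (e j) \<eta>))) =
    b y z + (1 / 2) * (\<Sum>i\<in>UNIV. \<Sum>j\<in>UNIV. b (e i) (e j) * Om (e i) (e j) y z)"
proof -
  have t: "A2 y z \<eta> \<bullet> cl (e i) (cl (e j) \<eta>) = Om (e i) (e j) y z + g (e i) y * g (e j) z - g (e i) z * g (e j) y" for i j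
  proof -
    have "A2 y z \<eta> \<bullet> cl (e i) (cl (e j) \<eta>) = - (cl (e i) (A2 y z \<eta>) \<bullet> cl (e j) \<eta>)"
      using skew[of "e i" "A2 y z \<eta>" "cl (e j) \<eta>"] by simp
    also have "\<dots> = - Om (e j) (e i) y z + g (e i) y * g (e j) z - g (e i) z * g (e j) y"
      unfolding cl_A2 by (simp add: inner_diff_left inner_add_left cl_eta_inner Om_def sym[of z] sym[of y])
    finally show ?thesis by (simp add: Om_swap(1)[of "e j" "e i"])
  qed
  have "A2 y z \<eta> \<bullet> (\<Sum>i\<in>UNIV. \<Sum>j\<in>UNIV. b (e i) (e j) *\<^sub>R cl (e i) (cl (e j) \<eta>)) =
    (\<Sum>i\<in>UNIV. \<Sum>j\<in>UNIV. b (e i) (e j) * (Om (e i) (e j) y z + g (e i) y * g (e j) z - g (e i) z * g (e j) y))"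
    by (simp add: inner_sum_right t)
  also have "\<dots> = (\<Sum>i\<in>UNIV. \<Sum>j\<in>UNIV. b (e i) (e j) * Om (e i) (e j) y z) + b y z - b z y"
    unfolding bilinear_expand[OF b, of y z] bilinear_expand[OF b, of z y]
    by (simp add: sum.distrib sum_subtractf algebra_simps)
  also have "\<dots> = (\<Sum>i\<in>UNIV. \<Sum>j\<in>UNIV. b (e i) (e j) * Om (e i) (e j) y z) + 2 * b y z"
    using anti[of z y] by simp
  finally show ?thesis by (simp add: algebra_simps)
qed

text \<open>For each fixed i, \<open>completeness\<close> applied to \<open>cl (e i) \<phi>\<close>
  makes the sum over j equal to - e_i e_i \<phi> = \<phi>. There are eight values of i, and 8 * 1/4
  * 1/2 = 1.\<close>

lemma c_inverse_formula:
  assumes \<phi>: "vol_op \<phi> = \<phi>" "\<eta> \<bullet> \<phi> = 0"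
  shows "(1 / 2) *\<^sub>R (\<Sum>i\<in>UNIV. \<Sum>j\<in>UNIV. (1 / 4 * (A2 (e i) (e j) \<eta> \<bullet> \<phi>)) *\<^sub>R cl (e i) (cl (e j) \<eta>)) = \<phi>"
proof -
  have t: "A2 (e i) (e j) \<eta> \<bullet> \<phi> = - (cl (e j) \<eta> \<bullet> cl (e i) \<phi>)" for i j
    by (simp add: A2_eq inner_add_left \<phi>(2) skew[of "e i"])
  have "(\<Sum>j\<in>UNIV. (A2 (e i) (e j) \<eta> \<bullet> \<phi>) *\<^sub>R cl (e i) (cl (e j) \<eta>)) = \<phi>" for i
  proof -
    have "(\<Sum>j\<in>UNIV. (A2 (e i) (e j) \<eta> \<bullet> \<phi>) *\<^sub>R cl (e i) (cl (e j) \<eta>)) =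
        - cl (e i) (\<Sum>j\<in>UNIV. (cl (e j) \<eta> \<bullet> cl (e i) \<phi>) *\<^sub>R cl (e j) \<eta>)"
      by (simp add: t cl_sum cl_scaleR sum_negf)
    also have "\<dots> = \<phi>" by (subst completeness) (simp_all add: vol_op_cl \<phi>(1) cl_e_square)
    finally show ?thesis .
  qed
  then have "(\<Sum>i\<in>UNIV. (1 / 4) *\<^sub>R (\<Sum>j\<in>UNIV. (A2 (e i) (e j) \<eta> \<bullet> \<phi>) *\<^sub>R cl (e i) (cl (e j) \<eta>))) = 2 *\<^sub>R \<phi>"
    by (simp add: sum_constant_scaleR del: sum_constant)
  then show ?thesis by (simp add: scaleR_sum_right)
qed

text \<open>Half of this sum is c applied to the star of w \<and> x \<and> \<Omega>, so the lemma
  says that this star followed by c is 3 times c on every decomposable 2-form. The coefficient is 8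
  - 2: the trace over the frame gives 8, and the contraction terms of \<open>cl_A2\<close> remove
  the commutator of w and x.\<close>

lemma sum_Om_cl:
  "(\<Sum>j\<in>UNIV. \<Sum>k\<in>UNIV. Om (e j) (e k) w x *\<^sub>R cl (e j) (cl (e k) \<eta>)) = 6 *\<^sub>R A2 w x \<eta>"
proof -
  \<comment> \<open>For distinct indices the two vectors are interchanged, so that the sum over j
    becomes the expansion of a negative spinor as in \<open>completeness\<close>; for equal indices
    both sides vanish.\<close>
  have "Om (e j) (e k) w x *\<^sub>R cl (e j) (cl (e k) \<eta>) =
      - (cl (e k) ((cl (e j) \<eta> \<bullet> A3 (e k) w x \<eta>) *\<^sub>R cl (e j) \<eta>))" for j k
  proof (cases "j = k")
    case True
    then have "cl (e j) \<eta> \<bullet> A3 (e k) w x \<eta> = 0" using Om_same[of "e k" w x] by (simp add: Om_def inner_commute)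
    then show ?thesis using True by (simp add: Om_same)
  next
    case False
    then show ?thesis by (simp add: cl_e_swap[OF False] Om_def cl_scaleR inner_commute)
  qed
  then have "(\<Sum>j\<in>UNIV. \<Sum>k\<in>UNIV. Om (e j) (e k) w x *\<^sub>R cl (e j) (cl (e k) \<eta>)) =
      - (\<Sum>k\<in>UNIV. cl (e k) (\<Sum>j\<in>UNIV. (cl (e j) \<eta> \<bullet> A3 (e k) w x \<eta>) *\<^sub>R cl (e j) \<eta>))"
    by (subst sum.swap) (simp add: cl_sum sum_negf)
  also have "\<dots> = - (\<Sum>k\<in>UNIV. cl (e k) (A3 (e k) w x \<eta>))"
  proof -
    have "vol_op (A3 (e k) w x \<eta>) = - A3 (e k) w x \<eta>" for k
      by (simp add: A3_def A2_def vol_op_cl positive linear_add[OF linear_vol_op] linear_diff[OF linear_vol_op]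
          linear_cmul[OF linear_vol_op] cl_simps algebra_simps)
    then show ?thesis by (simp add: completeness)
  qed
  also have "\<dots> = - (\<Sum>k\<in>UNIV. - A2 w x \<eta> + g (e k) w *\<^sub>R cl (e k) (cl x \<eta>) - g (e k) x *\<^sub>R cl (e k) (cl w \<eta>))"
  proof -
    have "A3 v w x \<eta> = cl v (A2 w x \<eta>) + g v w *\<^sub>R cl x \<eta> - g v x *\<^sub>R cl w \<eta>" for v
      using cl_A2[of v w x \<eta>] by simp
    then show ?thesis by (simp add: cl_simps cl_e_square)
  qed
  also have "\<dots> = 8 *\<^sub>R A2 w x \<eta> - cl w (cl x \<eta>) + cl x (cl w \<eta>)"
  proof -
    have "(\<Sum>k\<in>UNIV. g (e k) v *\<^sub>R cl (e k) \<psi>) = cl v \<psi>" for v \<psi>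
      by (subst (2) expand[of v]) (simp add: cl_sum cl_scaleR)
    then show ?thesis by (simp add: sum.distrib sum_subtractf sum_constant_scaleR del: sum_constant)
  qed
  also have "\<dots> = 6 *\<^sub>R A2 w x \<eta>" by (simp add: A2_def vec_eq_iff field_simps)
  finally show ?thesis .
qed

end

section \<open>Pointwise algebra of a spinor together with its covariant derivative\<close>

locale positive_spinor_derivative = positive_spinor +
  fixes N :: "real^8 \<Rightarrow> real^16"
  assumes linear_N: "linear N" and positive_N: "vol_op (N v) = N v" and orth_N: "\<eta> \<bullet> N v = 0"
begin

definition star_d :: "real^8 \<Rightarrow> real^8 \<Rightarrow> real^8 \<Rightarrow> real" where
  "star_d x y z = (\<Sum>i\<in>UNIV. - 2 * (A4 (e i) x y z \<eta> \<bullet> N (e i)))"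

definition D :: "real^16" where
  "D = (\<Sum>i\<in>UNIV. cl (e i) (N (e i)))"

lemma sum_N: "(\<Sum>i\<in>UNIV. g (e i) x * (\<psi> \<bullet> N (e i))) = \<psi> \<bullet> N x"
  by (subst (2) expand[of x]) (simp add: linear_sum[OF linear_N] linear_cmul[OF linear_N] inner_sum_right)

text \<open>In \<open>A4 (e i) x y z\<close>, the part \<open>cl (e i)\<close> times
  \<open>A3\<close> moves onto \<open>N (e i)\<close> and sums to the Dirac term \<open>D\<close>;
  in the contraction terms the sum over i turns \<open>N (e i)\<close> into \<open>N x\<close>,
  \<open>N y\<close> and \<open>N z\<close>. If D is V\<eta>, the first term is 2
  i(V)\<Omega>.\<close>

lemma star_d_eq:
  "star_d x y z = 2 * (A3 x y z \<eta> \<bullet> D) - 2 * (A2 y z \<eta> \<bullet> N x - A2 x z \<eta> \<bullet> N y + A2 x y \<eta> \<bullet> N z)"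
proof -
  have t: "A4 (e i) x y z \<eta> \<bullet> N (e i) = - (A3 x y z \<eta> \<bullet> cl (e i) (N (e i))) + g (e i) x * (A2 y z \<eta> \<bullet> N (e i))
      - g (e i) y * (A2 x z \<eta> \<bullet> N (e i)) + g (e i) z * (A2 x y \<eta> \<bullet> N (e i))" for i
  proof -
    have "A4 (e i) x y z \<eta> = cl (e i) (A3 x y z \<eta>) + g (e i) x *\<^sub>R A2 y z \<eta> - g (e i) y *\<^sub>R A2 x z \<eta> + g (e i) z *\<^sub>R A2 x y \<eta>"
      using cl_A3[of "e i" x y z \<eta>] by simp
    then show ?thesis by (simp add: inner_add_left inner_diff_left skew[of "e i"])
  qed
  have D: "(\<Sum>i\<in>UNIV. A3 x y z \<eta> \<bullet> cl (e i) (N (e i))) = A3 x y z \<eta> \<bullet> D"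
    by (simp add: D_def inner_sum_right)
  have "(\<Sum>i\<in>UNIV. A4 (e i) x y z \<eta> \<bullet> N (e i)) =
      - (A3 x y z \<eta> \<bullet> D) + A2 y z \<eta> \<bullet> N x - A2 x z \<eta> \<bullet> N y + A2 x y \<eta> \<bullet> N z"
    by (simp only: t sum.distrib sum_subtractf sum_negf sum_N D)
  moreover have "star_d x y z = - 2 * (\<Sum>i\<in>UNIV. A4 (e i) x y z \<eta> \<bullet> N (e i))"
    unfolding star_d_def by (simp only: sum_distrib_left)
  ultimately show ?thesis by simp
qed

text \<open>Relabelling indices and alternation of \<open>Om\<close> make the three remaining terms
  of \<open>star_d_eq\<close> equal multiples of \<open>?S\<close>. By \<open>sum_Om_cl\<close>,
  \<open>?S\<close> is six times the sum of the products of \<open>A2 (e i) w \<eta>\<close> with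
  \<open>N (e i)\<close>, that is, -6 times the product of \<open>cl w \<eta>\<close> with
  \<open>D\<close>.\<close>

lemma star_d_orthogonal:
  assumes "D = 0"
  shows "(\<Sum>i\<in>UNIV. \<Sum>j\<in>UNIV. \<Sum>k\<in>UNIV. star_d (e i) (e j) (e k) * Om (e i) (e j) (e k) w) = 0"
proof -
  let ?S = "\<Sum>i\<in>UNIV. \<Sum>j\<in>UNIV. \<Sum>k\<in>UNIV. (A2 (e j) (e k) \<eta> \<bullet> N (e i)) * Om (e i) (e j) (e k) w"
  have 2: "(\<Sum>i\<in>UNIV. \<Sum>j\<in>UNIV. \<Sum>k\<in>UNIV. (A2 (e i) (e k) \<eta> \<bullet> N (e j)) * Om (e i) (e j) (e k) w) = - ?S"
  proof -
    have "(\<Sum>i\<in>UNIV. \<Sum>j\<in>UNIV. \<Sum>k\<in>UNIV. (A2 (e i) (e k) \<eta> \<bullet> N (e j)) * Om (e i) (e j) (e k) w) =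
       (\<Sum>i\<in>UNIV. \<Sum>j\<in>UNIV. \<Sum>k\<in>UNIV. (A2 (e j) (e k) \<eta> \<bullet> N (e i)) * Om (e j) (e i) (e k) w)"
      by (rule sum.swap)
    also have "\<dots> = (\<Sum>i\<in>UNIV. \<Sum>j\<in>UNIV. \<Sum>k\<in>UNIV. (A2 (e j) (e k) \<eta> \<bullet> N (e i)) * - Om (e i) (e j) (e k) w)"
      by (intro sum.cong refl arg_cong2[of _ _ _ _ "(*)"] Om_swap(1))
    finally show ?thesis by (simp add: sum_negf)
  qed
  have 3: "(\<Sum>i\<in>UNIV. \<Sum>j\<in>UNIV. \<Sum>k\<in>UNIV. (A2 (e i) (e j) \<eta> \<bullet> N (e k)) * Om (e i) (e j) (e k) w) = ?S"
  proof -
    have "(\<Sum>i\<in>UNIV. \<Sum>j\<in>UNIV. \<Sum>k\<in>UNIV. (A2 (e i) (e j) \<eta> \<bullet> N (e k)) * Om (e i) (e j) (e k) w) =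
       (\<Sum>i\<in>UNIV. \<Sum>k\<in>UNIV. \<Sum>j\<in>UNIV. (A2 (e i) (e j) \<eta> \<bullet> N (e k)) * Om (e i) (e j) (e k) w)"
      by (intro sum.cong refl sum.swap)
    also have "\<dots> = (\<Sum>k\<in>UNIV. \<Sum>i\<in>UNIV. \<Sum>j\<in>UNIV. (A2 (e i) (e j) \<eta> \<bullet> N (e k)) * Om (e i) (e j) (e k) w)"
      by (rule sum.swap)
    also have "\<dots> = ?S"
    proof (intro sum.cong refl arg_cong2[of _ _ _ _ "(*)"])
      show "Om (e i) (e j) (e k) w = Om (e k) (e i) (e j) w" for i j k
        using Om_swap(1)[of "e i" "e k" "e j" w] Om_swap(2)[of "e i" "e k" "e j" w] by simp
    qed
    finally show ?thesis .
  qed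
  have S: "?S = (\<Sum>i\<in>UNIV. 6 * (A2 (e i) w \<eta> \<bullet> N (e i)))"
  proof -
    have "(\<Sum>j\<in>UNIV. \<Sum>k\<in>UNIV. (A2 (e j) (e k) \<eta> \<bullet> N (e i)) * Om (e i) (e j) (e k) w) = 6 * (A2 (e i) w \<eta> \<bullet> N (e i))" for i
    proof -
      have o: "Om (e i) (e j) (e k) w = Om (e j) (e k) (e i) w" for j k
        using Om_swap(1)[of "e i" "e j" "e k" w] Om_swap(2)[of "e j" "e i" "e k" w] by simp
      have "(A2 (e j) (e k) \<eta> \<bullet> N (e i)) = cl (e j) (cl (e k) \<eta>) \<bullet> N (e i)" for j k
        by (simp add: A2_eq inner_add_left orth_N)
      then have "(\<Sum>j\<in>UNIV. \<Sum>k\<in>UNIV. (A2 (e j) (e k) \<eta> \<bullet> N (e i)) * Om (e i) (e j) (e k) w) =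
         (\<Sum>j\<in>UNIV. \<Sum>k\<in>UNIV. Om (e j) (e k) (e i) w *\<^sub>R cl (e j) (cl (e k) \<eta>)) \<bullet> N (e i)"
        by (simp add: o inner_sum_left mult.commute)
      then show ?thesis by (simp add: sum_Om_cl)
    qed
    then show ?thesis by simp
  qed
  have "(\<Sum>i\<in>UNIV. A2 (e i) w \<eta> \<bullet> N (e i)) = - (cl w \<eta> \<bullet> D)"
    by (simp add: A2_eq inner_add_left orth_N skew D_def inner_sum_right sum_negf)
  then have S0: "?S = 0" using S assms by (simp flip: sum_distrib_left)
  have "star_d (e i) (e j) (e k) * Om (e i) (e j) (e k) w = - 2 * ((A2 (e j) (e k) \<eta> \<bullet> N (e i)) * Om (e i) (e j) (e k) w)
      + 2 * ((A2 (e i) (e k) \<eta> \<bullet> N (e j)) * Om (e i) (e j) (e k) w)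
      + - 2 * ((A2 (e i) (e j) \<eta> \<bullet> N (e k)) * Om (e i) (e j) (e k) w)" for i j k
    by (simp add: star_d_eq assms algebra_simps)
  then show ?thesis
    by (simp only: sum.distrib sum_distrib_left[symmetric] 2 3 S0)
qed

end

section \<open>Hodge stars of wedge products with the 4-form and of its exterior derivative\<close>

lemma self_dual_cmult: "self_dual g b \<beta> \<Longrightarrow> self_dual g b (\<lambda>X. c * \<beta> X)"
  unfolding self_dual_def by (simp add: mult.assoc flip: sum_distrib_left)

text \<open>The cycle that brings entry \<open>i\<close> to the front and keeps the order of the
  others. Its values on \<open>Suc j\<close> reproduce the omitted-index pattern of
  \<open>ext_deriv\<close>, and its sign is the sign there.\<close>

primrec front_cycle :: "nat \<Rightarrow> nat \<Rightarrow> nat" where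
  "front_cycle 0 = id"
| "front_cycle (Suc i) = Transposition.transpose i (Suc i) \<circ> front_cycle i"

lemma front_cycle_permutes: "i < n \<Longrightarrow> front_cycle i permutes {..<n}"
  by (induction i) (auto intro!: permutes_compose permutes_swap_id simp: permutes_id simp del: o_apply)

lemma sign_front_cycle: "sign (front_cycle i) = (-1) ^ i"
proof (induction i)
  case (Suc i)
  have "permutation (front_cycle i)"
    using front_cycle_permutes[of i "Suc i"] by (auto intro: permutes_imp_permutation[of "{..<Suc i}"])
  then show ?case
    unfolding front_cycle.simps
    by (subst sign_compose) (auto simp: permutation_swap_id sign_swap_id Suc)
qed simp

lemma front_cycle_0: "front_cycle i 0 = i"
  by (induction i) auto

lemma front_cycle_Suc: "front_cycle i (Suc j) = (if j < i then j else Suc j)"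
  by (induction i) (auto simp: Transposition.transpose_def)

context positive_spinor
begin

text \<open>Since \<Omega> is self-dual, the star of \<alpha> \<and> \<Omega> is the full
  contraction of \<alpha> into \<Omega>.\<close>

lemma hodge_wedge:
  assumes \<alpha>: "covariant_tensor k \<alpha>" and k: "k \<le> 4"
  shows "hodge g e (k + 4) (wedge k 4 \<alpha> (\<lambda>X. Om (X 0) (X 1) (X 2) (X 3))) X =
    (\<Sum>xs\<in>basis_lists k. \<alpha> (nth (map e xs)) *
      (\<lambda>Y. Om (Y 0) (Y 1) (Y 2) (Y 3)) (nth (map e xs @ map X [0..<4 - k]))) / fact k"
proof -
  let ?Om = "\<lambda>X. Om (X 0) (X 1) (X 2) (X 3)"
  let ?T = "\<lambda>Y. \<alpha> Y * ?Om (\<lambda>i. Y (k + i))"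
  let ?\<beta> = "\<lambda>xs Z. \<alpha> (nth (map e xs)) * ?Om Z"
  have ct: "covariant_tensor (k + 4) ?T"
    using covariant_tensor_product[OF \<alpha>, of 4 ?Om] exterior_form_Om by (simp add: exterior_form_def)
  have "hodge g e (k + 4) ?T X =
      24 * (\<Sum>xs\<in>basis_lists k. ?\<beta> xs (nth (map e xs @ map X [0..<4 - k]))) / fact (k + 4)"
  proof (rule hodge_self_dual[OF exterior_volume k])
    show "?T X = ?T Y" if "\<And>i. i < k + 4 \<Longrightarrow> X i = Y i" for X Y
      by (rule covariant_tensor_cong[OF ct that])
    fix xs ys :: "8 list" assume l: "length xs = k"
    show "self_dual g e (?\<beta> xs)" by (rule self_dual_cmult[OF self_dual_Om])
    assume "length ys = 4"
    have "\<alpha> (nth (map e xs @ map e ys)) = \<alpha> (nth (map e xs))"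
      by (rule covariant_tensor_cong[OF \<alpha>]) (use l in \<open>simp add: nth_append\<close>)
    then show "?T (nth (map e xs @ map e ys)) = ?\<beta> xs (nth (map e ys))"
      using l by (simp add: nth_append)
  qed
  \<comment> \<open>The factor of the wedge product, (k+4)!/(k! 4!), meets 24/(k+4)! from
    \<open>hodge_self_dual\<close>, which leaves 1/k!.\<close>
  then have "hodge g e (k + 4) (wedge k 4 \<alpha> ?Om) X = fact (k + 4) / (fact k * fact 4) *
      (24 * (\<Sum>xs\<in>basis_lists k. ?\<beta> xs (nth (map e xs @ map X [0..<4 - k]))) / fact (k + 4))"
    using k unfolding wedge_def hodge_cmult by (simp add: hodge_alt[OF exterior_volume])
  then show ?thesis by (simp add: fact_numeral)
qed

lemma hodge_wedge_2:
  assumes \<beta>: "covariant_tensor 2 \<beta>"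
  shows "hodge g e 6 (wedge 2 4 \<beta> (\<lambda>X. Om (X 0) (X 1) (X 2) (X 3))) X =
    1 / 2 * (\<Sum>i\<in>UNIV. \<Sum>j\<in>UNIV. \<beta> (nth [e i, e j]) * Om (e i) (e j) (X 0) (X 1))"
  using hodge_wedge[OF \<beta>, of X]
  by (simp add: numeral_2_eq_2 sum_basis_lists_Suc numeral_3_eq_3 upt_rec eval_nat_numeral)

lemma hodge_wedge_3:
  assumes \<alpha>: "covariant_tensor 3 \<alpha>"
  shows "hodge g e 7 (wedge 3 4 \<alpha> (\<lambda>X. Om (X 0) (X 1) (X 2) (X 3))) X =
    1 / 6 * (\<Sum>i\<in>UNIV. \<Sum>j\<in>UNIV. \<Sum>k\<in>UNIV. \<alpha> (nth [e i, e j, e k]) * Om (e i) (e j) (e k) (X 0))"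
  using hodge_wedge[OF \<alpha>, of X]
  by (simp add: numeral_3_eq_3 sum_basis_lists_Suc numeral_2_eq_2 upt_rec eval_nat_numeral)

end

context positive_spinor_derivative
begin

definition nabla_Om :: "real^8 \<Rightarrow> tensor" where
  "nabla_Om v X = - 2 * (A4 (X 0) (X 1) (X 2) (X 3) \<eta> \<bullet> N v)"

lemma self_dual_nabla_Om: "self_dual g e (nabla_Om v)"
  using self_dual_cmult[OF self_dual_aprod[of "N v"], of "-2"]
  by (simp add: nabla_Om_def[abs_def] aprod_4)

text \<open>Each of the five summands is the first one composed with a \<open>front_cycle\<close>,
  so under the star all five agree. \<open>hodge_self_dual\<close> with one contracted slot
  finishes, as 5 * 24 / 5! = 1.\<close>

lemma hodge_nabla_Om:
  "hodge g e 5 (\<lambda>X. \<Sum>i\<le>4. (-1) ^ i * nabla_Om (X i) (\<lambda>j. X (if j < i then j else Suc j))) X =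
    star_d (X 0) (X 1) (X 2)"
proof -
  let ?T = "\<lambda>Y. nabla_Om (Y 0) (\<lambda>j. Y (Suc j))"
  have T: "(\<lambda>X. \<Sum>i\<le>4. (-1) ^ i * nabla_Om (X i) (\<lambda>j. X (if j < i then j else Suc j))) =
      (\<lambda>X. \<Sum>i\<le>4. (-1) ^ i * ?T (X \<circ> front_cycle i))"
    by (simp add: front_cycle_0 front_cycle_Suc)
  have "hodge g e 5 (\<lambda>X. \<Sum>i\<le>4. (-1) ^ i * ?T (X \<circ> front_cycle i)) X =
      (\<Sum>i\<le>4. (-1) ^ i * hodge g e 5 (\<lambda>X. ?T (X \<circ> front_cycle i)) X)"
    by (simp only: hodge_sum hodge_cmult)
  also have "\<dots> = (\<Sum>i\<le>4::nat. hodge g e 5 ?T X)"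
  proof (intro sum.cong refl)
    fix i :: nat assume "i \<in> {..4}"
    then have "hodge g e 5 (\<lambda>X. ?T (X \<circ> front_cycle i)) X = (-1) ^ i * hodge g e 5 ?T X"
      using hodge_permute[OF exterior_volume front_cycle_permutes[of i 5], of ?T X]
      by (simp add: sign_front_cycle)
    then show "(-1) ^ i * hodge g e 5 (\<lambda>X. ?T (X \<circ> front_cycle i)) X = hodge g e 5 ?T X"
      by (simp flip: mult.assoc power_add)
  qed
  also have "\<dots> = 5 * hodge g e 5 ?T X" by simp
  also have "hodge g e 5 ?T X = hodge g e (1 + 4) ?T X" by simp
  also have "\<dots> = 24 * (\<Sum>xs\<in>basis_lists 1. nabla_Om (e (hd xs)) (nth (map e xs @ map X [0..<4 - 1]))) / fact (1 + 4)"
  proof (rule hodge_self_dual[OF exterior_volume])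
    show "?T X = ?T Y" if "\<And>i. i < 1 + 4 \<Longrightarrow> X i = Y i" for X Y
      by (simp add: nabla_Om_def that)
    fix xs ys :: "8 list" assume "length xs = 1" "length ys = 4"
    then show "?T (nth (map e xs @ map e ys)) = nabla_Om (e (hd xs)) (nth (map e ys))"
      by (auto simp: length_Suc_conv)
  qed (simp_all add: self_dual_nabla_Om)
  also have "\<dots> = 24 * star_d (X 0) (X 1) (X 2) / fact 5"
    by (simp add: sum_basis_lists_Suc star_d_def nabla_Om_def upt_rec numeral_2_eq_2 numeral_3_eq_3)
  finally show ?thesis unfolding T by (simp add: fact_numeral)
qed

lemma exterior_form_star_d: "exterior_form 3 (\<lambda>X. star_d (X 0) (X 1) (X 2))"
proof -
  have "(\<lambda>X. star_d (X 0) (X 1) (X 2)) =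
     (\<lambda>X. \<Sum>i\<in>UNIV. - 2 * (aprod cl 4 (\<lambda>m. if m < 1 then e i else X (m - 1)) \<eta> \<bullet> N (e i)))"
    by (simp add: star_d_def aprod_4 fun_eq_iff)
  moreover have "exterior_form 3 \<dots>"
    using exterior_form_aprod[of 4]
    by (intro exterior_form_sum exterior_form_scale exterior_form_fix_initial[of 1 3]) simp
  ultimately show ?thesis by simp
qed

lemma star_d_wedge_Om:
  assumes "D = 0"
  shows "wedge 3 4 (\<lambda>X. star_d (X 0) (X 1) (X 2)) (\<lambda>X. Om (X 0) (X 1) (X 2) (X 3)) = (\<lambda>X. 0)"
proof -
  have ct: "covariant_tensor 3 (\<lambda>X. star_d (X 0) (X 1) (X 2))"
    "covariant_tensor 4 (\<lambda>X. Om (X 0) (X 1) (X 2) (X 3))"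
    using exterior_form_star_d exterior_form_Om by (simp_all add: exterior_form_def)
  show ?thesis
  proof (rule hodge_eq_0_7)
    show "exterior_form 7 (wedge 3 4 (\<lambda>X. star_d (X 0) (X 1) (X 2)) (\<lambda>X. Om (X 0) (X 1) (X 2) (X 3)))"
      using exterior_form_wedge[OF ct] by simp
    show "hodge g e 7 (wedge 3 4 (\<lambda>X. star_d (X 0) (X 1) (X 2)) (\<lambda>X. Om (X 0) (X 1) (X 2) (X 3))) X = 0" for X
      unfolding hodge_wedge_3[OF ct(1)] using star_d_orthogonal[OF assms, of "X 0"] by simp
  qed
qed

end

subsection \<open>The Leibniz rule for the spin connection\<close>

text \<open>\<open>B\<close> is the zeroth order part of a connection in a trivialisation, so
  \<open>f'\<close> is the directional derivative of \<open>f\<close> along \<open>v\<close> plus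
  \<open>B (f x)\<close>. Differentiability is part of the notion, so that Leibniz rules compose
  without side conditions.\<close>

definition covariant_deriv ::
  "('b::real_normed_vector \<Rightarrow> 'b) \<Rightarrow> 'a::real_normed_vector \<Rightarrow> 'a \<Rightarrow> ('a \<Rightarrow> 'b) \<Rightarrow> 'b \<Rightarrow> bool" where
  "covariant_deriv B x v f f' \<longleftrightarrow> (\<exists>D. (f has_derivative D) (at x) \<and> D v = f' - B (f x))"

lemma covariant_deriv_diff:
  assumes "linear B" "covariant_deriv B x v f f'" "covariant_deriv B x v h h'"
  shows "covariant_deriv B x v (\<lambda>y. f y - h y) (f' - h')"
proof -
  obtain F where F: "(f has_derivative F) (at x)" "F v = f' - B (f x)"
    using assms(2) by (auto simp: covariant_deriv_def)
  obtain H where H: "(h has_derivative H) (at x)" "H v = h' - B (h x)"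
    using assms(3) by (auto simp: covariant_deriv_def)
  show ?thesis unfolding covariant_deriv_def
    using has_derivative_diff[OF F(1) H(1)] by (intro exI[of _ "\<lambda>u. F u - H u"]) (simp add: F(2) H(2) linear_diff[OF assms(1)])
qed

lemma covariant_deriv_add:
  assumes "linear B" "covariant_deriv B x v f f'" "covariant_deriv B x v h h'"
  shows "covariant_deriv B x v (\<lambda>y. f y + h y) (f' + h')"
proof -
  obtain F where F: "(f has_derivative F) (at x)" "F v = f' - B (f x)"
    using assms(2) by (auto simp: covariant_deriv_def)
  obtain H where H: "(h has_derivative H) (at x)" "H v = h' - B (h x)"
    using assms(3) by (auto simp: covariant_deriv_def)
  show ?thesis unfolding covariant_deriv_def
    using has_derivative_add[OF F(1) H(1)] by (intro exI[of _ "\<lambda>u. F u + H u"]) (simp add: F(2) H(2) linear_add[OF assms(1)])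
qed

lemma covariant_deriv_scaleR:
  assumes "linear B" "covariant_deriv B x v f f'"
  shows "covariant_deriv B x v (\<lambda>y. c *\<^sub>R f y) (c *\<^sub>R f')"
proof -
  obtain F where F: "(f has_derivative F) (at x)" "F v = f' - B (f x)"
    using assms(2) by (auto simp: covariant_deriv_def)
  show ?thesis unfolding covariant_deriv_def
    using has_derivative_scaleR_right[OF F(1)]
    by (intro exI[of _ "\<lambda>u. c *\<^sub>R F u"]) (simp add: F(2) linear_cmul[OF assms(1)] scaleR_right_diff_distrib)
qed

lemma covariant_deriv_inner:
  fixes f h :: "'a::real_normed_vector \<Rightarrow> 'b::real_inner"
  assumes "\<And>\<phi> \<psi>. B \<phi> \<bullet> \<psi> = - (\<phi> \<bullet> B \<psi>)" "covariant_deriv B x v f f'" "covariant_deriv B x v h h'"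
  shows "\<exists>D. ((\<lambda>y. f y \<bullet> h y) has_derivative D) (at x) \<and> D v = f' \<bullet> h x + f x \<bullet> h'"
proof -
  obtain F where F: "(f has_derivative F) (at x)" "F v = f' - B (f x)"
    using assms(2) by (auto simp: covariant_deriv_def)
  obtain H where H: "(h has_derivative H) (at x)" "H v = h' - B (h x)"
    using assms(3) by (auto simp: covariant_deriv_def)
  show ?thesis
    using has_derivative_inner[OF F(1) H(1)]
    by (intro exI[of _ "\<lambda>u. f x \<bullet> H u + F u \<bullet> h x"])
       (simp add: F(2) H(2) inner_diff_left inner_diff_right assms(1))
qed

section \<open>Infinitesimal rotations and their lift to spinors\<close>

context spin_space
begin

definition rot_op :: "(8 \<Rightarrow> 8 \<Rightarrow> real) \<Rightarrow> real^16 \<Rightarrow> real^16" where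
  "rot_op \<omega> \<phi> = (1 / 4) *\<^sub>R (\<Sum>j\<in>UNIV. \<Sum>k\<in>UNIV. \<omega> j k *\<^sub>R cl (e j) (cl (e k) \<phi>))"

definition rot :: "(8 \<Rightarrow> 8 \<Rightarrow> real) \<Rightarrow> real^8 \<Rightarrow> real^8" where
  "rot \<omega> u = (\<Sum>j\<in>UNIV. \<Sum>k\<in>UNIV. (\<omega> j k * g (e j) u) *\<^sub>R e k)"

lemma linear_rot_op: "linear (rot_op \<omega>)"
  by (intro linearI)
     (simp_all add: rot_op_def cl_simps scaleR_right_distrib sum.distrib scaleR_sum_right mult.commute)

lemma rot_op_skew:
  assumes "\<And>j k. \<omega> j k = - \<omega> k j"
  shows "rot_op \<omega> \<phi> \<bullet> \<psi> = - (\<phi> \<bullet> rot_op \<omega> \<psi>)"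
proof -
  have "(\<Sum>j\<in>UNIV. \<Sum>k\<in>UNIV. \<omega> j k * (cl (e j) (cl (e k) \<phi>) \<bullet> \<psi>)) =
      (\<Sum>j\<in>UNIV. \<Sum>k\<in>UNIV. \<omega> j k * (\<phi> \<bullet> cl (e k) (cl (e j) \<psi>)))"
    by (simp add: skew)
  also have "\<dots> = (\<Sum>k\<in>UNIV. \<Sum>j\<in>UNIV. \<omega> j k * (\<phi> \<bullet> cl (e k) (cl (e j) \<psi>)))"
    by (rule sum.swap)
  also have "\<dots> = (\<Sum>k\<in>UNIV. \<Sum>j\<in>UNIV. - \<omega> k j * (\<phi> \<bullet> cl (e k) (cl (e j) \<psi>)))"
    by (intro sum.cong refl arg_cong2[of _ _ _ _ "(*)"] assms)
  also have "\<dots> = - (\<Sum>k\<in>UNIV. \<Sum>j\<in>UNIV. \<omega> k j * (\<phi> \<bullet> cl (e k) (cl (e j) \<psi>)))"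
    by (simp add: sum_negf)
  finally show ?thesis by (simp add: rot_op_def inner_sum_left inner_sum_right)
qed

text \<open>The commutator of \<open>rot_op \<omega>\<close> with u is
  \<open>rot \<omega> u\<close>; this compatibility yields the Leibniz rule
  \<open>covariant_deriv_cl\<close>. Commuting e_j e_k past u leaves two remainders with coefficient
  2, equal after summation because \<omega> is skew: 4 in total, against the 1/4 of
  \<open>rot_op\<close>.\<close>

lemma rot_op_cl:
  assumes "\<And>j k. \<omega> j k = - \<omega> k j"
  shows "rot_op \<omega> (cl u \<phi>) = cl (rot \<omega> u) \<phi> + cl u (rot_op \<omega> \<phi>)"
proof -
  have t: "cl (e j) (cl (e k) (cl u \<phi>)) = cl u (cl (e j) (cl (e k) \<phi>)) + (2 * g (e j) u) *\<^sub>R cl (e k) \<phi>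
      - (2 * g (e k) u) *\<^sub>R cl (e j) \<phi>" for j k
    unfolding cl_swap[of "e k" u] cl_diff cl_minus cl_scaleR cl_swap[of "e j" u] by simp
  let ?S = "\<Sum>j\<in>UNIV. \<Sum>k\<in>UNIV. (\<omega> j k * g (e j) u) *\<^sub>R cl (e k) \<phi>"
  have "(\<Sum>j\<in>UNIV. \<Sum>k\<in>UNIV. (\<omega> j k * g (e k) u) *\<^sub>R cl (e j) \<phi>) =
      (\<Sum>k\<in>UNIV. \<Sum>j\<in>UNIV. (\<omega> j k * g (e k) u) *\<^sub>R cl (e j) \<phi>)"
    by (rule sum.swap)
  also have "\<dots> = (\<Sum>k\<in>UNIV. \<Sum>j\<in>UNIV. (- \<omega> k j * g (e k) u) *\<^sub>R cl (e j) \<phi>)"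
    by (intro sum.cong refl arg_cong2[of _ _ _ _ "(*\<^sub>R)"] arg_cong2[of _ _ _ _ "(*)"] assms)
  also have "\<dots> = - ?S" by (simp add: sum_negf)
  finally have s: "(\<Sum>j\<in>UNIV. \<Sum>k\<in>UNIV. (\<omega> j k * g (e k) u) *\<^sub>R cl (e j) \<phi>) = - ?S" .
  have w: "\<omega> j k *\<^sub>R (a + (2 * p) *\<^sub>R x - (2 * q) *\<^sub>R y) =
      \<omega> j k *\<^sub>R a + 2 *\<^sub>R ((\<omega> j k * p) *\<^sub>R x) - 2 *\<^sub>R ((\<omega> j k * q) *\<^sub>R y)" for j k p q and a x y :: "real^16"
    by (simp add: scaleR_right_distrib scaleR_right_diff_distrib mult.left_commute)
  have "(\<Sum>j\<in>UNIV. \<Sum>k\<in>UNIV. \<omega> j k *\<^sub>R cl (e j) (cl (e k) (cl u \<phi>))) =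
     (\<Sum>j\<in>UNIV. \<Sum>k\<in>UNIV. \<omega> j k *\<^sub>R cl u (cl (e j) (cl (e k) \<phi>))) + 2 *\<^sub>R ?S - 2 *\<^sub>R (- ?S)"
    unfolding t w sum.distrib sum_subtractf scaleR_sum_right[symmetric] s by simp
  then have "rot_op \<omega> (cl u \<phi>) = (1 / 4) *\<^sub>R (\<Sum>j\<in>UNIV. \<Sum>k\<in>UNIV. \<omega> j k *\<^sub>R cl u (cl (e j) (cl (e k) \<phi>))) + ?S"
    by (simp add: rot_op_def vec_eq_iff field_simps)
  also have "?S = cl (rot \<omega> u) \<phi>" by (simp add: rot_def cl_sum cl_scaleR)
  finally show ?thesis by (simp add: rot_op_def cl_sum cl_scaleR)
qed

lemma vol_rot_op: "vol_op (rot_op \<omega> \<phi>) = rot_op \<omega> (vol_op \<phi>)"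
  by (simp add: rot_op_def linear_cmul[OF linear_vol_op] linear_sum[OF linear_vol_op] vol_op_cl cl_simps)

lemma bounded_bilinear_cl: "bounded_bilinear cl"
  using bilinear_cl by (simp add: bilinear_conv_bounded_bilinear)

lemma covariant_deriv_cl:
  assumes \<omega>: "\<And>j k. \<omega> j k = - \<omega> k j"
    and y: "covariant_deriv (rot \<omega>) x v y y'" and f: "covariant_deriv (rot_op \<omega>) x v f f'"
  shows "covariant_deriv (rot_op \<omega>) x v (\<lambda>u. cl (y u) (f u)) (cl y' (f x) + cl (y x) f')"
proof -
  obtain F where F: "(f has_derivative F) (at x)" "F v = f' - rot_op \<omega> (f x)"
    using f by (auto simp: covariant_deriv_def)
  obtain Y where Y: "(y has_derivative Y) (at x)" "Y v = y' - rot \<omega> (y x)"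
    using y by (auto simp: covariant_deriv_def)
  show ?thesis unfolding covariant_deriv_def
    using bounded_bilinear.FDERIV[OF bounded_bilinear_cl Y(1) F(1)]
    by (intro exI[of _ "\<lambda>u. cl (y x) (F u) + cl (Y u) (f x)"]) (simp add: F(2) Y(2) cl_simps rot_op_cl[OF \<omega>])
qed

lemma covariant_deriv_A2:
  assumes \<omega>: "\<And>j k. \<omega> j k = - \<omega> k j"
    and y: "covariant_deriv (rot \<omega>) x v y y'" and z: "covariant_deriv (rot \<omega>) x v z z'"
    and f: "covariant_deriv (rot_op \<omega>) x v f f'"
  shows "covariant_deriv (rot_op \<omega>) x v (\<lambda>u. A2 (y u) (z u) (f u))
    (A2 y' (z x) (f x) + A2 (y x) z' (f x) + A2 (y x) (z x) f')"
proof -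
  have "covariant_deriv (rot_op \<omega>) x v (\<lambda>u. A2 (y u) (z u) (f u))
    ((1 / 2) *\<^sub>R ((cl y' (cl (z x) (f x)) + cl (y x) (cl z' (f x) + cl (z x) f'))
      - (cl z' (cl (y x) (f x)) + cl (z x) (cl y' (f x) + cl (y x) f'))))"
    unfolding A2_def
    by (intro covariant_deriv_scaleR covariant_deriv_diff covariant_deriv_cl linear_rot_op \<omega> y z f)
  also have "(1 / 2) *\<^sub>R ((cl y' (cl (z x) (f x)) + cl (y x) (cl z' (f x) + cl (z x) f'))
      - (cl z' (cl (y x) (f x)) + cl (z x) (cl y' (f x) + cl (y x) f'))) =
      A2 y' (z x) (f x) + A2 (y x) z' (f x) + A2 (y x) (z x) f'"
    by (simp add: A2_def cl_simps vec_eq_iff field_simps)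
  finally show ?thesis .
qed

lemma A2_add: "A2 y z (\<phi> + \<psi>) = A2 y z \<phi> + A2 y z \<psi>"
  by (simp add: A2_def cl_simps vec_eq_iff field_simps)

lemma covariant_deriv_A3:
  assumes \<omega>: "\<And>j k. \<omega> j k = - \<omega> k j"
    and w: "covariant_deriv (rot \<omega>) x v w w'" and y: "covariant_deriv (rot \<omega>) x v y y'"
    and z: "covariant_deriv (rot \<omega>) x v z z'" and f: "covariant_deriv (rot_op \<omega>) x v f f'"
  shows "covariant_deriv (rot_op \<omega>) x v (\<lambda>u. A3 (w u) (y u) (z u) (f u))
    (A3 w' (y x) (z x) (f x) + A3 (w x) y' (z x) (f x) + A3 (w x) (y x) z' (f x) + A3 (w x) (y x) (z x) f')"
proof -
  have "covariant_deriv (rot_op \<omega>) x v (\<lambda>u. A3 (w u) (y u) (z u) (f u))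
    ((1 / 2) *\<^sub>R ((cl w' (A2 (y x) (z x) (f x)) + cl (w x) (A2 y' (z x) (f x) + A2 (y x) z' (f x) + A2 (y x) (z x) f'))
      + (A2 y' (z x) (cl (w x) (f x)) + A2 (y x) z' (cl (w x) (f x)) + A2 (y x) (z x) (cl w' (f x) + cl (w x) f'))))"
    unfolding A3_def
    by (intro covariant_deriv_scaleR covariant_deriv_add covariant_deriv_cl covariant_deriv_A2 linear_rot_op \<omega> w y z f)
  also have "(1 / 2) *\<^sub>R ((cl w' (A2 (y x) (z x) (f x)) + cl (w x) (A2 y' (z x) (f x) + A2 (y x) z' (f x) + A2 (y x) (z x) f'))
      + (A2 y' (z x) (cl (w x) (f x)) + A2 (y x) z' (cl (w x) (f x)) + A2 (y x) (z x) (cl w' (f x) + cl (w x) f'))) =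
    A3 w' (y x) (z x) (f x) + A3 (w x) y' (z x) (f x) + A3 (w x) (y x) z' (f x) + A3 (w x) (y x) (z x) f'"
    by (simp add: A3_def A2_add cl_add scaleR_right_distrib)
  finally show ?thesis .
qed

text \<open>The derivative of the quadratic expression in \<phi> that defines the 4-form. Symmetry
  of \<open>A3\<close> and skewness of \<open>cl w\<close> move both terms onto \<psi>, where they
  combine to the commutator in \<open>A4\<close>; hence the -2.\<close>

lemma A3_polarize: "A3 x y z \<psi> \<bullet> cl w \<phi> + A3 x y z \<phi> \<bullet> cl w \<psi> = - 2 * (A4 w x y z \<phi> \<bullet> \<psi>)"
proof -
  have "A3 x y z \<psi> \<bullet> cl w \<phi> = A3 x y z (cl w \<phi>) \<bullet> \<psi>"
    using A3_symmetric[of x y z \<psi> "cl w \<phi>"] A3_symmetric[of x y z "cl w \<phi>" \<psi>] by (simp add: inner_commute)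
  moreover have "A3 x y z \<phi> \<bullet> cl w \<psi> = - (cl w (A3 x y z \<phi>) \<bullet> \<psi>)"
    using skew[of w "A3 x y z \<phi>" \<psi>] by simp
  ultimately show ?thesis by (simp add: A4_def inner_diff_left field_simps)
qed

text \<open>The zeroth order terms of the spin connection cancel because the form
  \<open>\<langle>A\<^sub>3(x,y,z)\<phi>, w\<phi>\<rangle>\<close> is invariant under \<open>Spin(8)\<close>.\<close>

lemma derivative_A3_cl:
  assumes \<omega>: "\<And>j k. \<omega> j k = - \<omega> k j"
    and w: "covariant_deriv (rot \<omega>) x v w w'" and y: "covariant_deriv (rot \<omega>) x v y y'"
    and z: "covariant_deriv (rot \<omega>) x v z z'" and t: "covariant_deriv (rot \<omega>) x v t t'"
    and f: "covariant_deriv (rot_op \<omega>) x v f f'"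
  shows "\<exists>D. ((\<lambda>u. A3 (y u) (z u) (t u) (f u) \<bullet> cl (w u) (f u)) has_derivative D) (at x) \<and>
    D v = A3 (y x) (z x) (t x) (f x) \<bullet> cl w' (f x) + A3 y' (z x) (t x) (f x) \<bullet> cl (w x) (f x)
      + A3 (y x) z' (t x) (f x) \<bullet> cl (w x) (f x) + A3 (y x) (z x) t' (f x) \<bullet> cl (w x) (f x)
      - 2 * (A4 (w x) (y x) (z x) (t x) (f x) \<bullet> f')"
proof -
  have "\<exists>D. ((\<lambda>u. A3 (y u) (z u) (t u) (f u) \<bullet> cl (w u) (f u)) has_derivative D) (at x) \<and>
    D v = (A3 y' (z x) (t x) (f x) + A3 (y x) z' (t x) (f x) + A3 (y x) (z x) t' (f x) + A3 (y x) (z x) (t x) f')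
      \<bullet> cl (w x) (f x) + A3 (y x) (z x) (t x) (f x) \<bullet> (cl w' (f x) + cl (w x) f')"
    by (intro covariant_deriv_inner[where B = "rot_op \<omega>"] rot_op_skew covariant_deriv_A3 covariant_deriv_cl \<omega> w y z t f)
  then show ?thesis
    using A3_polarize[of "y x" "z x" "t x" f' "w x" "f x"]
    by (simp add: inner_add_left inner_add_right algebra_simps)
qed

end

subsection \<open>Charts and coordinate vector fields\<close>

lemma frechet_derivative_cong_open:
  assumes "open S" "x \<in> S" "\<And>y. y \<in> S \<Longrightarrow> f y = h y"
  shows "frechet_derivative f (at x) = frechet_derivative h (at x)"
proof -
  have "(f has_derivative D) (at x) \<longleftrightarrow> (h has_derivative D) (at x)" for D
    using has_derivative_transform_within_open[of f D x UNIV S h]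
      has_derivative_transform_within_open[of h D x UNIV S f] assms by auto
  then show ?thesis by (simp add: frechet_derivative_def)
qed

lemma differentiable_cong_open:
  assumes "open S" "x \<in> S" "\<And>y. y \<in> S \<Longrightarrow> f y = h y" "f differentiable (at x)"
  shows "h differentiable (at x)"
  using assms has_derivative_transform_within_open[of f _ x UNIV S h]
  unfolding differentiable_def by blast

lemma Ck_on_cong:
  assumes "open S" "\<And>x. x \<in> S \<Longrightarrow> f x = h x" "Ck_on n S f"
  shows "Ck_on n S h"
  using assms(2,3)
proof (induction n arbitrary: f h)
  case 0
  then show ?case using continuous_on_cong[of S S f h] by auto
next
  case (Suc n)
  have "Ck_on n S (\<lambda>x. frechet_derivative h (at x) v)" for v
  proof (rule Suc.IH)
    show "Ck_on n S (\<lambda>x. frechet_derivative f (at x) v)" using Suc.prems by simp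
    show "frechet_derivative f (at x) v = frechet_derivative h (at x) v" if "x \<in> S" for x
      using frechet_derivative_cong_open[OF assms(1) that, of f h] Suc.prems by simp
  qed
  moreover have "h differentiable (at x)" if "x \<in> S" for x
    using differentiable_cong_open[OF assms(1) that, of f h] Suc.prems that by simp
  ultimately show ?case by simp
qed

lemma Ck_on_subset: "T \<subseteq> S \<Longrightarrow> Ck_on n S f \<Longrightarrow> Ck_on n T f"
  by (induction n arbitrary: f) (auto intro: continuous_on_subset)

lemma Ck_on_Suc_D: "Ck_on (Suc n) S f \<Longrightarrow> Ck_on n S f"
proof (induction n arbitrary: f)
  case 0
  then show ?case
    by (auto intro!: continuous_at_imp_continuous_on differentiable_imp_continuous_within)
qed simp

lemma Ck_on_const: "Ck_on n S (\<lambda>x. c)"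
  by (induction n arbitrary: c) (simp_all add: frechet_derivative_const)

lemma Ck_on_add:
  assumes "open S"
  shows "Ck_on n S f \<Longrightarrow> Ck_on n S h \<Longrightarrow> Ck_on n S (\<lambda>x. f x + h x)"
proof (induction n arbitrary: f h)
  case 0
  then show ?case by (simp add: continuous_on_add)
next
  case (Suc n)
  have D: "((\<lambda>x. f x + h x) has_derivative
      (\<lambda>v. frechet_derivative f (at x) v + frechet_derivative h (at x) v)) (at x)" if "x \<in> S" for x
    using Suc.prems that by (intro has_derivative_add) (simp_all flip: frechet_derivative_works)
  have "Ck_on n S (\<lambda>x. frechet_derivative (\<lambda>x. f x + h x) (at x) v)" for v
  proof (rule Ck_on_cong[OF assms])
    show "Ck_on n S (\<lambda>x. frechet_derivative f (at x) v + frechet_derivative h (at x) v)"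
      using Suc by simp
    show "frechet_derivative f (at x) v + frechet_derivative h (at x) v = frechet_derivative (\<lambda>x. f x + h x) (at x) v"
      if "x \<in> S" for x
      using frechet_derivative_at[OF D[OF that]] by metis
  qed
  then show ?case using Suc.prems by simp
qed

lemma Ck_on_sum:
  assumes "open S" "\<And>a. a \<in> A \<Longrightarrow> Ck_on n S (f a)"
  shows "Ck_on n S (\<lambda>x. \<Sum>a\<in>A. f a x)"
  using assms(2)
proof (induction A rule: infinite_finite_induct)
  case (insert a A)
  then show ?case using Ck_on_add[OF assms(1), of n "f a" "\<lambda>x. \<Sum>a\<in>A. f a x"] by simp
qed (simp_all add: Ck_on_const)

lemma Ck_on_scaleR:
  assumes "open S"
  shows "Ck_on n S f \<Longrightarrow> Ck_on n S h \<Longrightarrow> Ck_on n S (\<lambda>x. f x *\<^sub>R h x)"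
proof (induction n arbitrary: f h)
  case 0
  then show ?case by (simp add: continuous_on_scaleR)
next
  case (Suc n)
  have D: "((\<lambda>x. f x *\<^sub>R h x) has_derivative
      (\<lambda>v. f x *\<^sub>R frechet_derivative h (at x) v + frechet_derivative f (at x) v *\<^sub>R h x)) (at x)" if "x \<in> S" for x
    using Suc.prems that by (intro has_derivative_scaleR) (simp_all flip: frechet_derivative_works)
  have "Ck_on n S (\<lambda>x. frechet_derivative (\<lambda>x. f x *\<^sub>R h x) (at x) v)" for v
  proof (rule Ck_on_cong[OF assms])
    have "Ck_on n S f" "Ck_on n S h" using Suc.prems by (auto intro: Ck_on_Suc_D)
    then show "Ck_on n S (\<lambda>x. f x *\<^sub>R frechet_derivative h (at x) v + frechet_derivative f (at x) v *\<^sub>R h x)"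
      using Suc by (intro Ck_on_add[OF assms] Suc.IH) simp_all
    show "f x *\<^sub>R frechet_derivative h (at x) v + frechet_derivative f (at x) v *\<^sub>R h x =
        frechet_derivative (\<lambda>x. f x *\<^sub>R h x) (at x) v" if "x \<in> S" for x
      using frechet_derivative_at[OF D[OF that]] by metis
  qed
  then show ?case using D by (auto simp: differentiable_def)
qed

lemma Ck_on_inner:
  fixes f :: "'a::real_normed_vector \<Rightarrow> 'b::real_inner"
  assumes "open S"
  shows "Ck_on n S f \<Longrightarrow> Ck_on n S (\<lambda>x. f x \<bullet> b)"
proof (induction n arbitrary: f)
  case 0
  then show ?case by (simp add: continuous_on_inner)
next
  case (Suc n)
  have D: "((\<lambda>x. f x \<bullet> b) has_derivative (\<lambda>v. frechet_derivative f (at x) v \<bullet> b)) (at x)" if "x \<in> S" for x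
    using Suc.prems that by (intro has_derivative_inner_left) (simp flip: frechet_derivative_works)
  have "Ck_on n S (\<lambda>x. frechet_derivative (\<lambda>x. f x \<bullet> b) (at x) v)" for v
  proof (rule Ck_on_cong[OF assms])
    show "Ck_on n S (\<lambda>x. frechet_derivative f (at x) v \<bullet> b)" using Suc by simp
    show "frechet_derivative f (at x) v \<bullet> b = frechet_derivative (\<lambda>x. f x \<bullet> b) (at x) v" if "x \<in> S" for x
      using frechet_derivative_at[OF D[OF that]] by metis
  qed
  then show ?case using D by (auto simp: differentiable_def)
qed

text \<open>\<open>Ck_on\<close> iterates derivatives along fixed vectors, whereas the chain rule
  feeds the derivative of \<open>h\<close> the moving vector f'(x) v. Expanding that vector in
  \<open>Basis\<close> gives a sum of products covered by the induction; hence the Euclidean type in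
  the middle.\<close>

lemma Ck_on_compose:
  fixes f :: "'a::real_normed_vector \<Rightarrow> 'b::euclidean_space" and h :: "'b \<Rightarrow> 'c::real_normed_vector"
  assumes S: "open S" and T: "open T" and fS: "f ` S \<subseteq> T"
  shows "Ck_on n S f \<Longrightarrow> Ck_on n T h \<Longrightarrow> Ck_on n S (\<lambda>x. h (f x))"
proof (induction n arbitrary: h)
  case 0
  then show ?case using continuous_on_compose2[of T h S f] fS by simp
next
  case (Suc n)
  have D: "((\<lambda>x. h (f x)) has_derivative
      (\<lambda>v. frechet_derivative h (at (f x)) (frechet_derivative f (at x) v))) (at x)" if "x \<in> S" for x
  proof -
    have "(f has_derivative frechet_derivative f (at x)) (at x)"
      using Suc.prems that by (simp flip: frechet_derivative_works)
    moreover have "(h has_derivative frechet_derivative h (at (f x))) (at (f x))"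
      using Suc.prems that fS by (auto simp flip: frechet_derivative_works)
    ultimately show ?thesis using diff_chain_at[of f _ x h] by (simp add: comp_def)
  qed
  have f: "Ck_on n S f" using Suc.prems by (auto intro: Ck_on_Suc_D)
  have "Ck_on n S (\<lambda>x. frechet_derivative (\<lambda>x. h (f x)) (at x) v)" for v
  proof (rule Ck_on_cong[OF S])
    show "Ck_on n S (\<lambda>x. \<Sum>b\<in>Basis. (frechet_derivative f (at x) v \<bullet> b) *\<^sub>R frechet_derivative h (at (f x)) b)"
    proof (intro Ck_on_sum[OF S] Ck_on_scaleR[OF S] Ck_on_inner[OF S])
      show "Ck_on n S (\<lambda>x. frechet_derivative f (at x) v)" using Suc.prems by simp
      show "Ck_on n S (\<lambda>x. frechet_derivative h (at (f x)) b)" for b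
        using Suc.prems by (intro Suc.IH f) simp
    qed
    fix x assume x: "x \<in> S"
    then have "h differentiable (at (f x))" using Suc.prems fS by auto
    then have l: "linear (frechet_derivative h (at (f x)))" by (rule linear_frechet_derivative)
    have "frechet_derivative h (at (f x)) (frechet_derivative f (at x) v) =
        frechet_derivative h (at (f x)) (\<Sum>b\<in>Basis. (frechet_derivative f (at x) v \<bullet> b) *\<^sub>R b)"
      by (simp add: euclidean_representation)
    then have "frechet_derivative h (at (f x)) (frechet_derivative f (at x) v) =
        (\<Sum>b\<in>Basis. (frechet_derivative f (at x) v \<bullet> b) *\<^sub>R frechet_derivative h (at (f x)) b)"
      by (simp add: linear_sum[OF l] linear_cmul[OF l])
    then show "(\<Sum>b\<in>Basis. (frechet_derivative f (at x) v \<bullet> b) *\<^sub>R frechet_derivative h (at (f x)) b) =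
        frechet_derivative (\<lambda>x. h (f x)) (at x) v"
      using frechet_derivative_at[OF D[OF x]] by metis
  qed
  then show ?case using D by (auto simp: differentiable_def)
qed

lemma smooth_on_differentiable: "smooth_on S f \<Longrightarrow> x \<in> S \<Longrightarrow> f differentiable (at x)"
  unfolding smooth_on_def by (metis Ck_on.simps(2))

lemma smooth_on_frechet_derivative: "smooth_on S f \<Longrightarrow> smooth_on S (\<lambda>x. frechet_derivative f (at x) v)"
  unfolding smooth_on_def by (metis Ck_on.simps(2))

lemma smooth_on_subset: "T \<subseteq> S \<Longrightarrow> smooth_on S f \<Longrightarrow> smooth_on T f"
  unfolding smooth_on_def using Ck_on_subset by blast

lemma smooth_on_cong: "open S \<Longrightarrow> smooth_on S f \<Longrightarrow> (\<And>x. x \<in> S \<Longrightarrow> f x = h x) \<Longrightarrow> smooth_on S h"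
  unfolding smooth_on_def using Ck_on_cong[of S f h] by simp

lemma smooth_on_compose:
  fixes f :: "'a::real_normed_vector \<Rightarrow> 'b::euclidean_space" and h :: "'b \<Rightarrow> 'c::real_normed_vector"
  assumes "open S" "open T" "smooth_on S f" "smooth_on T h" "f ` S \<subseteq> T"
  shows "smooth_on S (\<lambda>x. h (f x))"
  unfolding smooth_on_def
proof
  fix n show "Ck_on n S (\<lambda>x. h (f x))"
    by (rule Ck_on_compose[OF assms(1,2,5)]) (use assms(3,4) in \<open>simp_all add: smooth_on_def\<close>)
qed

section \<open>Change of charts and differentials on the manifold\<close>

locale atlas_manifold =
  fixes M :: "('m::{t2_space, second_countable_topology}, 'z) riemannian_scheme"
  assumes atlas: "oriented_atlas (atlas M)"
begin

lemma chart_at: "chart_at M p \<in> atlas M" "p \<in> fst (chart_at M p)"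
proof -
  have "\<exists>c. c \<in> atlas M \<and> p \<in> fst c" using atlas unfolding oriented_atlas_def by blast
  then have "chart_at M p \<in> atlas M \<and> p \<in> fst (chart_at M p)"
    unfolding chart_at_def by (rule someI_ex)
  then show "chart_at M p \<in> atlas M" "p \<in> fst (chart_at M p)" by auto
qed

lemma chart_homeomorphism:
  assumes "c \<in> atlas M"
  shows "open (fst c)" "open (snd c ` fst c)" "homeomorphism (fst c) (snd c ` fst c) (snd c) (chart_inv c)"
  using assms atlas unfolding oriented_atlas_def by auto

lemma chart_inverse: "c \<in> atlas M \<Longrightarrow> q \<in> fst c \<Longrightarrow> chart_inv c (snd c q) = q"
  using chart_homeomorphism(3)[of c] by (simp add: homeomorphism_def)

lemma open_chart_image:
  assumes c: "c \<in> atlas M" and U: "open U"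
  shows "open (snd c ` (fst c \<inter> U))"
proof -
  have "snd c ` (fst c \<inter> U) = snd c ` fst c \<inter> chart_inv c -` U"
    using chart_inverse[OF c] by (auto simp: image_iff)
  moreover have "continuous_on (snd c ` fst c) (chart_inv c)"
    using chart_homeomorphism(3)[OF c] by (simp add: homeomorphism_def)
  ultimately show ?thesis
    using continuous_open_preimage[OF _ chart_homeomorphism(2)[OF c] U] by simp
qed

lemma transition_smooth:
  "c \<in> atlas M \<Longrightarrow> c' \<in> atlas M \<Longrightarrow> smooth_on (snd c ` (fst c \<inter> fst c')) (snd c' \<circ> chart_inv c)"
  using atlas unfolding oriented_atlas_def by blast

lemma transition_has_derivative:
  assumes "c \<in> atlas M" "c' \<in> atlas M" "q \<in> fst c" "q \<in> fst c'"
  shows "((snd c' \<circ> chart_inv c) has_derivative frechet_derivative (snd c' \<circ> chart_inv c) (at (snd c q))) (at (snd c q))"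
  using smooth_on_differentiable[OF transition_smooth[OF assms(1,2)], of "snd c q"] assms(3,4)
  by (simp flip: frechet_derivative_works)

lemma transition_chain:
  assumes c: "c1 \<in> atlas M" "c2 \<in> atlas M" "c3 \<in> atlas M" and q: "q \<in> fst c1" "q \<in> fst c2" "q \<in> fst c3"
  shows "frechet_derivative (snd c3 \<circ> chart_inv c2) (at (snd c2 q))
      (frechet_derivative (snd c2 \<circ> chart_inv c1) (at (snd c1 q)) v) =
    frechet_derivative (snd c3 \<circ> chart_inv c1) (at (snd c1 q)) v"
proof -
  let ?x = "snd c1 q"
  have v: "(snd c2 \<circ> chart_inv c1) ?x = snd c2 q" using chart_inverse c q by simp
  have "((snd c3 \<circ> chart_inv c2) \<circ> (snd c2 \<circ> chart_inv c1) has_derivative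
     frechet_derivative (snd c3 \<circ> chart_inv c2) (at (snd c2 q)) \<circ> frechet_derivative (snd c2 \<circ> chart_inv c1) (at ?x)) (at ?x)"
    by (intro diff_chain_at transition_has_derivative c q) (use v transition_has_derivative[OF c(2,3) q(2,3)] in simp)
  from frechet_derivative_at[OF this] have
    "frechet_derivative (snd c3 \<circ> chart_inv c2) (at (snd c2 q)) \<circ> frechet_derivative (snd c2 \<circ> chart_inv c1) (at ?x)
      = frechet_derivative ((snd c3 \<circ> chart_inv c2) \<circ> (snd c2 \<circ> chart_inv c1)) (at ?x)" .
  also have "\<dots> = frechet_derivative (snd c3 \<circ> chart_inv c1) (at ?x)"
  proof (rule frechet_derivative_cong_open)
    show "open (snd c1 ` (fst c1 \<inter> fst c2))"
      by (intro open_chart_image chart_homeomorphism c)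
    show "?x \<in> snd c1 ` (fst c1 \<inter> fst c2)" using q by blast
    show "((snd c3 \<circ> chart_inv c2) \<circ> (snd c2 \<circ> chart_inv c1)) y = (snd c3 \<circ> chart_inv c1) y"
      if "y \<in> snd c1 ` (fst c1 \<inter> fst c2)" for y
      using that chart_inverse c by auto
  qed
  finally show ?thesis by (metis comp_apply)
qed

lemma differential_coord_field:
  assumes "c \<in> atlas M" "q \<in> fst c" "q \<in> fst (chart_at M p)"
  shows "differential M (snd c) q (coord_field M p v q) =
    frechet_derivative (snd c \<circ> chart_inv (chart_at M p)) (at (snd (chart_at M p) q)) v"
  unfolding differential_def coord_field_def
  by (intro transition_chain chart_at assms)

lemma frechet_derivative_chart_self:
  assumes c: "c \<in> atlas M" and q: "q \<in> fst c"
  shows "frechet_derivative (snd c \<circ> chart_inv c) (at (snd c q)) v = v"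
proof -
  have "frechet_derivative (snd c \<circ> chart_inv c) (at (snd c q)) = frechet_derivative (\<lambda>x. x) (at (snd c q))"
    by (rule frechet_derivative_cong_open[OF chart_homeomorphism(2)[OF c]])
       (use q chart_inverse[OF c] in auto)
  then show ?thesis by simp
qed

lemma differential_coord_field_self:
  "q \<in> fst (chart_at M p) \<Longrightarrow> differential M (snd (chart_at M p)) q (coord_field M p v q) = v"
  by (simp add: differential_coord_field chart_at frechet_derivative_chart_self)

lemma coord_field_self: "coord_field M p v p = v"
  by (simp add: coord_field_def frechet_derivative_chart_self chart_at)

text \<open>In a chart \<open>c\<close> the components of the field are a directional derivative of
  the transition map from \<open>chart_at M p\<close> to \<open>c\<close>; tested in a further chart
  \<open>c'\<close>, this is composed with one more transition map.\<close>

lemma smooth_coord_field: "smooth_vector_field_on M (fst (chart_at M p)) (coord_field M p v)"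
  unfolding smooth_vector_field_on_def smooth_map_on_def
proof (intro ballI)
  fix c c' assume c: "c \<in> atlas M" and c': "c' \<in> atlas M"
  let ?c0 = "chart_at M p"
  let ?S = "snd c' ` (fst c' \<inter> (fst ?c0 \<inter> fst c))" and ?T = "snd ?c0 ` (fst ?c0 \<inter> fst c)"
  let ?F = "\<lambda>x. frechet_derivative (snd c \<circ> chart_inv ?c0) (at x) v"
  note c0 = chart_at(1)[of p]
  have S: "open ?S" by (intro open_chart_image c' open_Int chart_homeomorphism(1) c c0)
  have T: "open ?T" by (intro open_chart_image c0 chart_homeomorphism(1) c)
  have 1: "smooth_on ?S (snd ?c0 \<circ> chart_inv c')"
    by (rule smooth_on_subset[OF _ transition_smooth[OF c' c0]]) auto
  have 2: "smooth_on ?T ?F"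
    by (rule smooth_on_frechet_derivative[OF transition_smooth[OF c0 c]])
  have 3: "(snd ?c0 \<circ> chart_inv c') ` ?S \<subseteq> ?T"
    using chart_inverse[OF c'] by auto
  show "smooth_on ?S ((\<lambda>q. differential M (snd c) q (coord_field M p v q)) \<circ> chart_inv c')"
    by (rule smooth_on_cong[OF S smooth_on_compose[OF S T 1 2 3]])
       (auto simp: chart_inverse[OF c'] differential_coord_field[OF c])
qed

lemma smooth_map_on_subset:
  assumes "V \<subseteq> U" "smooth_map_on M U F"
  shows "smooth_map_on M V F"
  unfolding smooth_map_on_def
proof
  fix c assume "c \<in> atlas M"
  then have "smooth_on (snd c ` (fst c \<inter> U)) (F \<circ> chart_inv c)"
    using assms(2) by (simp add: smooth_map_on_def)
  then show "smooth_on (snd c ` (fst c \<inter> V)) (F \<circ> chart_inv c)"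
    by (rule smooth_on_subset[rotated]) (use assms(1) in blast)
qed

lemma smooth_vector_field_on_subset:
  assumes "V \<subseteq> U" "smooth_vector_field_on M U X"
  shows "smooth_vector_field_on M V X"
  unfolding smooth_vector_field_on_def
proof
  fix c assume "c \<in> atlas M"
  then have "smooth_map_on M (U \<inter> fst c) (\<lambda>q. differential M (snd c) q (X q))"
    using assms(2) by (simp add: smooth_vector_field_on_def)
  then show "smooth_map_on M (V \<inter> fst c) (\<lambda>q. differential M (snd c) q (X q))"
    by (rule smooth_map_on_subset[rotated]) (use assms(1) in blast)
qed

lemma smooth_map_on_const: "smooth_map_on M U (\<lambda>_. c)"
  unfolding smooth_map_on_def smooth_on_def by (simp add: comp_def Ck_on_const)

lemma smooth_map_has_derivative:
  assumes F: "smooth_map_on M U F" and p: "p \<in> U"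
  shows "((F \<circ> chart_inv (chart_at M p)) has_derivative differential M F p) (at (snd (chart_at M p) p))"
proof -
  have "smooth_on (snd (chart_at M p) ` (fst (chart_at M p) \<inter> U)) (F \<circ> chart_inv (chart_at M p))"
    using F chart_at(1) unfolding smooth_map_on_def by blast
  then have "(F \<circ> chart_inv (chart_at M p)) differentiable (at (snd (chart_at M p) p))"
    by (rule smooth_on_differentiable) (use chart_at p in blast)
  then show ?thesis unfolding differential_def[abs_def] by (simp flip: frechet_derivative_works)
qed

text \<open>Only the germ at p matters. This allows the preferred trivialisation, which may jump
  near p, to be replaced by the fixed one of p before differentiating.\<close>

lemma differential_cong:
  assumes U: "open U" "p \<in> U" and FG: "\<And>q. q \<in> U \<Longrightarrow> q \<in> fst (chart_at M p) \<Longrightarrow> F q = G q"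
  shows "differential M F p = differential M G p"
proof
  fix v
  have "frechet_derivative (F \<circ> chart_inv (chart_at M p)) (at (snd (chart_at M p) p)) =
        frechet_derivative (G \<circ> chart_inv (chart_at M p)) (at (snd (chart_at M p) p))"
  proof (rule frechet_derivative_cong_open)
    show "open (snd (chart_at M p) ` (fst (chart_at M p) \<inter> U))" by (intro open_chart_image chart_at U)
    show "snd (chart_at M p) p \<in> snd (chart_at M p) ` (fst (chart_at M p) \<inter> U)" using chart_at U by blast
    show "(F \<circ> chart_inv (chart_at M p)) y = (G \<circ> chart_inv (chart_at M p)) y"
      if "y \<in> snd (chart_at M p) ` (fst (chart_at M p) \<inter> U)" for y
      using that FG chart_inverse[OF chart_at(1)] by auto
  qed
  then show "differential M F p v = differential M G p v" by (simp add: differential_def)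
qed

lemma differential_const: "differential M (\<lambda>_. c) p v = 0"
  by (simp add: differential_def comp_def frechet_derivative_const)

lemma lie_bracket_coord_field: "lie_bracket M (coord_field M p v) (coord_field M p w) p = 0"
proof -
  have "differential M (\<lambda>q. differential M (snd (chart_at M p)) q (coord_field M p u q)) p =
      differential M (\<lambda>q. u) p" for u
    by (rule differential_cong[OF chart_homeomorphism(1)[OF chart_at(1)] chart_at(2)])
       (rule differential_coord_field_self)
  then show ?thesis by (simp add: lie_bracket_def differential_const)
qed

end

subsection \<open>The spinor bundle\<close>

context spin_space
begin

lemma sum_cl: "(\<Sum>j\<in>UNIV. g u (e j) *\<^sub>R cl (e j) \<psi>) = cl u \<psi>"
  by (subst (2) expand[of u]) (simp add: cl_sum cl_scaleR sym[of u])

lemma sum_cl_3: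
  "(\<Sum>j\<in>UNIV. \<Sum>k\<in>UNIV. \<Sum>l\<in>UNIV. (g u (e j) * g v (e k) * g w (e l)) *\<^sub>R cl (e j) (cl (e k) (cl (e l) \<phi>))) =
    cl u (cl v (cl w \<phi>))"
proof -
  have "(\<Sum>j\<in>UNIV. \<Sum>k\<in>UNIV. \<Sum>l\<in>UNIV. (g u (e j) * g v (e k) * g w (e l)) *\<^sub>R cl (e j) (cl (e k) (cl (e l) \<phi>))) =
     (\<Sum>j\<in>UNIV. g u (e j) *\<^sub>R cl (e j) (\<Sum>k\<in>UNIV. g v (e k) *\<^sub>R cl (e k) (\<Sum>l\<in>UNIV. g w (e l) *\<^sub>R cl (e l) \<phi>)))"
    by (simp add: cl_sum cl_scaleR scaleR_sum_right mult.assoc)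
  then show ?thesis by (simp add: sum_cl)
qed

text \<open>The six-term form matches the expansion in \<open>wedge_flat_3\<close>, through which
  the triple product is defined.\<close>

lemma A3_antisymmetrized:
  "A3 x y z \<phi> = (1 / 6) *\<^sub>R (cl x (cl y (cl z \<phi>)) - cl x (cl z (cl y \<phi>)) - cl y (cl x (cl z \<phi>))
     + cl z (cl x (cl y \<phi>)) + cl y (cl z (cl x \<phi>)) - cl z (cl y (cl x \<phi>)))"
proof -
  have A3: "A3 x y z \<phi> = cl x (A2 y z \<phi>) + g x y *\<^sub>R cl z \<phi> - g x z *\<^sub>R cl y \<phi>"
    using cl_A2[of x y z \<phi>] by simp
  show ?thesis
    unfolding A3 A2_eq cl_swap[of z x] cl_swap[of z y] cl_diff cl_minus cl_scaleR cl_swap[of y x] cl_swap[of z x] cl_swap[of z y]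
    by (simp add: cl_simps sym[of y x] sym[of z x] sym[of z y] vec_eq_iff field_simps)
qed

end

lemma wedge_flat_2:
  "wedge 1 1 (flat g y) (flat g z) = (\<lambda>X. g y (X 0) * g z (X 1) - g y (X 1) * g z (X 0))"
proof
  fix X
  have "wedge 1 1 (flat g y) (flat g z) X = 2 * alt 2 (\<lambda>X. g y (X 0) * g z (X 1)) X"
    unfolding wedge_def flat_def one_add_one by simp
  then show "wedge 1 1 (flat g y) (flat g z) X = g y (X 0) * g z (X 1) - g y (X 1) * g z (X 0)"
    using alt_2[of "\<lambda>u v. g y u * g z v" X] by simp
qed

lemma wedge_flat_3:
  "wedge 1 2 (flat g x) (wedge 1 1 (flat g y) (flat g z)) X =
    g x (X 0) * g y (X 1) * g z (X 2) - g x (X 0) * g z (X 1) * g y (X 2) - g y (X 0) * g x (X 1) * g z (X 2)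
    + g z (X 0) * g x (X 1) * g y (X 2) + g y (X 0) * g z (X 1) * g x (X 2) - g z (X 0) * g y (X 1) * g x (X 2)"
proof -
  have "wedge 1 2 (flat g x) (wedge 1 1 (flat g y) (flat g z)) X =
      3 * alt 3 (\<lambda>X. g x (X 0) * (g y (X 1) * g z (X 2) - g y (X 2) * g z (X 1))) X"
  proof -
    have 3: "(1::nat) + 2 = 3" by simp
    show ?thesis unfolding wedge_flat_2 wedge_def[of 1 2] flat_def 3 by (simp add: fact_numeral numeral_2_eq_2)
  qed
  then show ?thesis
    using alt_3[of "\<lambda>u v w. g x u * (g y v * g z w - g y w * g z v)" X] by (simp add: field_simps)
qed

section \<open>Pointwise models from a Clifford representation, and the spin group\<close>

lemma spin_space_clifford_rep:
  assumes \<gamma>: "clifford_rep \<gamma>" and e: "orthonormal_frame g e"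
  shows "spin_space g e (\<lambda>v \<phi>. \<gamma> (\<chi> k. g (e k) v) *v \<phi>)"
proof -
  interpret orthonormal_frame g e by (rule e)
  let ?c = "\<lambda>v. \<chi> k. g (e k) v"
  have lin: "linear \<gamma>" and cliff: "\<gamma> v ** \<gamma> w + \<gamma> w ** \<gamma> v = (- 2 * (v \<bullet> w)) *\<^sub>R mat 1"
    and tr: "transpose (\<gamma> v) = - \<gamma> v" for v w
    using \<gamma> by (auto simp: clifford_rep_def)
  \<comment> \<open>Coordinates in an orthonormal frame are an isometry, which transfers the
    Clifford relation from the dot product to \<open>g\<close>.\<close>
  have c: "?c v \<bullet> ?c w = g v w" for v w
  proof -
    have "g v w = g v (\<Sum>k\<in>UNIV. g (e k) w *\<^sub>R e k)" by (simp flip: expand)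
    also have "\<dots> = (\<Sum>k\<in>UNIV. g (e k) v * g (e k) w)"
      by (simp add: g_sum g_scaleR sym[of v] mult.commute)
    finally show ?thesis by (simp add: inner_vec_def)
  qed
  have lin_c: "linear ?c" by (intro linearI) (simp_all add: vec_eq_iff g_add g_scaleR)
  show ?thesis
  proof
    show "bilinear (\<lambda>v \<phi>. \<gamma> (?c v) *v \<phi>)"
      unfolding bilinear_def
      by (auto intro!: linearI simp: linear_add[OF lin_c] linear_cmul[OF lin_c] linear_add[OF lin] linear_cmul[OF lin]
          matrix_vector_mult_add_rdistrib matrix_vector_right_distrib matrix_vector_mult_scaleR scaleR_matrix_vector_assoc)
    show "\<gamma> (?c v) *v (\<gamma> (?c w) *v \<phi>) + \<gamma> (?c w) *v (\<gamma> (?c v) *v \<phi>) = (- 2 * g v w) *\<^sub>R \<phi>" for v w \<phi>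
    proof -
      have "\<gamma> (?c v) *v (\<gamma> (?c w) *v \<phi>) + \<gamma> (?c w) *v (\<gamma> (?c v) *v \<phi>) =
          (\<gamma> (?c v) ** \<gamma> (?c w) + \<gamma> (?c w) ** \<gamma> (?c v)) *v \<phi>"
        by (simp only: matrix_vector_mult_add_rdistrib matrix_vector_mul_assoc)
      then show ?thesis by (simp only: cliff c scaleR_matrix_vector_assoc[symmetric] matrix_vector_mul_lid)
    qed
    show "(\<gamma> (?c v) *v \<phi>) \<bullet> \<psi> = - (\<phi> \<bullet> (\<gamma> (?c v) *v \<psi>))" for v \<phi> \<psi>
    proof -
      have "\<phi> \<bullet> (\<gamma> (?c v) *v \<psi>) = (transpose (\<gamma> (?c v)) *v \<phi>) \<bullet> \<psi>"
        by (simp add: dot_lmul_matrix)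
      also have "transpose (\<gamma> (?c v)) *v \<phi> = - (\<gamma> (?c v) *v \<phi>)"
        unfolding tr using matrix_vector_mult_add_rdistrib[of "- \<gamma> (?c v)" "\<gamma> (?c v)" \<phi>]
        by (simp add: eq_neg_iff_add_eq_0)
      finally show ?thesis by simp
    qed
  qed
qed

lemma standard_frame: "orthonormal_frame (\<bullet>) (\<lambda>k :: 8. axis k 1)"
  by standard (auto simp: bilinear_conv_bounded_bilinear bounded_bilinear_inner inner_commute inner_axis_axis)

lemma spin_space_standard:
  assumes "clifford_rep \<gamma>"
  shows "spin_space (\<bullet>) (\<lambda>k :: 8. axis k 1) (\<lambda>v \<phi>. \<gamma> v *v \<phi>)"
proof -
  have "(\<chi> k. axis k 1 \<bullet> v) = v" for v :: "real^8"
    by (simp add: vec_eq_iff inner_axis')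
  then show ?thesis using spin_space_clifford_rep[OF assms standard_frame] by simp
qed

lemma foldr_matrix_vector:
  "foldr (\<lambda>k A. \<gamma> (f k) ** A) ks (mat 1) *v (\<phi> :: real^16) = foldr (\<lambda>v \<phi>. \<gamma> v *v \<phi>) (map f ks) \<phi>"
  by (induction ks) (simp_all flip: matrix_vector_mul_assoc)

lemma vol_op_standard:
  assumes "clifford_rep \<gamma>"
  shows "spin_space.vol_op (\<lambda>k. axis k 1) (\<lambda>v \<phi>. \<gamma> v *v \<phi>) \<phi> = volume_element \<gamma> *v \<phi>"
  unfolding spin_space.vol_op_def[OF spin_space_standard[OF assms]] volume_element_def
  by (simp add: foldr_matrix_vector[of \<gamma> "\<lambda>k. axis (of_nat k) 1"])

text \<open>A unit vector acts by a skew map with square -1, hence by an isometry.\<close>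

lemma spin_group_inner:
  assumes \<gamma>: "clifford_rep \<gamma>" and "h \<in> spin_group \<gamma>"
  shows "(h *v \<phi>) \<bullet> (h *v \<psi>) = \<phi> \<bullet> \<psi>"
  using assms(2)
proof (induction arbitrary: \<phi> \<psi>)
  case (mult h u v)
  interpret spin_space "(\<bullet>)" "\<lambda>k :: 8. axis k 1" "\<lambda>v \<phi>. \<gamma> v *v \<phi>" by (rule spin_space_standard[OF \<gamma>])
  have "(\<gamma> w *v \<phi>) \<bullet> (\<gamma> w *v \<psi>) = \<phi> \<bullet> \<psi>" if "norm w = 1" for w \<phi> \<psi>
    using skew[of w \<phi> "\<gamma> w *v \<psi>"] cl_square[of w \<psi>] that by (simp add: norm_eq_1)
  then show ?case using mult by (simp flip: matrix_vector_mul_assoc)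
qed simp

text \<open>A vector anticommutes with the volume element, and vectors enter the group in
  pairs.\<close>

lemma spin_group_volume:
  assumes \<gamma>: "clifford_rep \<gamma>" and "h \<in> spin_group \<gamma>"
  shows "volume_element \<gamma> *v (h *v \<phi>) = h *v (volume_element \<gamma> *v \<phi>)"
  using assms(2)
proof (induction arbitrary: \<phi>)
  case (mult h u v)
  interpret spin_space "(\<bullet>)" "\<lambda>k :: 8. axis k 1" "\<lambda>v \<phi>. \<gamma> v *v \<phi>" by (rule spin_space_standard[OF \<gamma>])
  have "volume_element \<gamma> *v (\<gamma> w *v \<psi>) = - (\<gamma> w *v (volume_element \<gamma> *v \<psi>))" for w \<psi>
    using vol_op_cl[of w \<psi>] by (simp add: vol_op_standard[OF \<gamma>])
  then show ?case using mult cl_minus by (simp flip: matrix_vector_mul_assoc)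
qed simp

section \<open>The spinor bundle and its form in different trivialisations\<close>

locale spin_geometry =
  fixes M :: "('m::{t2_space, second_countable_topology}, 'i) spin_mfd"
  assumes spin: "spin_manifold M"
begin

sublocale atlas_manifold M
  using spin by unfold_locales (auto simp: spin_manifold_def riemannian_manifold_def)

abbreviation \<gamma> :: "real^8 \<Rightarrow> real^16^16" where "\<gamma> \<equiv> cliff_rep M"

abbreviation mul :: "real^8 \<Rightarrow> real^16 \<Rightarrow> real^16" where "mul \<equiv> \<lambda>v \<phi>. \<gamma> v *v \<phi>"

abbreviation cl :: "'i \<Rightarrow> 'm \<Rightarrow> real^8 \<Rightarrow> real^16 \<Rightarrow> real^16" where
  "cl a q \<equiv> \<lambda>v \<phi>. \<gamma> (frame_coords M a q v) *v \<phi>"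

lemma clifford_rep: "clifford_rep \<gamma>"
  using spin by (simp add: spin_manifold_def)

sublocale std: spin_space "(\<bullet>)" "\<lambda>k :: 8. axis k 1" mul
  by (rule spin_space_standard[OF clifford_rep])

lemma frame_orthonormal:
  assumes "q \<in> triv_dom M a"
  shows "orthonormal_frame (metric M q) (frame M a q)"
proof
  show "bilinear (metric M q)" "metric M q v w = metric M q w v" for v w
    using spin by (auto simp: spin_manifold_def riemannian_manifold_def)
  show "metric M q (frame M a q i) (frame M a q j) = (if i = j then 1 else 0)" for i j
    using spin assms by (auto simp: spin_manifold_def oriented_orthonormal_basis_def)
qed

lemma spin_space_at: "q \<in> triv_dom M a \<Longrightarrow> spin_space (metric M q) (frame M a q) (cl a q)"
  unfolding frame_coords_def by (rule spin_space_clifford_rep[OF clifford_rep frame_orthonormal])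

lemma triv_at: "q \<in> triv_dom M (triv_at M q)"
proof -
  have "\<exists>a. q \<in> triv_dom M a" using spin unfolding spin_manifold_def by blast
  then show ?thesis unfolding triv_at_def by (rule someI_ex)
qed

lemma open_triv_dom: "open (triv_dom M a)"
  using spin by (simp add: spin_manifold_def)

lemma frame_coords_frame: "q \<in> triv_dom M a \<Longrightarrow> frame_coords M a q (frame M a q k) = axis k 1"
  using orthonormal_frame.orth[OF frame_orthonormal]
  by (simp add: frame_coords_def vec_eq_iff axis_def)

text \<open>The frame has the standard axes as its frame coordinates, so the volume operator is one
  and the same matrix in every trivialisation and at every point.\<close>

lemma vol_op_at:
  assumes q: "q \<in> triv_dom M a"
  shows "spin_space.vol_op (frame M a q) (cl a q) \<phi> = volume_element \<gamma> *v \<phi>"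
proof -
  interpret S: spin_space "metric M q" "frame M a q" "cl a q" by (rule spin_space_at[OF q])
  have "foldr (cl a q) (map (\<lambda>k. frame M a q (of_nat k)) ks) \<phi> = foldr mul (map (\<lambda>k. axis (of_nat k) 1) ks) \<phi>" for ks
    by (induction ks) (simp_all add: frame_coords_frame[OF q])
  then show ?thesis
    unfolding S.vol_op_def volume_element_def by (simp add: foldr_matrix_vector[of \<gamma> "\<lambda>k. axis (of_nat k) 1"])
qed

lemma trans_props:
  assumes "q \<in> triv_dom M a" "q \<in> triv_dom M b"
  shows trans_spin: "trans M a b q \<in> spin_group \<gamma>"
    and trans_cl: "trans M a b q *v cl b q v \<phi> = cl a q v (trans M a b q *v \<phi>)"
proof -
  show "trans M a b q \<in> spin_group \<gamma>"
    using spin assms by (simp add: spin_manifold_def)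
  have "trans M a b q ** \<gamma> (frame_coords M b q v) = \<gamma> (frame_coords M a q v) ** trans M a b q"
    using spin assms by (simp add: spin_manifold_def)
  then show "trans M a b q *v cl b q v \<phi> = cl a q v (trans M a b q *v \<phi>)"
    by (simp add: matrix_vector_mul_assoc)
qed

lemma trans_inner:
  "q \<in> triv_dom M a \<Longrightarrow> q \<in> triv_dom M b \<Longrightarrow> (trans M a b q *v \<phi>) \<bullet> (trans M a b q *v \<psi>) = \<phi> \<bullet> \<psi>"
  by (intro spin_group_inner[OF clifford_rep] trans_spin)

text \<open>The cocycle condition only makes the transition matrix idempotent; being an isometry it
  is also injective, hence the identity.\<close>

lemma trans_self:
  assumes q: "q \<in> triv_dom M a"
  shows "trans M a a q *v \<phi> = \<phi>"
proof -
  let ?T = "trans M a a q"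
  have "?T ** ?T = ?T" using spin q by (simp add: spin_manifold_def)
  then have "?T *v (?T *v \<phi>) = ?T *v \<phi>" by (simp add: matrix_vector_mul_assoc)
  then have "?T *v (?T *v \<phi> - \<phi>) = 0" by (simp add: matrix_vector_mult_diff_distrib)
  then have "(?T *v \<phi> - \<phi>) \<bullet> (?T *v \<phi> - \<phi>) = 0"
    using trans_inner[OF q q, of "?T *v \<phi> - \<phi>" "?T *v \<phi> - \<phi>"] by simp
  then show ?thesis by simp
qed

lemma cliff_eq: "cliff M q = cl (triv_at M q) q"
  by (simp add: cliff_def fun_eq_iff)

lemma form_act_2:
  "form_act M q 2 \<beta> \<phi> = (1 / 2) *\<^sub>R (\<Sum>j\<in>UNIV. \<Sum>k\<in>UNIV.
     \<beta> (case_nat (frame_at M q j) (case_nat (frame_at M q k) (\<lambda>_. 0))) *\<^sub>R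
       cliff M q (frame_at M q j) (cliff M q (frame_at M q k) \<phi>))"
proof -
  interpret S: spin_space "metric M q" "frame M (triv_at M q) q" "cliff M q"
    unfolding cliff_eq by (rule spin_space_at[OF triv_at])
  show ?thesis by (simp add: numeral_2_eq_2 contract_def S.cl_sum S.cl_scaleR)
qed

lemma form_act_3:
  "form_act M q 3 \<beta> \<phi> = (1 / 6) *\<^sub>R (\<Sum>j\<in>UNIV. \<Sum>k\<in>UNIV. \<Sum>l\<in>UNIV.
     \<beta> (case_nat (frame_at M q j) (case_nat (frame_at M q k) (case_nat (frame_at M q l) (\<lambda>_. 0)))) *\<^sub>R
       cliff M q (frame_at M q j) (cliff M q (frame_at M q k) (cliff M q (frame_at M q l) \<phi>)))"
proof -
  interpret S: spin_space "metric M q" "frame M (triv_at M q) q" "cliff M q"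
    unfolding cliff_eq by (rule spin_space_at[OF triv_at])
  show ?thesis by (simp add: numeral_3_eq_3 contract_def S.cl_sum S.cl_scaleR scaleR_sum_right)
qed

end

locale spin7_geometry = spin_geometry M
  for M :: "('m::{t2_space, second_countable_topology}, 'i) spin_mfd" +
  fixes \<eta> :: "'m spinor_field"
  assumes smooth: "smooth_spinor_field M \<eta>"
    and positive: "\<eta> p \<in> positive_spinors M"
    and unit: "norm (\<eta> p) = 1"
begin

lemma local_rep_self: "local_rep M \<eta> (triv_at M p) p = \<eta> p"
  by (simp add: local_rep_def trans_self triv_at)

lemma positive_spinor_at:
  assumes q: "q \<in> triv_dom M a"
  shows "positive_spinor (metric M q) (frame M a q) (cl a q) (local_rep M \<eta> a q)"
proof -
  interpret S: spin_space "metric M q" "frame M a q" "cl a q" by (rule spin_space_at[OF q])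
  show ?thesis
  proof
    have "volume_element \<gamma> *v \<eta> q = \<eta> q" using positive[of q] by (simp add: positive_spinors_def)
    then show "S.vol_op (local_rep M \<eta> a q) = local_rep M \<eta> a q"
      using spin_group_volume[OF clifford_rep trans_spin[OF q triv_at]]
      by (simp add: vol_op_at[OF q] local_rep_def)
    have "local_rep M \<eta> a q \<bullet> local_rep M \<eta> a q = 1"
      using unit[of q] by (simp add: local_rep_def trans_inner[OF q triv_at] norm_eq_1)
    then show "norm (local_rep M \<eta> a q) = 1" by (simp add: norm_eq_1)
  qed
qed

text \<open>\<open>spin7_form\<close> is written in the trivialisation preferred at q, but
  transition matrices are isometries that intertwine Clifford multiplication, so any trivialisation
  gives the same value. Only therefore can the form be differentiated in a fixed one.\<close>

lemma spin7_form_at: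
  assumes q: "q \<in> triv_dom M a"
  shows "spin7_form M \<eta> q X = spin_space.A3 (cl a q) (X 1) (X 2) (X 3) (local_rep M \<eta> a q) \<bullet> cl a q (X 0) (local_rep M \<eta> a q)"
proof -
  let ?b = "triv_at M q"
  interpret B: positive_spinor "metric M q" "frame M ?b q" "cl ?b q" "\<eta> q"
    using positive_spinor_at[OF triv_at, of q] by (simp add: local_rep_self)
  interpret S: spin_space "metric M q" "frame M a q" "cl a q" by (rule spin_space_at[OF q])
  have act: "form_act M q 3 (wedge 1 2 (flat (metric M q) x) (wedge 1 1 (flat (metric M q) y) (flat (metric M q) z))) (\<eta> q)
      = B.A3 x y z (\<eta> q)" for x y z
    unfolding form_act_3 wedge_flat_3 cliff_eq frame_at_def
    by (simp only: nat.case numeral_2_eq_2 One_nat_def scaleR_left_distrib scaleR_left_diff_distrib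
        sum.distrib sum_subtractf B.sum_cl_3 B.A3_antisymmetrized)
  \<comment> \<open>\<open>A3\<close> applied to \<eta> is a negative spinor, so
    \<open>completeness\<close> supplies the vector, and injectivity of multiplication on \<eta>
    makes the \<open>THE\<close> well defined.\<close>
  have triple: "cl ?b q (triple_product M \<eta> q x y z) (\<eta> q) = B.A3 x y z (\<eta> q)" for x y z
  proof -
    have "B.vol_op (B.A3 x y z (\<eta> q)) = - B.A3 x y z (\<eta> q)"
      by (simp add: B.A3_def B.A2_def B.vol_op_cl B.positive linear_add[OF B.linear_vol_op] linear_diff[OF B.linear_vol_op]
          linear_cmul[OF B.linear_vol_op] B.cl_simps algebra_simps)
    from B.completeness[OF this] obtain T where T: "cl ?b q T (\<eta> q) = B.A3 x y z (\<eta> q)"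
      unfolding B.cl_scaleR(2)[symmetric] B.cl_sum(2)[symmetric] by blast
    have "triple_product M \<eta> q x y z = T"
      unfolding triple_product_def act unfolding cliff_eq T[symmetric]
      by (rule the_equality) (auto dest: B.cl_eta_inj)
    then show ?thesis using T by simp
  qed
  let ?T = "trans M a ?b q"
  have A3: "S.A3 x y z (?T *v \<phi>) = ?T *v B.A3 x y z \<phi>" for x y z \<phi>
    by (simp add: S.A3_def S.A2_def B.A3_def B.A2_def trans_cl[OF q triv_at] matrix_vector_right_distrib
        matrix_vector_mult_diff_distrib matrix_vector_mult_scaleR)
  have "spin7_form M \<eta> q X = B.A3 (X 1) (X 2) (X 3) (\<eta> q) \<bullet> cl ?b q (X 0) (\<eta> q)"
    unfolding spin7_form_def cliff_eq triple ..
  also have "\<dots> = (?T *v B.A3 (X 1) (X 2) (X 3) (\<eta> q)) \<bullet> (?T *v cl ?b q (X 0) (\<eta> q))"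
    by (simp only: trans_inner[OF q triv_at])
  finally show ?thesis by (simp only: A3[symmetric] trans_cl[OF q triv_at] local_rep_def)
qed

end

subsection \<open>The exterior derivative of \<Omega>\<close>

locale spin7_connection = spin7_geometry M \<eta>
  for M :: "('m::{t2_space, second_countable_topology}, 'i) spin_mfd" and \<eta> :: "'m spinor_field" +
  fixes nab :: "'m connection"
  assumes levi_civita: "levi_civita M nab"
begin

lemma connection_props:
  assumes "open U" "smooth_vector_field_on M U X" "smooth_vector_field_on M U Y" "p \<in> U"
  shows connection_linear: "linear (\<lambda>v. nab p v X)"
    and connection_metric: "differential M (\<lambda>q. metric M q (X q) (Y q)) p v =
      metric M p (nab p v X) (Y p) + metric M p (X p) (nab p v Y)"
    and connection_torsion: "nab p (X p) Y - nab p (Y p) X = lie_bracket M X Y p"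
  \<comment> \<open>\<open>levi_civita\<close> also quantifies over a function for the Leibniz
    clause; the zero function serves.\<close>
  using levi_civita[unfolded levi_civita_def, rule_format, of U X Y "\<lambda>_. 0"] assms
  by (simp_all add: smooth_map_on_const)

lemma smooth_frame: "smooth_vector_field_on M (triv_dom M a) (\<lambda>q. frame M a q k)"
  using spin by (simp add: spin_manifold_def)

lemma smooth_metric:
  assumes "open U" "smooth_vector_field_on M U X" "smooth_vector_field_on M U Y"
  shows "smooth_map_on M U (\<lambda>q. metric M q (X q) (Y q))"
proof -
  have "riemannian_manifold M" using spin by (simp add: spin_manifold_def)
  then have "\<forall>U X Y. open U \<and> smooth_vector_field_on M U X \<and> smooth_vector_field_on M U Y \<longrightarrow>
      smooth_map_on M U (\<lambda>q. metric M q (X q) (Y q))"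
    unfolding riemannian_manifold_def by (elim conjE)
  from this[rule_format, of U X Y] show ?thesis using assms by simp
qed

lemma open_chart_dom: "open (fst (chart_at M p))"
  by (intro chart_homeomorphism chart_at)

lemma connection_symmetric: "nab p v (coord_field M p w) = nab p w (coord_field M p v)"
  using connection_torsion[OF open_chart_dom smooth_coord_field smooth_coord_field chart_at(2)]
  by (simp add: coord_field_self lie_bracket_coord_field)

definition conn :: "'m \<Rightarrow> real^8 \<Rightarrow> 8 \<Rightarrow> 8 \<Rightarrow> real" where
  "conn p v j k = metric M p (nab p v (\<lambda>q. frame M (triv_at M p) q j)) (frame_at M p k)"

lemma metric_sym: "metric M p v w = metric M p w v"
  using spin by (auto simp: spin_manifold_def riemannian_manifold_def)

lemma conn_skew: "conn p v j k = - conn p v k j"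
proof -
  let ?a = "triv_at M p"
  have "differential M (\<lambda>q. metric M q (frame M ?a q j) (frame M ?a q k)) p =
      differential M (\<lambda>q. if j = k then 1 else 0) p"
    by (rule differential_cong[OF open_triv_dom triv_at])
       (simp add: orthonormal_frame.orth[OF frame_orthonormal])
  then have "metric M p (nab p v (\<lambda>q. frame M ?a q j)) (frame M ?a p k)
      + metric M p (frame M ?a p j) (nab p v (\<lambda>q. frame M ?a q k)) = 0"
    using connection_metric[OF open_triv_dom smooth_frame smooth_frame triv_at, of p j k v]
    by (simp only: differential_const)
  then show ?thesis by (simp add: conn_def frame_at_def metric_sym[of p "frame M ?a p j"])
qed

lemma spin_nabla_eq:
  "spin_nabla M nab p v \<eta> = differential M (local_rep M \<eta> (triv_at M p)) p v + std.rot_op (conn p v) (\<eta> p)"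
  unfolding spin_nabla_def std.rot_op_def
  by (simp add: cliff_def frame_at_def frame_coords_frame triv_at conn_def)

lemma covariant_deriv_local_rep:
  "covariant_deriv (std.rot_op (conn p v)) (snd (chart_at M p) p) v
     (local_rep M \<eta> (triv_at M p) \<circ> chart_inv (chart_at M p)) (spin_nabla M nab p v \<eta>)"
proof -
  have "smooth_map_on M (triv_dom M (triv_at M p)) (local_rep M \<eta> (triv_at M p))"
    using smooth by (simp add: smooth_spinor_field_def)
  from smooth_map_has_derivative[OF this triv_at] show ?thesis
    unfolding covariant_deriv_def
    by (intro exI conjI) (simp_all add: spin_nabla_eq chart_inverse chart_at local_rep_self)
qed

text \<open>Component k is the metric product of frame vector k with the coordinate field. Metric
  compatibility differentiates it, and the term with the derivative of the frame is, by
  \<open>conn_skew\<close>, minus the rotation \<open>std.rot (conn p v)\<close>. This is the vector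
  counterpart of \<open>covariant_deriv_local_rep\<close>.\<close>

lemma covariant_deriv_frame_coords:
  "covariant_deriv (std.rot (conn p v)) (snd (chart_at M p) p) v
     ((\<lambda>q. frame_coords M (triv_at M p) q (coord_field M p w q)) \<circ> chart_inv (chart_at M p))
     (frame_coords M (triv_at M p) p (nab p v (coord_field M p w)))"
proof -
  let ?a = "triv_at M p" and ?c = "chart_at M p"
  interpret F: orthonormal_frame "metric M p" "frame M ?a p" by (rule frame_orthonormal[OF triv_at])
  let ?U = "triv_dom M ?a \<inter> fst ?c"
  let ?h = "\<lambda>k q. metric M q (frame M ?a q k) (coord_field M p w q)"
  have U: "open ?U" "p \<in> ?U" using open_triv_dom open_chart_dom triv_at chart_at by auto
  have s1: "smooth_vector_field_on M ?U (\<lambda>q. frame M ?a q k)" for k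
    by (rule smooth_vector_field_on_subset[OF _ smooth_frame]) simp
  have s2: "smooth_vector_field_on M ?U (coord_field M p w)"
    by (rule smooth_vector_field_on_subset[OF _ smooth_coord_field]) simp
  have "smooth_map_on M ?U (?h k)" for k
    by (rule smooth_metric[OF U(1) s1 s2])
  note hd = smooth_map_has_derivative[OF this U(2)]
  have D: "((\<lambda>x. \<Sum>k\<in>UNIV. (?h k \<circ> chart_inv ?c) x *\<^sub>R axis k 1) has_derivative
      (\<lambda>u. \<Sum>k\<in>UNIV. differential M (?h k) p u *\<^sub>R (axis k 1 :: real^8))) (at (snd ?c p))"
    by (intro has_derivative_sum has_derivative_scaleR_left hd)
  have vec: "(\<Sum>k\<in>UNIV. f k *\<^sub>R axis k 1) = (\<chi> k. f k)" for f :: "8 \<Rightarrow> real"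
    by (simp add: vec_eq_iff axis_def if_distrib cong: if_cong)
  have rot: "std.rot \<omega> u $ i = (\<Sum>j\<in>UNIV. \<omega> j i * u $ j)" for \<omega> u i
  proof -
    have "std.rot \<omega> u = (\<Sum>j\<in>UNIV. \<Sum>k\<in>UNIV. (\<omega> j k * u $ j) *\<^sub>R axis k 1)"
      by (simp add: std.rot_def inner_axis')
    then show ?thesis by (simp add: vec)
  qed
  have "differential M (?h k) p v = metric M p (frame M ?a p k) (nab p v (coord_field M p w))
      - (\<Sum>j\<in>UNIV. conn p v j k * metric M p (frame M ?a p j) w)" for k
  proof -
    have "metric M p (nab p v (\<lambda>q. frame M ?a q k)) w =
        (\<Sum>j\<in>UNIV. metric M p (frame M ?a p j) w * metric M p (nab p v (\<lambda>q. frame M ?a q k)) (frame M ?a p j))"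
      by (subst F.expand[of w]) (simp add: F.g_sum F.g_scaleR)
    also have "\<dots> = - (\<Sum>j\<in>UNIV. conn p v j k * metric M p (frame M ?a p j) w)"
      unfolding conn_skew[of p v _ k] by (simp add: conn_def frame_at_def sum_negf mult.commute)
    finally show ?thesis
      using connection_metric[OF U(1) s1 s2 U(2), of k v] by (simp add: coord_field_self)
  qed
  then have "(\<Sum>k\<in>UNIV. differential M (?h k) p v *\<^sub>R (axis k 1 :: real^8)) =
      frame_coords M ?a p (nab p v (coord_field M p w)) - std.rot (conn p v) (frame_coords M ?a p w)"
    unfolding vec by (simp add: frame_coords_def vec_eq_iff rot)
  moreover have "(\<lambda>q. frame_coords M ?a q (coord_field M p w q)) \<circ> chart_inv ?c =
      (\<lambda>x. \<Sum>k\<in>UNIV. (?h k \<circ> chart_inv ?c) x *\<^sub>R axis k 1)"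
    unfolding vec by (simp add: frame_coords_def comp_def)
  ultimately show ?thesis
    unfolding covariant_deriv_def using D
    by (intro exI[of _ "\<lambda>u. \<Sum>k\<in>UNIV. differential M (?h k) p u *\<^sub>R (axis k 1 :: real^8)"])
       (simp add: chart_inverse chart_at coord_field_self vec frame_coords_def[of M ?a p w])
qed

lemma positive_spinor_here: "positive_spinor (metric M p) (frame_at M p) (cliff M p) (\<eta> p)"
  using positive_spinor_at[OF triv_at, of p] by (simp add: local_rep_self cliff_eq frame_at_def)

abbreviation Om_at :: "'m \<Rightarrow> real^8 \<Rightarrow> real^8 \<Rightarrow> real^8 \<Rightarrow> real^8 \<Rightarrow> real" where
  "Om_at p \<equiv> positive_spinor.Om (cliff M p) (\<eta> p)"

text \<open>In frame coordinates the Clifford multiplication no longer depends on q, so the Leibniz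
  rules of the constant model \<open>std\<close> apply.\<close>

lemma A3_std:
  assumes q: "q \<in> triv_dom M a"
  shows "spin_space.A3 (cl a q) x y z \<phi> =
    std.A3 (frame_coords M a q x) (frame_coords M a q y) (frame_coords M a q z) \<phi>"
proof -
  interpret S: spin_space "metric M q" "frame M a q" "cl a q" by (rule spin_space_at[OF q])
  show ?thesis by (simp add: S.A3_def S.A2_def std.A3_def std.A2_def)
qed

lemma A4_std:
  assumes q: "q \<in> triv_dom M a"
  shows "spin_space.A4 (cl a q) w x y z \<phi> =
    std.A4 (frame_coords M a q w) (frame_coords M a q x) (frame_coords M a q y) (frame_coords M a q z) \<phi>"
proof -
  interpret S: spin_space "metric M q" "frame M a q" "cl a q" by (rule spin_space_at[OF q])
  show ?thesis by (simp add: S.A4_def std.A4_def A3_std[OF q])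
qed

lemma Om_at_std:
  "Om_at p w x y z = std.A3 (frame_coords M (triv_at M p) p x) (frame_coords M (triv_at M p) p y)
     (frame_coords M (triv_at M p) p z) (\<eta> p) \<bullet> mul (frame_coords M (triv_at M p) p w) (\<eta> p)"
  unfolding positive_spinor.Om_def[OF positive_spinor_here] unfolding cliff_eq A3_std[OF triv_at] ..

lemma spin7_form_eq: "spin7_form M \<eta> p = (\<lambda>X. Om_at p (X 0) (X 1) (X 2) (X 3))"
  by (simp add: fun_eq_iff Om_at_std spin7_form_at[OF triv_at] A3_std[OF triv_at] local_rep_self)

lemma differential_spin7_form:
  fixes W :: "nat \<Rightarrow> real^8" and p :: 'm and v :: "real^8"
  defines "\<Gamma> \<equiv> \<lambda>i. nab p v (coord_field M p (W i))"
  shows "differential M (\<lambda>q. spin7_form M \<eta> q (\<lambda>j. coord_field M p (W j) q)) p v =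
    Om_at p (\<Gamma> 0) (W 1) (W 2) (W 3) + Om_at p (W 0) (\<Gamma> 1) (W 2) (W 3)
    + Om_at p (W 0) (W 1) (\<Gamma> 2) (W 3) + Om_at p (W 0) (W 1) (W 2) (\<Gamma> 3)
    - 2 * (spin_space.A4 (cliff M p) (W 0) (W 1) (W 2) (W 3) (\<eta> p) \<bullet> spin_nabla M nab p v \<eta>)"
proof -
  let ?a = "triv_at M p" and ?c = "chart_at M p"
  let ?x = "snd ?c p"
  let ?y = "\<lambda>i. (\<lambda>q. frame_coords M ?a q (coord_field M p (W i) q)) \<circ> chart_inv ?c"
  let ?f = "local_rep M \<eta> ?a \<circ> chart_inv ?c"
  let ?F = "\<lambda>u. std.A3 (?y 1 u) (?y 2 u) (?y 3 u) (?f u) \<bullet> mul (?y 0 u) (?f u)"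
  note cov = covariant_deriv_frame_coords[of p v]
  obtain D where D: "(?F has_derivative D) (at ?x)"
    and Dv: "D v = std.A3 (?y 1 ?x) (?y 2 ?x) (?y 3 ?x) (?f ?x) \<bullet> mul (frame_coords M ?a p (\<Gamma> 0)) (?f ?x)
      + std.A3 (frame_coords M ?a p (\<Gamma> 1)) (?y 2 ?x) (?y 3 ?x) (?f ?x) \<bullet> mul (?y 0 ?x) (?f ?x)
      + std.A3 (?y 1 ?x) (frame_coords M ?a p (\<Gamma> 2)) (?y 3 ?x) (?f ?x) \<bullet> mul (?y 0 ?x) (?f ?x)
      + std.A3 (?y 1 ?x) (?y 2 ?x) (frame_coords M ?a p (\<Gamma> 3)) (?f ?x) \<bullet> mul (?y 0 ?x) (?f ?x)
      - 2 * (std.A4 (?y 0 ?x) (?y 1 ?x) (?y 2 ?x) (?y 3 ?x) (?f ?x) \<bullet> spin_nabla M nab p v \<eta>)"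
    using std.derivative_A3_cl[OF conn_skew cov[of "W 0"] cov[of "W 1"] cov[of "W 2"] cov[of "W 3"]
        covariant_deriv_local_rep]
    unfolding \<Gamma>_def by blast
  have y: "?y i ?x = frame_coords M ?a p (W i)" for i
    by (simp add: chart_inverse chart_at coord_field_self)
  have f: "?f ?x = \<eta> p" by (simp add: chart_inverse chart_at local_rep_self)
  \<comment> \<open>Near p the moving trivialisation is exchanged for the one at p, by
    \<open>spin7_form_at\<close>.\<close>
  have "differential M (\<lambda>q. spin7_form M \<eta> q (\<lambda>j. coord_field M p (W j) q)) p =
    differential M (\<lambda>q. std.A3 (frame_coords M ?a q (coord_field M p (W 1) q)) (frame_coords M ?a q (coord_field M p (W 2) q))
      (frame_coords M ?a q (coord_field M p (W 3) q)) (local_rep M \<eta> ?a q)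
      \<bullet> mul (frame_coords M ?a q (coord_field M p (W 0) q)) (local_rep M \<eta> ?a q)) p"
    by (rule differential_cong[OF open_triv_dom triv_at]) (simp only: spin7_form_at A3_std)
  then have "differential M (\<lambda>q. spin7_form M \<eta> q (\<lambda>j. coord_field M p (W j) q)) p v = D v"
    using frechet_derivative_at[OF D] by (simp add: differential_def comp_def)
  then show ?thesis
    unfolding Dv y f Om_at_std unfolding cliff_eq A4_std[OF triv_at] by simp
qed

lemma spin_nabla_linear: "linear (\<lambda>v. spin_nabla M nab p v \<eta>)"
proof -
  have l: "linear (\<lambda>v. nab p v (\<lambda>q. frame M (triv_at M p) q j))" for j
    by (rule connection_linear[OF open_triv_dom smooth_frame smooth_frame triv_at])
  have "smooth_map_on M (triv_dom M (triv_at M p)) (local_rep M \<eta> (triv_at M p))"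
    using smooth by (simp add: smooth_spinor_field_def)
  from smooth_map_has_derivative[OF this triv_at]
  have d: "linear (differential M (local_rep M \<eta> (triv_at M p)) p)" by (rule has_derivative_linear)
  interpret F: orthonormal_frame "metric M p" "frame M (triv_at M p) p" by (rule frame_orthonormal[OF triv_at])
  show ?thesis
    unfolding spin_nabla_eq std.rot_op_def
    by (intro linearI)
       (simp_all add: linear_add[OF d] linear_cmul[OF d] conn_def linear_add[OF l] linear_cmul[OF l]
         F.g_add F.g_scaleR scaleR_left_distrib sum.distrib scaleR_right_distrib scaleR_sum_right mult.left_commute)
qed

lemma spin_nabla_orthogonal: "\<eta> p \<bullet> spin_nabla M nab p v \<eta> = 0"
proof -
  let ?a = "triv_at M p" and ?c = "chart_at M p"
  let ?f = "local_rep M \<eta> ?a \<circ> chart_inv ?c"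
  have f: "?f (snd ?c p) = \<eta> p" by (simp add: chart_inverse chart_at local_rep_self)
  obtain D where D: "((\<lambda>y. ?f y \<bullet> ?f y) has_derivative D) (at (snd ?c p))"
    and Dv: "D v = spin_nabla M nab p v \<eta> \<bullet> \<eta> p + \<eta> p \<bullet> spin_nabla M nab p v \<eta>"
    using covariant_deriv_inner[OF std.rot_op_skew[OF conn_skew] covariant_deriv_local_rep covariant_deriv_local_rep, of p v]
    unfolding f by blast
  have "differential M (\<lambda>q. local_rep M \<eta> ?a q \<bullet> local_rep M \<eta> ?a q) p = differential M (\<lambda>q. 1) p"
    by (rule differential_cong[OF open_triv_dom triv_at])
       (use positive_spinor.unit_inner[OF positive_spinor_at] in blast)
  then have "differential M (\<lambda>q. local_rep M \<eta> ?a q \<bullet> local_rep M \<eta> ?a q) p v = 0"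
    by (simp add: differential_const)
  then have "D v = 0"
    using frechet_derivative_at[OF D] by (simp add: differential_def comp_def)
  then show ?thesis using Dv by (simp add: inner_commute)
qed

text \<open>The volume element is a constant matrix fixing the local representative of \<eta>, so it
  fixes its differential; and it commutes with the zeroth order term, which is even in Clifford
  multiplications.\<close>

lemma spin_nabla_positive: "volume_element \<gamma> *v spin_nabla M nab p v \<eta> = spin_nabla M nab p v \<eta>"
proof -
  let ?a = "triv_at M p" and ?c = "chart_at M p"
  let ?f = "local_rep M \<eta> ?a"
  have "smooth_map_on M (triv_dom M ?a) ?f"
    using smooth by (simp add: smooth_spinor_field_def)
  from smooth_map_has_derivative[OF this triv_at]
  have D: "((?f \<circ> chart_inv ?c) has_derivative differential M ?f p) (at (snd ?c p))" .
  have vol: "std.vol_op \<phi> = volume_element \<gamma> *v \<phi>" for \<phi> by (rule vol_op_standard[OF clifford_rep])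
  have bl: "bounded_linear (\<lambda>\<phi>. volume_element \<gamma> *v \<phi>)" by (rule matrix_vector_mul_bounded_linear)
  have D': "((\<lambda>x. volume_element \<gamma> *v ((?f \<circ> chart_inv ?c) x)) has_derivative
      (\<lambda>u. volume_element \<gamma> *v differential M ?f p u)) (at (snd ?c p))"
    by (rule bounded_linear.has_derivative[OF bl D])
  have "volume_element \<gamma> *v ?f q = ?f q" if "q \<in> triv_dom M ?a" for q
    using positive_spinor.positive[OF positive_spinor_at[OF that]] vol_op_at[OF that] by simp
  then have "differential M (\<lambda>q. volume_element \<gamma> *v ?f q) p = differential M ?f p"
    by (intro differential_cong[OF open_triv_dom triv_at])
  moreover have "differential M (\<lambda>q. volume_element \<gamma> *v ?f q) p v = volume_element \<gamma> *v differential M ?f p v"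
  proof -
    have "differential M (\<lambda>q. volume_element \<gamma> *v ?f q) p v =
        frechet_derivative (\<lambda>x. volume_element \<gamma> *v ((?f \<circ> chart_inv ?c) x)) (at (snd ?c p)) v"
      by (simp add: differential_def comp_def)
    also have "\<dots> = volume_element \<gamma> *v differential M ?f p v"
      by (rule fun_cong[OF frechet_derivative_at[OF D', symmetric]])
    finally show ?thesis .
  qed
  ultimately have 1: "volume_element \<gamma> *v differential M ?f p v = differential M ?f p v" by simp
  have "volume_element \<gamma> *v \<eta> p = \<eta> p" using positive[of p] by (simp add: positive_spinors_def)
  then have "volume_element \<gamma> *v std.rot_op (conn p v) (\<eta> p) = std.rot_op (conn p v) (\<eta> p)"
    using std.vol_rot_op[of "conn p v" "\<eta> p"] by (simp add: vol)
  with 1 show ?thesis by (simp add: spin_nabla_eq matrix_vector_right_distrib)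
qed

text \<open>The bridge between the layers: from here on the connection enters the computation at p
  only through these three properties of \<nabla>\<eta>.\<close>

lemma derivative_here:
  "positive_spinor_derivative (metric M p) (frame_at M p) (cliff M p) (\<eta> p) (\<lambda>v. spin_nabla M nab p v \<eta>)"
proof -
  interpret P: positive_spinor "metric M p" "frame_at M p" "cliff M p" "\<eta> p" by (rule positive_spinor_here)
  have "P.vol_op \<phi> = volume_element \<gamma> *v \<phi>" for \<phi>
    unfolding cliff_eq frame_at_def by (rule vol_op_at[OF triv_at])
  then show ?thesis
    by unfold_locales (simp_all add: linear_add[OF spin_nabla_linear] linear_cmul[OF spin_nabla_linear] spin_nabla_positive spin_nabla_orthogonal)
qed

end

section \<open>The star of the exterior derivative in terms of the covariant derivative of the
  spinor\<close>

context spin7_connection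
begin

text \<open>The terms containing the Levi-Civita connection of the coordinate fields cancel, as
  \<open>\<nabla>\<close> is torsion free and \<open>\<Omega>\<close> is alternating.\<close>

lemma ext_deriv_spin7_form:
  "ext_deriv M 4 (spin7_form M \<eta>) p = (\<lambda>X. \<Sum>i\<le>4. (-1) ^ i *
     positive_spinor_derivative.nabla_Om (cliff M p) (\<eta> p) (\<lambda>v. spin_nabla M nab p v \<eta>) (X i)
       (\<lambda>j. X (if j < i then j else Suc j)))"
proof
  fix X :: "nat \<Rightarrow> real^8"
  interpret P: positive_spinor_derivative "metric M p" "frame_at M p" "cliff M p" "\<eta> p" "\<lambda>v. spin_nabla M nab p v \<eta>"
    by (rule derivative_here)
  define \<Gamma> where "\<Gamma> i j = nab p (X i) (coord_field M p (X j))" for i j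
  have \<Gamma>: "\<Gamma> j i = \<Gamma> i j" for i j
    unfolding \<Gamma>_def by (rule connection_symmetric)
  let ?s = "\<lambda>i j :: nat. if j < i then j else Suc j"
  define G where "G i = P.Om (\<Gamma> i (?s i 0)) (X (?s i 1)) (X (?s i 2)) (X (?s i 3))
      + P.Om (X (?s i 0)) (\<Gamma> i (?s i 1)) (X (?s i 2)) (X (?s i 3))
      + P.Om (X (?s i 0)) (X (?s i 1)) (\<Gamma> i (?s i 2)) (X (?s i 3))
      + P.Om (X (?s i 0)) (X (?s i 1)) (X (?s i 2)) (\<Gamma> i (?s i 3))" for i
  have d: "differential M (\<lambda>q. spin7_form M \<eta> q (\<lambda>j. coord_field M p (X (?s i j)) q)) p (X i) =
      G i + P.nabla_Om (X i) (\<lambda>j. X (?s i j))" for i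
    unfolding differential_spin7_form[of p "\<lambda>j. X (?s i j)" "X i"] P.nabla_Om_def G_def \<Gamma>_def by simp
  have m1: "P.Om x (\<Gamma> i j) y z = - P.Om (\<Gamma> i j) x y z" for x y z i j
    by (rule P.Om_swap(1))
  have m2: "P.Om x y (\<Gamma> i j) z = P.Om (\<Gamma> i j) x y z" for x y z i j
    using P.Om_swap(2)[of x y "\<Gamma> i j" z] m1[of x i j y z] by simp
  have m3: "P.Om x y z (\<Gamma> i j) = - P.Om (\<Gamma> i j) x y z" for x y z i j
    using P.Om_swap(3)[of x y z "\<Gamma> i j"] m2[of x y i j z] by simp
  \<comment> \<open>With the connection term moved to the front, each pair of indices i < j occurs
    in \<open>G i\<close> and in \<open>G j\<close> with the same three remaining vectors, and with
    opposite signs in the alternating sum.\<close>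
  have G: "G 0 = P.Om (\<Gamma> 0 1) (X 2) (X 3) (X 4) - P.Om (\<Gamma> 0 2) (X 1) (X 3) (X 4) + P.Om (\<Gamma> 0 3) (X 1) (X 2) (X 4) - P.Om (\<Gamma> 0 4) (X 1) (X 2) (X 3)"
    "G 1 = P.Om (\<Gamma> 0 1) (X 2) (X 3) (X 4) - P.Om (\<Gamma> 1 2) (X 0) (X 3) (X 4) + P.Om (\<Gamma> 1 3) (X 0) (X 2) (X 4) - P.Om (\<Gamma> 1 4) (X 0) (X 2) (X 3)"
    "G 2 = P.Om (\<Gamma> 0 2) (X 1) (X 3) (X 4) - P.Om (\<Gamma> 1 2) (X 0) (X 3) (X 4) + P.Om (\<Gamma> 2 3) (X 0) (X 1) (X 4) - P.Om (\<Gamma> 2 4) (X 0) (X 1) (X 3)"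
    "G 3 = P.Om (\<Gamma> 0 3) (X 1) (X 2) (X 4) - P.Om (\<Gamma> 1 3) (X 0) (X 2) (X 4) + P.Om (\<Gamma> 2 3) (X 0) (X 1) (X 4) - P.Om (\<Gamma> 3 4) (X 0) (X 1) (X 2)"
    "G 4 = P.Om (\<Gamma> 0 4) (X 1) (X 2) (X 3) - P.Om (\<Gamma> 1 4) (X 0) (X 2) (X 3) + P.Om (\<Gamma> 2 4) (X 0) (X 1) (X 3) - P.Om (\<Gamma> 3 4) (X 0) (X 1) (X 2)"
    by (simp_all add: G_def m1 m2 m3 numeral_eq_Suc \<Gamma>)
  have "{..4::nat} = {0, 1, 2, 3, 4}" by auto
  then have 0: "(\<Sum>i\<le>4. (-1) ^ i * G i) = 0" by (simp add: G[unfolded One_nat_def])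
  have "ext_deriv M 4 (spin7_form M \<eta>) p X = (\<Sum>i\<le>4. (-1) ^ i * (G i + P.nabla_Om (X i) (\<lambda>j. X (?s i j))))"
    by (simp only: ext_deriv_def d)
  also have "\<dots> = (\<Sum>i\<le>4. (-1) ^ i * P.nabla_Om (X i) (\<lambda>j. X (?s i j)))"
    by (simp only: distrib_left sum.distrib 0 add_0)
  finally show "ext_deriv M 4 (spin7_form M \<eta>) p X = (\<Sum>i\<le>4. (-1) ^ i * P.nabla_Om (X i) (\<lambda>j. X (?s i j)))" .
qed

lemma star_d_form_eq:
  "star_d_form M \<eta> p = (\<lambda>X. positive_spinor_derivative.star_d (frame_at M p) (cliff M p) (\<eta> p)
     (\<lambda>v. spin_nabla M nab p v \<eta>) (X 0) (X 1) (X 2))"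
proof -
  interpret P: positive_spinor_derivative "metric M p" "frame_at M p" "cliff M p" "\<eta> p" "\<lambda>v. spin_nabla M nab p v \<eta>"
    by (rule derivative_here)
  show ?thesis
    unfolding star_d_form_def ext_deriv_spin7_form by (rule ext) (rule P.hodge_nabla_Om)
qed

lemma dirac_eq:
  "dirac M nab \<eta> p = positive_spinor_derivative.D (frame_at M p) (cliff M p) (\<lambda>v. spin_nabla M nab p v \<eta>)"
  by (simp add: dirac_def positive_spinor_derivative.D_def[OF derivative_here])

text \<open>\<open>c_inv\<close> is an \<open>inv_into\<close>, so three facts are needed: c is
  injective on \<open>Lambda2_7\<close>, the proposed form is mapped to the spinor, and it lies in
  \<open>Lambda2_7\<close>. The identity \<open>ip\<close> yields the first and, together with the
  second, the third.\<close>

lemma c_inv_spin_nabla: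
  "c_inv M \<eta> p (spin_nabla M nab p v \<eta>) =
    (\<lambda>X. 1 / 4 * (spin_space.A2 (cliff M p) (X 0) (X 1) (\<eta> p) \<bullet> spin_nabla M nab p v \<eta>))"
proof -
  interpret P: positive_spinor_derivative "metric M p" "frame_at M p" "cliff M p" "\<eta> p" "\<lambda>v. spin_nabla M nab p v \<eta>"
    by (rule derivative_here)
  let ?e = "frame_at M p"
  let ?\<phi> = "spin_nabla M nab p v \<eta>"
  let ?\<beta> = "\<lambda>X. 1 / 4 * (P.A2 (X 0) (X 1) (\<eta> p) \<bullet> ?\<phi>)"
  have c: "c_map M \<eta> p \<beta> = (1 / 2) *\<^sub>R (\<Sum>i\<in>UNIV. \<Sum>j\<in>UNIV.
      \<beta> (nth [?e i, ?e j]) *\<^sub>R cliff M p (?e i) (cliff M p (?e j) (\<eta> p)))" if "exterior_form 2 \<beta>" for \<beta>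
  proof -
    have "\<beta> (case_nat (?e i) (case_nat (?e j) (\<lambda>_. 0))) = \<beta> (nth [?e i, ?e j])" for i j
      using that unfolding exterior_form_def
      by (elim conjE, intro covariant_tensor_cong[of 2 \<beta>]) (auto simp: less_2_cases_iff)
    then show ?thesis by (simp add: c_map_def form_act_2)
  qed
  have ip: "P.A2 y z (\<eta> p) \<bullet> c_map M \<eta> p \<beta> =
      \<beta> (nth [y, z]) + star M p 6 (wedge 2 4 \<beta> (spin7_form M \<eta> p)) (nth [y, z])" if \<beta>: "exterior_form 2 \<beta>" for \<beta> y z
  proof -
    have ct: "covariant_tensor 2 \<beta>" using \<beta> by (simp add: exterior_form_def)
    let ?b = "\<lambda>v w. \<beta> (nth [v, w])"
    have "linear (\<lambda>w. ?b v w)" for v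
    proof -
      have "?b v w = \<beta> ((nth [v, 0])(1 := w))" for w
        by (rule covariant_tensor_cong[OF ct]) (auto simp: less_2_cases_iff)
      then show ?thesis using covariant_tensor_linear[OF ct, of 1 "nth [v, 0]"] by (simp only:)
    qed
    moreover have "linear (\<lambda>v. ?b v w)" for w
    proof -
      have "?b v w = \<beta> ((nth [0, w])(0 := v))" for v
        by (rule covariant_tensor_cong[OF ct]) (auto simp: less_2_cases_iff)
      then show ?thesis using covariant_tensor_linear[OF ct, of 0 "nth [0, w]"] by (simp only:)
    qed
    ultimately have bil: "bilinear ?b" by (simp add: bilinear_def)
    have anti: "?b v w = - ?b w v" for v w
    proof -
      have "\<beta> (nth [w, v] \<circ> Transposition.transpose 0 1) = - ?b w v"
        by (rule exterior_form_transpose[OF \<beta>]) auto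
      moreover have "\<beta> (nth [w, v] \<circ> Transposition.transpose 0 1) = ?b v w"
        by (rule covariant_tensor_cong[OF ct]) (auto simp: less_2_cases_iff Transposition.transpose_def)
      ultimately show ?thesis by simp
    qed
    show ?thesis
      unfolding c[OF \<beta>] P.A2_inner_form[OF bil anti] spin7_form_eq P.hodge_wedge_2[OF ct] by simp
  qed
  have "inj_on (c_map M \<eta> p) (Lambda2_7 M \<eta> p)"
  proof (rule inj_onI)
    fix \<beta> \<beta>' assume b: "\<beta> \<in> Lambda2_7 M \<eta> p" "\<beta>' \<in> Lambda2_7 M \<eta> p" and eq: "c_map M \<eta> p \<beta> = c_map M \<eta> p \<beta>'"
    have 4: "P.A2 y z (\<eta> p) \<bullet> c_map M \<eta> p \<alpha> = 4 * \<alpha> (nth [y, z])" if "\<alpha> \<in> Lambda2_7 M \<eta> p" for \<alpha> y z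
      using that ip[of \<alpha> y z] by (simp add: Lambda2_7_def)
    show "\<beta> = \<beta>'"
    proof
      fix X
      have "\<alpha> X = \<alpha> (nth [X 0, X 1])" if "\<alpha> \<in> Lambda2_7 M \<eta> p" for \<alpha>
        using that unfolding Lambda2_7_def exterior_form_def mem_Collect_eq
        by (elim conjE, intro covariant_tensor_cong[of 2 \<alpha>]) (auto simp: less_2_cases_iff)
      then show "\<beta> X = \<beta>' X" using 4[OF b(1)] 4[OF b(2)] eq b by (metis mult_cancel_left zero_neq_numeral)
    qed
  qed
  moreover have ext: "exterior_form 2 ?\<beta>"
    using exterior_form_scale[OF P.exterior_form_aprod[of 2 "\<eta> p" ?\<phi>], of "1 / 4"] by (simp add: P.aprod_2)
  moreover have cb: "c_map M \<eta> p ?\<beta> = ?\<phi>"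
    unfolding c[OF ext] using P.c_inverse_formula[OF P.positive_N P.orth_N, of v] by simp
  moreover have "?\<beta> \<in> Lambda2_7 M \<eta> p"
  proof -
    have ct: "covariant_tensor 2 ?\<beta>" using ext by (simp add: exterior_form_def)
    \<comment> \<open>By its definition 4 \<open>?\<beta>\<close> is the pairing of
      \<open>A2\<close> on \<eta> with the spinor, and that spinor is c(\<open>?\<beta>\<close>). So
      \<open>ip\<close> reads 4 \<open>?\<beta>\<close> = \<open>?\<beta>\<close> + star, and the
      star is 3 \<open>?\<beta>\<close>.\<close>
    have "star M p 6 (wedge 2 4 ?\<beta> (spin7_form M \<eta> p)) X = 3 * ?\<beta> X" for X
    proof -
      have "star M p 6 (wedge 2 4 ?\<beta> (spin7_form M \<eta> p)) X = star M p 6 (wedge 2 4 ?\<beta> (spin7_form M \<eta> p)) (nth [X 0, X 1])"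
        unfolding spin7_form_eq P.hodge_wedge_2[OF ct] by simp
      then show ?thesis using ip[OF ext, of "X 0" "X 1", unfolded cb] by simp
    qed
    then show ?thesis using ext by (simp add: Lambda2_7_def fun_eq_iff)
  qed
  ultimately show ?thesis unfolding c_inv_def by (intro inv_into_f_eq)
qed

text \<open>Skewness in the last two arguments merges the six permutations into three pairs, and 1/6
  * 2 * 1/4 = 1/12.\<close>

lemma alt_c_inv_nabla:
  "alt 3 (c_inv_nabla M nab \<eta> p) X = (1 / 12) *
    (spin_space.A2 (cliff M p) (X 1) (X 2) (\<eta> p) \<bullet> spin_nabla M nab p (X 0) \<eta>
     - spin_space.A2 (cliff M p) (X 0) (X 2) (\<eta> p) \<bullet> spin_nabla M nab p (X 1) \<eta>
     + spin_space.A2 (cliff M p) (X 0) (X 1) (\<eta> p) \<bullet> spin_nabla M nab p (X 2) \<eta>)"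
proof -
  interpret P: positive_spinor_derivative "metric M p" "frame_at M p" "cliff M p" "\<eta> p" "\<lambda>v. spin_nabla M nab p v \<eta>"
    by (rule derivative_here)
  have e: "c_inv_nabla M nab \<eta> p = (\<lambda>X. (\<lambda>u v w. 1 / 4 * (P.A2 v w (\<eta> p) \<bullet> spin_nabla M nab p u \<eta>)) (X 0) (X 1) (X 2))"
    by (simp add: c_inv_nabla_def c_inv_spin_nabla fun_eq_iff numeral_2_eq_2)
  have s: "P.A2 v w (\<eta> p) \<bullet> \<phi> = - (P.A2 w v (\<eta> p) \<bullet> \<phi>)" for v w \<phi>
    by (simp add: P.A2_def inner_diff_left field_simps)
  show ?thesis
    unfolding e alt_3[of "\<lambda>u v w. 1 / 4 * (P.A2 v w (\<eta> p) \<bullet> spin_nabla M nab p u \<eta>)" X]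
    using s[of "X 2" "X 1" "spin_nabla M nab p (X 0) \<eta>"]
      s[of "X 2" "X 0" "spin_nabla M nab p (X 1) \<eta>"] s[of "X 1" "X 0" "spin_nabla M nab p (X 2) \<eta>"]
    by (simp add: field_simps)
qed

text \<open>By \<open>alt_c_inv_nabla\<close> the bracket in \<open>star_d_eq\<close> is 12 times
  the alternation, and it carries the factor -2.\<close>

lemma star_d_form_formula:
  assumes "dirac M nab \<eta> p = cliff M p V (\<eta> p)"
  shows "star_d_form M \<eta> p X = 2 * contract V (spin7_form M \<eta> p) X - 24 * alt 3 (c_inv_nabla M nab \<eta> p) X"
proof -
  interpret P: positive_spinor_derivative "metric M p" "frame_at M p" "cliff M p" "\<eta> p" "\<lambda>v. spin_nabla M nab p v \<eta>"
    by (rule derivative_here)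
  have "contract V (spin7_form M \<eta> p) X = P.A3 (X 0) (X 1) (X 2) (\<eta> p) \<bullet> P.D"
    by (simp add: contract_def spin7_form_eq P.Om_def numeral_2_eq_2 numeral_3_eq_3 assms flip: dirac_eq)
  then show ?thesis
    unfolding star_d_form_eq P.star_d_eq alt_c_inv_nabla by (simp add: field_simps)
qed

end

theorem theorem1p1:
  fixes M :: "('m::{t2_space, second_countable_topology}, 'i) spin_mfd"
    and nab :: "'m connection"
    and \<eta> :: "'m spinor_field"
    and V :: "'m \<Rightarrow> real^8"
  assumes "spin_manifold M"
    and "levi_civita M nab"
    and "smooth_spinor_field M \<eta>"
    and "\<And>p. \<eta> p \<in> positive_spinors M"
    and "\<And>p. norm (\<eta> p) = 1"
    and "smooth_vector_field_on M UNIV V"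
    and "\<And>p. dirac M nab \<eta> p = cliff M p (V p) (\<eta> p)"
  shows "((\<forall>p v. spin_nabla M nab p v \<eta> = 0) \<longrightarrow> spin7_parallel M \<eta>) \<and>
         ((\<forall>p. contract (V p) (spin7_form M \<eta> p) = (\<lambda>X. 28 * alt 3 (c_inv_nabla M nab \<eta> p) X))
            \<longrightarrow> spin7_locally_conformally_parallel M \<eta>) \<and>
         ((\<forall>p. dirac M nab \<eta> p = 0) \<longrightarrow> spin7_balanced M \<eta>)"
proof -
  interpret spin7_connection M \<eta> nab
    by unfold_locales (fact assms)+
  show ?thesis
  proof (intro conjI impI)
    assume 0: "\<forall>p v. spin_nabla M nab p v \<eta> = 0"
    show "spin7_parallel M \<eta>"
      unfolding spin7_parallel_def
    proof
      fix p
      interpret P: positive_spinor_derivative "metric M p" "frame_at M p" "cliff M p" "\<eta> p" "\<lambda>v. spin_nabla M nab p v \<eta>"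
        by (rule derivative_here)
      show "star_d_form M \<eta> p = (\<lambda>X. 0)"
        unfolding star_d_form_eq P.star_d_def by (simp add: 0)
    qed
  next
    assume lcp: "\<forall>p. contract (V p) (spin7_form M \<eta> p) = (\<lambda>X. 28 * alt 3 (c_inv_nabla M nab \<eta> p) X)"
    show "spin7_locally_conformally_parallel M \<eta>"
      unfolding spin7_locally_conformally_parallel_def
    proof
      fix p
      interpret P: positive_spinor_derivative "metric M p" "frame_at M p" "cliff M p" "\<eta> p" "\<lambda>v. spin_nabla M nab p v \<eta>"
        by (rule derivative_here)
      \<comment> \<open>Under the hypothesis 24 \<open>alt\<close> is 24/28 of the contraction, and
        2 - 24/28 = 8/7; linearity of \<Omega> in its first slot absorbs the factor into the
        vector.\<close>
      have "star_d_form M \<eta> p = contract ((8 / 7) *\<^sub>R V p) (spin7_form M \<eta> p)"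
      proof
        fix X
        have "contract (V p) (spin7_form M \<eta> p) X = 28 * alt 3 (c_inv_nabla M nab \<eta> p) X"
          using fun_cong[OF lcp[rule_format, of p]] by simp
        then have "star_d_form M \<eta> p X = 8 / 7 * contract (V p) (spin7_form M \<eta> p) X"
          unfolding star_d_form_formula[OF assms(7)] by simp
        also have "\<dots> = contract ((8 / 7) *\<^sub>R V p) (spin7_form M \<eta> p) X"
          by (simp add: contract_def spin7_form_eq linear_cmul[OF P.linear_Om])
        finally show "star_d_form M \<eta> p X = contract ((8 / 7) *\<^sub>R V p) (spin7_form M \<eta> p) X" .
      qed
      then show "star_d_form M \<eta> p \<in> Lambda3_8 M \<eta> p" unfolding Lambda3_8_def by blast
    qed
  next
    assume 0: "\<forall>p. dirac M nab \<eta> p = 0"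
    show "spin7_balanced M \<eta>"
      unfolding spin7_balanced_def
    proof
      fix p
      interpret P: positive_spinor_derivative "metric M p" "frame_at M p" "cliff M p" "\<eta> p" "\<lambda>v. spin_nabla M nab p v \<eta>"
        by (rule derivative_here)
      have "P.D = 0" using 0 by (simp flip: dirac_eq)
      from P.star_d_wedge_Om[OF this] P.exterior_form_star_d
      show "star_d_form M \<eta> p \<in> Lambda3_48 M \<eta> p"
        by (simp only: Lambda3_48_def mem_Collect_eq star_d_form_eq spin7_form_eq simp_thms)
    qed
  qed
qed

end
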